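(* Let $A$ be a unital $\mathrm{C}^*$-algebra and let $I$ be a separable two-sided closed ideal of $A$. Then the group $\mathcal{U}_I(A)=\{u\in \mathcal{U}(A)\mid u-1\in I\}$ equipped with the norm topology is SUR if and only if $I$ is finite-dimensional.
   Context: $\mathcal{U}(A)$ is the unitary group of $A$. Separable means norm-separable. A Hausdorff topological group $G$ is strongly unitarily representable (SUR) if $G$ is isomorphic as a topological group to a closed subgroup of the unitary group $\mathcal{U}(H)$ of some (complex) Hilbert space $H$, where $\mathcal{U}(H)$ is equipped with the strong operator topology. *)

theory Defs
  imports "HOL-Analysis.Analysis" "HOL-Algebra.Algebraic_Closure_Type" "HOL-Algebra.Bij"
begin

section \<open>Unital C*-algebras\<close>

class scaleC =
  fixes scaleC :: "complex \<Rightarrow> 'a \<Rightarrow> 'a"  (infixr \<open>*\<^sub>C\<close> 75)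

class complex_vector = scaleC + ab_group_add +
  assumes scaleC_add_right: "a *\<^sub>C (x + y) = a *\<^sub>C x + a *\<^sub>C y"
    and scaleC_add_left: "(a + b) *\<^sub>C x = a *\<^sub>C x + b *\<^sub>C x"
    and scaleC_scaleC: "a *\<^sub>C b *\<^sub>C x = (a * b) *\<^sub>C x"
    and scaleC_one: "1 *\<^sub>C x = x"

global_interpretation complex_vector: vector_space "scaleC :: complex \<Rightarrow> 'a \<Rightarrow> 'a::complex_vector"
  by unfold_locales (simp_all add: scaleC_add_right scaleC_add_left scaleC_scaleC scaleC_one)

text \<open>
  The classes \<open>real_normed_algebra_1\<close> and \<open>banach\<close> make the algebra a real unital Banach algebra
  with \<open>norm 1 = 1\<close> (hence nonzero); the remaining axioms add the compatible complex scalars and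
  the involution.
\<close>

class unital_cstar_algebra = complex_vector + real_normed_algebra_1 + banach +
  fixes adj :: "'a \<Rightarrow> 'a"
  assumes scaleR_scaleC: "r *\<^sub>R x = complex_of_real r *\<^sub>C x"
    and norm_scaleC: "norm (a *\<^sub>C x) = cmod a * norm x"
    and mult_scaleC_left: "(a *\<^sub>C x) * y = a *\<^sub>C (x * y)"
    and mult_scaleC_right: "x * (a *\<^sub>C y) = a *\<^sub>C (x * y)"
    and adj_add: "adj (x + y) = adj x + adj y"
    and adj_scaleC: "adj (a *\<^sub>C x) = cnj a *\<^sub>C adj x"
    and adj_mult: "adj (x * y) = adj y * adj x"
    and adj_adj: "adj (adj x) = x"
    and cstar_identity: "norm (adj x * x) = (norm x)\<^sup>2"

definition closed_two_sided_ideal :: "'a::unital_cstar_algebra set \<Rightarrow> bool" where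
  "closed_two_sided_ideal I \<longleftrightarrow>
     closed I \<and> complex_vector.subspace I \<and> (\<forall>a. \<forall>x\<in>I. a * x \<in> I \<and> x * a \<in> I)"

definition finite_dimensional :: "'a::complex_vector set \<Rightarrow> bool" where
  "finite_dimensional V \<longleftrightarrow> (\<exists>B. finite B \<and> V = complex_vector.span B)"

definition unitaries :: "'a::unital_cstar_algebra set" where
  "unitaries = {u. adj u * u = 1 \<and> u * adj u = 1}"

definition ideal_unitary_group :: "'a::unital_cstar_algebra set \<Rightarrow> 'a monoid" where
  "ideal_unitary_group I =
     \<lparr>carrier = {u \<in> unitaries. u - 1 \<in> I}, monoid.mult = (*), one = 1\<rparr>"


section \<open>Hilbert spaces on carrier sets and their unitary groups\<close>

text \<open>
  The notion of a strongly unitarily representable group quantifies existentially over Hilbert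
  spaces, so these are structures on an explicit carrier set rather than a type class.  The fields
  \<open>mult\<close> and \<open>one\<close> inherited from the library record for modules are irrelevant.
\<close>

record 'h inner_module = "(complex, 'h) module" +
  cinner :: "'h \<Rightarrow> 'h \<Rightarrow> complex"

text \<open>Outside the carrier the distance is set to 0, because \<open>Metric_space\<close> requires
  nonnegativity and symmetry everywhere.\<close>

definition hdist :: "'h inner_module \<Rightarrow> 'h \<Rightarrow> 'h \<Rightarrow> real" where
  "hdist H x y =
     (if x \<in> carrier H \<and> y \<in> carrier H
      then sqrt (Re (cinner H (x \<ominus>\<^bsub>H\<^esub> y) (x \<ominus>\<^bsub>H\<^esub> y))) else 0)"

text \<open>The inner product is linear in its first argument.\<close>

locale complex_hilbert_space =
  Module.module "ring_of_type_algebra :: complex ring" H for H :: "'h inner_module" (structure) +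
  assumes cinner_add_left:
      "\<lbrakk>x \<in> carrier H; y \<in> carrier H; z \<in> carrier H\<rbrakk>
        \<Longrightarrow> cinner H (x \<oplus>\<^bsub>H\<^esub> y) z = cinner H x z + cinner H y z"
    and cinner_smult_left:
      "\<lbrakk>x \<in> carrier H; y \<in> carrier H\<rbrakk> \<Longrightarrow> cinner H (c \<odot>\<^bsub>H\<^esub> x) y = c * cinner H x y"
    and cinner_commute:
      "\<lbrakk>x \<in> carrier H; y \<in> carrier H\<rbrakk> \<Longrightarrow> cinner H y x = cnj (cinner H x y)"
    and cinner_nonneg: "x \<in> carrier H \<Longrightarrow> 0 \<le> Re (cinner H x x)"
    and cinner_definite: "\<lbrakk>x \<in> carrier H; cinner H x x = 0\<rbrakk> \<Longrightarrow> x = \<zero>\<^bsub>H\<^esub>"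
    and complete: "Metric_space.mcomplete (carrier H) (hdist H)"

text \<open>Unitary operators are the bijective linear maps that preserve the inner product; as members
  of \<open>Bij\<close> they are extensional on the carrier.\<close>

definition unitary_operators :: "'h inner_module \<Rightarrow> ('h \<Rightarrow> 'h) set" where
  "unitary_operators H =
     {U \<in> Bij (carrier H).
        (\<forall>x\<in>carrier H. \<forall>y\<in>carrier H. U (x \<oplus>\<^bsub>H\<^esub> y) = U x \<oplus>\<^bsub>H\<^esub> U y) \<and>
        (\<forall>c. \<forall>x\<in>carrier H. U (c \<odot>\<^bsub>H\<^esub> x) = c \<odot>\<^bsub>H\<^esub> U x) \<and>
        (\<forall>x\<in>carrier H. \<forall>y\<in>carrier H. cinner H (U x) (U y) = cinner H x y)}"

definition unitary_group :: "'h inner_module \<Rightarrow> ('h \<Rightarrow> 'h) monoid" where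
  "unitary_group H = (BijGroup (carrier H))\<lparr>carrier := unitary_operators H\<rparr>"

text \<open>The strong operator topology is the topology of pointwise convergence in norm.\<close>

definition strong_operator_topology :: "'h inner_module \<Rightarrow> ('h \<Rightarrow> 'h) topology" where
  "strong_operator_topology H =
     subtopology
       (product_topology (\<lambda>_. Metric_space.mtopology (carrier H) (hdist H)) (carrier H))
       (unitary_operators H)"


section \<open>Strongly unitarily representable groups\<close>

definition hausdorff_topological_group :: "'g monoid \<Rightarrow> 'g topology \<Rightarrow> bool" where
  "hausdorff_topological_group G T \<longleftrightarrow>
     group G \<and> topspace T = carrier G \<and> Hausdorff_space T \<and>
     continuous_map (prod_topology T T) T (\<lambda>(x, y). x \<otimes>\<^bsub>G\<^esub> y) \<and>
     continuous_map T T (\<lambda>x. inv\<^bsub>G\<^esub> x)"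

text \<open>
  HOL cannot quantify existentially over types, so the type \<open>'h\<close> that hosts the carrier of the
  Hilbert space is a parameter.  A Hilbert space of any dimension is available once \<open>'h\<close> is large
  enough.
\<close>

definition strongly_unitarily_representable ::
    "'h itself \<Rightarrow> 'g monoid \<Rightarrow> 'g topology \<Rightarrow> bool" where
  "strongly_unitarily_representable (_ :: 'h itself) G T \<longleftrightarrow>
     hausdorff_topological_group G T \<and>
     (\<exists>(H :: 'h inner_module) K \<phi>.
        complex_hilbert_space H \<and>
        subgroup K (unitary_group H) \<and>
        closedin (strong_operator_topology H) K \<and>
        \<phi> \<in> iso G ((unitary_group H)\<lparr>carrier := K\<rparr>) \<and>
        homeomorphic_map T (subtopology (strong_operator_topology H) K) \<phi>)"

end

theory Submission
  imports Defs
begin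

text \<open>
  Suppose first that the group is represented and that \<open>I\<close> is infinite-dimensional.  Then \<open>I\<close>
  contains a copy of \<open>c\<^sub>0\<close>: commuting self-adjoint elements \<open>h\<^sub>0, h\<^sub>1, \<dots>\<close> that stay away from
  \<open>0\<close>, with the norm of \<open>\<Sum> c\<^sub>j h\<^sub>j\<close> bounded by a multiple of the largest \<open>\<bar>c\<^sub>j\<bar>\<close>.  A Hilbert space
  cannot accommodate it.  By continuity, all unitaries \<open>exp (\<i> \<Sum> \<plusminus> s h\<^sub>j)\<close>, for a small \<open>s\<close> and any
  number of summands, move a given vector \<open>\<xi>\<close> very little.  Averaging \<open>\<xi>\<close> over the signs one index at
  a time loses little norm in total, so by the parallelogram law most steps lose almost nothing,
  which means that \<open>exp (2 \<i> s h\<^sub>k)\<close> almost fixes the averaged vector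
  (\<open>some_coordinate_almost_fixes\<close>).  Hence \<open>exp (\<i> h\<^sub>k) \<xi>\<close> is close to \<open>\<xi>\<close> for almost all \<open>k\<close>
  (\<open>c0_sequence_almost_all_fix\<close>), and since finitely many vectors suffice to recognise a norm
  neighbourhood of \<open>1\<close>, the unitaries \<open>exp (\<i> h\<^sub>k)\<close> come arbitrarily close to \<open>1\<close> in norm, which they
  do not.

  The copy of \<open>c\<^sub>0\<close> consists of polynomials in one self-adjoint element of \<open>I\<close> with infinite spectrum,
  close to disjoint bumps on that spectrum (\<open>infinite_spectrum_c0_sequence\<close>).  The required
  functional calculus, the equality of the norm of \<open>p(x)\<close>, for self-adjoint \<open>x\<close>, with the
  maximum of \<open>\<bar>p\<bar>\<close> on the spectrum, is derived from the C*-identity (\<open>norm_cpeval_selfadjoint\<close>).  If all self-adjoint elements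
  of \<open>I\<close> have finite spectrum, there are no infinite sequences of nonzero orthogonal projections in \<open>I\<close>, so
  finitely many orthogonal minimal projections \<open>p\<close> add up to a unit of \<open>I\<close>
  (\<open>exists_total_minimal_family\<close>), and \<open>I\<close> is a finite sum of the at most one-dimensional
  spaces \<open>pIq\<close>.

  Conversely, a finite-dimensional \<open>I\<close> has such a family of minimal projections.  Writing
  \<open>p y p = \<tau>\<^sub>p(y) p\<close>, the form \<open>\<langle>x, y\<rangle> = \<Sum>\<^sub>p \<tau>\<^sub>p(y\<^sup>* x)\<close> is an inner product on \<open>I\<close> with
  \<open>\<langle>x, x\<rangle> = \<Sum>\<^sub>p \<parallel>xp\<parallel>\<^sup>2\<close>, so it is complete and equivalent to the norm.  The unitaries act on
  this Hilbert space by left multiplication; the range consists of all unitary operators that commute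
  with right multiplications, which is strongly closed, and evaluation at the unit of \<open>I\<close> is a
  continuous inverse (\<open>left_regular_homeomorphic_map\<close>).  Separability of \<open>I\<close> ensures that \<open>I\<close> fits into
  the type that hosts the Hilbert space.
\<close>


section \<open>The involution\<close>

lemma adj_zero [simp]: "adj (0::'a::unital_cstar_algebra) = 0"
  using adj_add[of "0::'a" 0] by simp

lemma adj_minus: "adj (- x) = - adj (x::'a::unital_cstar_algebra)"
  using adj_add[of x "-x"] by (simp add: eq_neg_iff_add_eq_0 add.commute)

lemma adj_diff: "adj (x - y) = adj x - adj (y::'a::unital_cstar_algebra)"
  using adj_add[of x "-y"] by (simp add: adj_minus)

lemma adj_one [simp]: "adj (1::'a::unital_cstar_algebra) = 1"
  by (metis adj_adj adj_mult mult.right_neutral mult_1)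

lemma adj_sum: "adj (sum f A) = (\<Sum>i\<in>A. adj (f i :: 'a::unital_cstar_algebra))"
  by (induction A rule: infinite_finite_induct) (auto simp: adj_add)

lemma adj_power: "adj (x ^ n) = adj (x::'a::unital_cstar_algebra) ^ n"
  by (induction n) (auto simp: adj_mult power_commutes)

lemma norm_adj [simp]: "norm (adj x) = norm (x::'a::unital_cstar_algebra)"
proof -
  have *: "norm x \<le> norm (adj x)" for x :: 'a
  proof (cases "x = 0")
    case False
    have "norm x * norm x \<le> norm (adj x) * norm x"
      using norm_mult_ineq[of "adj x" x] cstar_identity[of x] by (simp add: power2_eq_square)
    then show ?thesis using False by simp
  qed simp
  from *[of x] *[of "adj x"] show ?thesis by (simp add: adj_adj)
qed

lemma cstar_zero_iff: "adj x * x = 0 \<longleftrightarrow> x = (0::'a::unital_cstar_algebra)"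
  using cstar_identity[of x] by (metis adj_zero mult_zero_right norm_eq_zero zero_eq_power2)

lemma bounded_linear_adj: "bounded_linear (adj :: 'a::unital_cstar_algebra \<Rightarrow> 'a)"
  by (rule bounded_linear_intro[where K = 1]) (auto simp: adj_add scaleR_scaleC adj_scaleC)

lemma selfadjoint_norm_square:
  "adj x = x \<Longrightarrow> norm (x * x) = (norm (x::'a::unital_cstar_algebra))\<^sup>2"
  using cstar_identity[of x] by simp

lemma selfadjoint_norm_power2n:
  assumes "adj x = (x::'a::unital_cstar_algebra)"
  shows "norm (x ^ (2 ^ n)) = norm x ^ (2 ^ n)"
proof (induction n)
  case (Suc n)
  have "norm (x ^ (2 ^ Suc n)) = norm (x ^ 2 ^ n * x ^ 2 ^ n)"
    by (simp add: mult_2 power_add)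
  also have "\<dots> = (norm (x ^ 2 ^ n))\<^sup>2"
    by (rule selfadjoint_norm_square) (simp add: adj_power assms)
  finally show ?case by (simp add: Suc power2_eq_square mult_2 power_add)
qed simp


section \<open>Polynomials in an element\<close>

text \<open>
  Values of complex polynomials at an element of the algebra, by Horner's scheme with the coefficients
  acting as scalars; \<open>poly\<close> itself evaluates only in a commutative ring containing the coefficients.
\<close>

definition cpeval :: "complex poly \<Rightarrow> 'a::unital_cstar_algebra \<Rightarrow> 'a" where
  "cpeval p x = fold_coeffs (\<lambda>a b. a *\<^sub>C 1 + x * b) p 0"

lemma cpeval_0 [simp]: "cpeval 0 x = 0"
  by (simp add: cpeval_def)

lemma cpeval_pCons [simp]: "cpeval (pCons a p) x = a *\<^sub>C 1 + x * cpeval p x"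
  by (cases "p = 0 \<and> a = 0") (auto simp: cpeval_def)

lemma cpeval_1 [simp]: "cpeval 1 x = 1"
  by (simp add: one_pCons scaleC_one)

lemma cpeval_add: "cpeval (p + q) x = cpeval p x + cpeval q x"
  by (induction p q rule: poly_induct2) (auto simp: scaleC_add_left algebra_simps)

lemma cpeval_smult: "cpeval (Polynomial.smult c p) x = c *\<^sub>C cpeval p x"
  by (induction p) (auto simp: scaleC_add_right scaleC_scaleC mult_scaleC_right)

lemma cpeval_minus: "cpeval (- p) x = - cpeval p x"
  using cpeval_smult[of "-1" p x] by (simp add: scaleC_one)

lemma cpeval_diff: "cpeval (p - q) x = cpeval p x - cpeval q x"
  using cpeval_add[of p "-q" x] by (simp add: cpeval_minus)

lemma cpeval_mult: "cpeval (p * q) x = cpeval p x * cpeval q x"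
  by (induction p)
    (auto simp: cpeval_add cpeval_smult scaleC_one mult_scaleC_left algebra_simps)

lemma cpeval_monom: "cpeval (Polynomial.monom c n) x = c *\<^sub>C x ^ n"
  by (induction n) (auto simp: monom_0 monom_Suc mult_scaleC_right)

lemma cpeval_sum: "cpeval (sum f A) x = (\<Sum>i\<in>A. cpeval (f i) x)"
  by (induction A rule: infinite_finite_induct) (auto simp: cpeval_add)

lemma cpeval_commute: "cpeval p x * cpeval q x = cpeval q x * cpeval p x"
  by (metis cpeval_mult mult.commute)

lemma map_poly_cnj:
  "map_poly cnj (p * q) = map_poly cnj p * map_poly cnj q"
  "map_poly cnj (p + q) = map_poly cnj p + map_poly cnj q"
  "map_poly cnj (p - q) = map_poly cnj p - map_poly cnj q"
  by (simp_all add: poly_eq_iff coeff_map_poly coeff_mult)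

lemma adj_cpeval:
  assumes "adj x = x"
  shows "adj (cpeval p x) = cpeval (map_poly cnj p) x"
proof (induction p)
  case (pCons a p)
  have "adj (cpeval p x) * x = x * adj (cpeval p x)"
    using cpeval_commute[of "map_poly cnj p" x "[:0,1:]"] by (simp add: pCons.IH scaleC_one)
  then show ?case
    by (simp add: pCons.IH adj_add adj_scaleC adj_mult assms map_poly_pCons)
qed simp

text \<open>
  The C*-identity turns the squared norm of an arbitrary polynomial in a self-adjoint \<open>x\<close> into the norm of
  the real polynomial \<open>cnj p * p\<close>, whose value is self-adjoint.
\<close>

lemma norm_cpeval_sq:
  assumes "adj x = x"
  shows "(norm (cpeval p x))\<^sup>2 = norm (cpeval (map_poly cnj p * p) x)"
  using cstar_identity[of "cpeval p x"] by (simp add: cpeval_mult adj_cpeval assms)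


section \<open>Spectra and the polynomial functional calculus\<close>

definition unit_elem :: "'a::monoid_mult \<Rightarrow> bool" where
  "unit_elem x \<longleftrightarrow> (\<exists>y. x * y = 1 \<and> y * x = 1)"

definition spectrum :: "'a::unital_cstar_algebra \<Rightarrow> complex set" where
  "spectrum x = {\<mu>. \<not> unit_elem (x - \<mu> *\<^sub>C 1)}"

lemma unit_elem_mult: "unit_elem x \<Longrightarrow> unit_elem y \<Longrightarrow> unit_elem (x * y)"
  unfolding unit_elem_def by (metis mult.assoc mult.left_neutral)

lemma unit_elem_mult_commuteD:
  assumes "x * y = y * x" "unit_elem (x * y)"
  shows "unit_elem x"
proof -
  obtain z where "x * y * z = 1" "z * (x * y) = 1"
    using assms unfolding unit_elem_def by blast
  then have "x * (y * z) = 1" "(z * y) * x = 1"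
    using assms(1) by (metis mult.assoc)+
  then show ?thesis
    unfolding unit_elem_def by (metis mult.assoc mult.left_neutral mult.right_neutral)
qed

lemma unit_elem_scaleC:
  assumes "c \<noteq> 0" "unit_elem x"
  shows "unit_elem (c *\<^sub>C (x::'a::unital_cstar_algebra))"
proof -
  obtain y where y: "x * y = 1" "y * x = 1" using assms(2) unfolding unit_elem_def by blast
  show ?thesis unfolding unit_elem_def
    by (rule exI[of _ "inverse c *\<^sub>C y"])
      (simp add: y assms(1) mult_scaleC_left mult_scaleC_right scaleC_scaleC scaleC_one)
qed

lemma unit_elem_one: "unit_elem 1"
  by (auto simp: unit_elem_def)

lemma not_unit_elem_0: "\<not> unit_elem (0::'a::unital_cstar_algebra)"
  by (auto simp: unit_elem_def)

lemma unit_elem_one_minus: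
  fixes x :: "'a::unital_cstar_algebra"
  assumes "norm x < 1"
  shows "unit_elem (1 - x)"
proof -
  have s: "summable (\<lambda>n. x ^ n)" by (rule complete_algebra_summable_geometric[OF assms])
  have t: "(\<lambda>n. x ^ n - x ^ Suc n) sums (x ^ 0 - 0)"
    by (rule telescope_sums'[OF summable_LIMSEQ_zero[OF s]])
  have "(\<lambda>n. (1 - x) * x ^ n) sums ((1 - x) * suminf (\<lambda>n. x ^ n))"
    by (rule sums_mult[OF summable_sums[OF s]])
  moreover have "(\<lambda>n. (1 - x) * x ^ n) = (\<lambda>n. x ^ n - x ^ Suc n)"
    by (simp add: algebra_simps)
  ultimately have 1: "(1 - x) * suminf (\<lambda>n. x ^ n) = 1"
    using t sums_unique2 by fastforce
  have "(\<lambda>n. x ^ n * (1 - x)) sums (suminf (\<lambda>n. x ^ n) * (1 - x))"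
    by (rule sums_mult2[OF summable_sums[OF s]])
  moreover have "(\<lambda>n. x ^ n * (1 - x)) = (\<lambda>n. x ^ n - x ^ Suc n)"
    by (simp add: algebra_simps power_commutes)
  ultimately have "suminf (\<lambda>n. x ^ n) * (1 - x) = 1"
    using t sums_unique2 by fastforce
  with 1 show ?thesis unfolding unit_elem_def by blast
qed

lemma norm_scaleC_one [simp]: "norm (c *\<^sub>C (1::'a::unital_cstar_algebra)) = cmod c"
  by (simp add: norm_scaleC)

lemma spectrum_norm_le:
  assumes "\<mu> \<in> spectrum x"
  shows "cmod \<mu> \<le> norm x"
proof (rule ccontr)
  assume "\<not> cmod \<mu> \<le> norm x"
  then have l: "norm x < cmod \<mu>" "\<mu> \<noteq> 0"
    by auto
  have "unit_elem (1 - inverse \<mu> *\<^sub>C x)"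
    by (rule unit_elem_one_minus) (use l in \<open>simp add: norm_scaleC norm_divide field_simps\<close>)
  then have "unit_elem ((- \<mu>) *\<^sub>C (1 - inverse \<mu> *\<^sub>C x))"
    using l by (intro unit_elem_scaleC) auto
  then show False
    using assms l
    by (simp add: spectrum_def complex_vector.scale_right_diff_distrib scaleC_scaleC scaleC_one)
qed

text \<open>
  Half of the spectral mapping theorem: \<open>x - \<mu>\<close> is a factor of \<open>p(x) - p(\<mu>)\<close> that commutes with the
  cofactor.
\<close>

lemma spectrum_cpeval:
  assumes "\<mu> \<in> spectrum x"
  shows "poly p \<mu> \<in> spectrum (cpeval p x)"
proof -
  have "poly (p - [:poly p \<mu>:]) \<mu> = 0" by simp
  then obtain q where q: "p - [:poly p \<mu>:] = [:-\<mu>, 1:] * q"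
    by (metis poly_eq_0_iff_dvd dvdE)
  have "cpeval p x - poly p \<mu> *\<^sub>C 1 = cpeval (p - [:poly p \<mu>:]) x"
    by (simp add: cpeval_diff)
  also have "\<dots> = (x - \<mu> *\<^sub>C 1) * cpeval q x"
    unfolding q cpeval_mult by (simp add: scaleC_one)
  finally have e: "cpeval p x - poly p \<mu> *\<^sub>C 1 = (x - \<mu> *\<^sub>C 1) * cpeval q x" .
  have "(x - \<mu> *\<^sub>C 1) * cpeval q x = cpeval q x * (x - \<mu> *\<^sub>C 1)"
    using cpeval_commute[of "[:-\<mu>, 1:]" x q] by (simp add: scaleC_one)
  then show ?thesis
    using assms unit_elem_mult_commuteD unfolding spectrum_def e[symmetric]
    by (metis (mono_tags, lifting) e mem_Collect_eq)
qed

text \<open>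
  The other half: over the complex numbers \<open>p(x)\<close> is a product of factors \<open>x - \<mu>\<close>, one of which is
  singular if \<open>p(x)\<close> is.
\<close>

lemma not_unit_cpeval_root:
  assumes "p \<noteq> 0" "\<not> unit_elem (cpeval p x)"
  shows "\<exists>\<mu>\<in>spectrum x. poly p \<mu> = 0"
  using assms
proof (induction "Polynomial.degree p" arbitrary: p)
  case 0
  then obtain c where "p = [:c:]" "c \<noteq> 0"
    by (metis degree_eq_zeroE pCons_0_0)
  then show ?case using 0 by (simp add: unit_elem_scaleC unit_elem_one)
next
  case (Suc n)
  then have "\<not> constant (poly p)" by (metis constant_degree nat.simps(3))
  then obtain \<mu> where l: "poly p \<mu> = 0"
    using fundamental_theorem_of_algebra by blast
  then obtain q where q: "p = [:-\<mu>, 1:] * q"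
    by (metis poly_eq_0_iff_dvd dvdE)
  show ?case
  proof (cases "\<mu> \<in> spectrum x")
    case False
    then have "unit_elem (cpeval [:-\<mu>, 1:] x)" by (simp add: spectrum_def scaleC_one)
    then have "\<not> unit_elem (cpeval q x)"
      using Suc.prems(2) unit_elem_mult unfolding q cpeval_mult by blast
    moreover have "q \<noteq> 0" using q Suc.prems by auto
    moreover have "n = Polynomial.degree q" using Suc.hyps(2) \<open>q \<noteq> 0\<close> by (simp add: q degree_mult_eq del: mult_pCons_left)
    ultimately obtain \<nu> where "\<nu> \<in> spectrum x" "poly q \<nu> = 0" using Suc.hyps(1) by blast
    then show ?thesis by (auto simp: q simp del: mult_pCons_left)
  qed (use l in auto)
qed

text \<open>
  Arens' trick.  Translating by \<open>\<i>t\<close> moves a spectral value \<open>a + \<i>b\<close> to \<open>a + \<i>(b + t)\<close>, but raises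
  the square of the norm of a self-adjoint element by at most \<open>t\<^sup>2\<close>; the term \<open>2bt\<close> must therefore
  stay bounded.
\<close>

lemma selfadjoint_spectrum_real:
  assumes "adj x = x" "\<mu> \<in> spectrum x"
  shows "Im \<mu> = 0"
proof -
  define b where "b = Im \<mu>"
  define y where "y = x - complex_of_real (Re \<mu>) *\<^sub>C 1"
  have ay: "adj y = y" by (simp add: y_def adj_diff adj_scaleC assms)
  have main: "b\<^sup>2 + 2 * b * t \<le> (norm y)\<^sup>2" for t
  proof -
    define z where "z = y + (\<i> * of_real t) *\<^sub>C 1"
    have "z - (\<i> * of_real (b + t)) *\<^sub>C 1 = x - \<mu> *\<^sub>C 1"
    proof -
      have "\<mu> = of_real (Re \<mu>) + \<i> * of_real b" by (simp add: b_def complex_eq mult.commute)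
      then have "\<mu> *\<^sub>C 1 = of_real (Re \<mu>) *\<^sub>C 1 + (\<i> * of_real b) *\<^sub>C (1::'a)"
        by (metis scaleC_add_left)
      then show ?thesis
        unfolding z_def y_def by (simp add: ring_distribs scaleC_add_left)
    qed
    then have "\<i> * of_real (b + t) \<in> spectrum z" using assms(2) by (simp add: spectrum_def)
    then have "cmod (\<i> * of_real (b + t)) \<le> norm z" by (rule spectrum_norm_le)
    then have "\<bar>b + t\<bar> \<le> norm z" by (simp add: norm_mult del: of_real_add)
    then have "(b + t)\<^sup>2 \<le> (norm z)\<^sup>2" by (metis abs_le_square_iff abs_norm_cancel)
    also have "(norm z)\<^sup>2 = norm (adj z * z)" by (simp add: cstar_identity)
    also have "adj z * z = y * y + of_real (t\<^sup>2) *\<^sub>C 1"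
    proof -
      have "adj z = y - (\<i> * of_real t) *\<^sub>C 1"
        by (simp add: z_def adj_add adj_scaleC ay)
      moreover have "(\<i> * of_real t) * (\<i> * of_real t) = - complex_of_real (t\<^sup>2)"
        by (simp add: complex_eq_iff power2_eq_square)
      ultimately show ?thesis
        unfolding \<open>adj z = _\<close> unfolding z_def
        by (simp add: ring_distribs mult_scaleC_left mult_scaleC_right scaleC_scaleC
            complex_vector.scale_right_diff_distrib complex_vector.scale_minus_left)
    qed
    also have "norm \<dots> \<le> (norm y)\<^sup>2 + t\<^sup>2"
    proof -
      have "norm (of_real (t\<^sup>2) *\<^sub>C (1::'a)) = t\<^sup>2" by (simp only: norm_scaleC_one norm_of_real) simp
      then show ?thesis
        using norm_triangle_ineq[of "y * y" "of_real (t\<^sup>2) *\<^sub>C 1"] selfadjoint_norm_square[OF ay]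
        by simp
    qed
    finally show ?thesis by (simp add: power2_eq_square algebra_simps)
  qed
  show ?thesis
  proof (rule ccontr)
    assume "Im \<mu> \<noteq> 0"
    then have "b \<noteq> 0" by (simp add: b_def)
    with main[of "((norm y)\<^sup>2) / b"] have "b\<^sup>2 + (norm y)\<^sup>2 \<le> 0" by simp
    moreover have "b\<^sup>2 > 0" using \<open>b \<noteq> 0\<close> by simp
    ultimately show False by (smt (verit) zero_le_power2)
  qed
qed

text \<open>
  A substitute for \<open>1 + w\<^sup>2 \<ge> 2w\<close> that needs no order on the algebra: \<open>(1 + w\<^sup>2)g\<close> has the norm of
  the normal element \<open>c = (1 - w\<^sup>2)g + 2\<i>wg\<close>, whose imaginary part is \<open>2wg\<close>.
\<close>

lemma norm_square_plus_square_ge: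
  fixes x :: "'a::unital_cstar_algebra"
  assumes x: "adj x = x" and W: "map_poly cnj W = W" and G: "map_poly cnj G = G"
  shows "norm (cpeval ((1 + W * W) * G) x) \<ge> 2 * norm (cpeval (W * G) x)"
proof -
  define U where "U = (1 - W * W) * G"
  define V where "V = Polynomial.smult 2 (W * G)"
  have real: "map_poly cnj U = U" "map_poly cnj V = V"
    by (simp_all add: U_def V_def map_poly_cnj W G map_poly_smult)
  define u v where "u = cpeval U x" and "v = cpeval V x"
  have a: "adj u = u" "adj v = v" using real by (simp_all add: u_def v_def adj_cpeval x)
  have vu: "v * u = u * v" unfolding u_def v_def by (rule cpeval_commute)
  have "adj (u + \<i> *\<^sub>C v) * (u + \<i> *\<^sub>C v) = u * u + v * v"
    by (simp add: adj_add adj_scaleC a algebra_simps mult_scaleC_left mult_scaleC_right scaleC_scaleC vu scaleC_one)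
  also have "\<dots> = cpeval (U * U + V * V) x" by (simp add: u_def v_def cpeval_add cpeval_mult)
  also have "U * U + V * V = map_poly cnj ((1 + W * W) * G) * ((1 + W * W) * G)"
  proof -
    have "map_poly cnj ((1 + W * W) * G) = (1 + W * W) * G"
      by (simp add: map_poly_cnj W G)
    moreover have "V = (W * G) + (W * G)" unfolding V_def by (metis smult_add_left smult_1_left one_add_one)
    ultimately show ?thesis unfolding U_def by (simp add: algebra_simps)
  qed
  finally have e: "norm (u + \<i> *\<^sub>C v) = norm (cpeval ((1 + W * W) * G) x)"
    using norm_cpeval_sq[OF x, of "(1 + W * W) * G"] cstar_identity[of "u + \<i> *\<^sub>C v"]
    by (metis norm_ge_zero power2_eq_imp_eq)
  have "(u + \<i> *\<^sub>C v) - adj (u + \<i> *\<^sub>C v) = (2 * \<i>) *\<^sub>C v"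
    by (simp add: adj_add adj_scaleC a) (metis scaleC_add_left mult_2)
  then have "2 * norm v \<le> norm (u + \<i> *\<^sub>C v) + norm (adj (u + \<i> *\<^sub>C v))"
    using norm_triangle_ineq4[of "u + \<i> *\<^sub>C v" "adj (u + \<i> *\<^sub>C v)"]
    by (simp add: norm_scaleC norm_mult)
  then have "norm v \<le> norm (u + \<i> *\<^sub>C v)" by simp
  with e show ?thesis by (simp add: v_def V_def cpeval_smult norm_scaleC)
qed


lemma norm_power_selfadjoint_ge:
  assumes "adj x = (x::'a::unital_cstar_algebra)" "norm x = 1"
  shows "norm (x ^ k) \<ge> 1"
proof -
  have k: "k \<le> 2 ^ k" by (simp add: less_imp_le)
  have "1 = norm (x ^ (2 ^ k))" by (simp add: selfadjoint_norm_power2n assms)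
  also have "\<dots> = norm (x ^ k * x ^ (2 ^ k - k))" using k by (simp flip: power_add)
  also have "\<dots> \<le> norm (x ^ k) * norm (x ^ (2 ^ k - k))" by (rule norm_mult_ineq)
  also have "\<dots> \<le> norm (x ^ k) * 1"
    by (rule mult_left_mono) (use norm_power_ineq[of x "2 ^ k - k"] assms in auto)
  finally show ?thesis by simp
qed

text \<open>
  The product telescopes to \<open>1 + X\<^sup>2 + X\<^sup>4 + \<dots>\<close>, the sum of the first \<open>2 ^ m\<close> even powers.
\<close>

definition doubling_poly :: "nat \<Rightarrow> complex poly" where
  "doubling_poly m = (\<Prod>j<m. 1 + Polynomial.monom 1 (2 ^ j) * Polynomial.monom 1 (2 ^ j))"

text \<open>
  A self-adjoint element of norm \<open>1\<close> has \<open>1\<close> or \<open>-1\<close> in its spectrum.  If \<open>1 - x\<^sup>2\<close> were invertible, the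
  geometric sums \<open>1 + x\<^sup>2 + \<dots> + x\<^bsup>2n-2\<^esup>\<close> would be bounded; but all powers of \<open>x\<close> have norm
  at least \<open>1\<close>, and by the preceding inequality the lower bound for the norm of the sum doubles
  together with the number of summands.  This elementary argument replaces the spectral radius formula.
\<close>

lemma norm_one_not_unit:
  fixes x :: "'a::unital_cstar_algebra"
  assumes x: "adj x = x" "norm x = 1"
  shows "\<not> unit_elem (1 - x * x)"
proof
  assume "unit_elem (1 - x * x)"
  then obtain y where y: "y * (1 - x * x) = 1" unfolding unit_elem_def by blast
  have rm: "map_poly cnj (Polynomial.monom 1 n) = Polynomial.monom 1 n" for n
    by (simp add: map_poly_monom)
  have rd: "map_poly cnj (doubling_poly m) = doubling_poly m" for m
    by (induction m) (simp_all add: doubling_poly_def map_poly_cnj rm)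
  have low: "norm (cpeval (doubling_poly m * Polynomial.monom 1 k) x) \<ge> 2 ^ m" for m k
  proof (induction m arbitrary: k)
    case 0
    show ?case using norm_power_selfadjoint_ge[OF x]
      by (simp add: doubling_poly_def cpeval_monom scaleC_one)
  next
    case (Suc m)
    have "2 * norm (cpeval (Polynomial.monom 1 (2 ^ m) * (doubling_poly m * Polynomial.monom 1 k)) x)
      \<le> norm (cpeval ((1 + Polynomial.monom 1 (2 ^ m) * Polynomial.monom 1 (2 ^ m)) * (doubling_poly m * Polynomial.monom 1 k)) x)"
      by (rule norm_square_plus_square_ge[OF x(1)]) (simp_all add: map_poly_cnj rm rd)
    moreover have "Polynomial.monom 1 (2 ^ m) * (doubling_poly m * Polynomial.monom 1 k)
        = doubling_poly m * Polynomial.monom 1 (2 ^ m + k)"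
      by (simp add: mult_monom mult.left_commute)
    moreover have "(1 + Polynomial.monom 1 (2 ^ m) * Polynomial.monom 1 (2 ^ m)) * (doubling_poly m * Polynomial.monom 1 k)
        = doubling_poly (Suc m) * Polynomial.monom 1 k"
      by (simp add: doubling_poly_def mult.assoc mult.left_commute mult.commute)
    ultimately show ?case using Suc.IH[of "2 ^ m + k"] by simp
  qed
  have tele: "(1 - Polynomial.monom 1 1 * Polynomial.monom 1 1) * doubling_poly m
      = 1 - Polynomial.monom 1 (2 ^ m) * Polynomial.monom 1 (2 ^ m)" for m
  proof (induction m)
    case (Suc m)
    have "(1 - Polynomial.monom 1 1 * Polynomial.monom 1 1) * doubling_poly (Suc m)
       = (1 - Polynomial.monom 1 (2 ^ m) * Polynomial.monom 1 (2 ^ m)) *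
         (1 + Polynomial.monom 1 (2 ^ m) * Polynomial.monom 1 (2 ^ m))"
      unfolding Suc.IH[symmetric] by (simp add: doubling_poly_def)
    also have "\<dots> = 1 - Polynomial.monom 1 (2 ^ Suc m) * Polynomial.monom 1 (2 ^ Suc m)"
      by (simp add: mult_monom algebra_simps mult_2)
    finally show ?case .
  qed (simp add: doubling_poly_def)
  have up: "norm (cpeval (doubling_poly m) x) \<le> norm y * 2" for m
  proof -
    have "cpeval (doubling_poly m) x = y * ((1 - x * x) * cpeval (doubling_poly m) x)"
      using y by (simp flip: mult.assoc)
    also have "(1 - x * x) * cpeval (doubling_poly m) x = 1 - x ^ 2 ^ m * x ^ 2 ^ m"
      using arg_cong[OF tele[of m], of "\<lambda>p. cpeval p x"]
      by (simp only: cpeval_mult cpeval_diff cpeval_monom cpeval_1 scaleC_one power_one_right)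
    finally have "norm (cpeval (doubling_poly m) x) \<le> norm y * norm (1 - x ^ 2 ^ m * x ^ 2 ^ m)"
      using norm_mult_ineq by metis
    also have "norm (1 - x ^ 2 ^ m * x ^ 2 ^ m) \<le> 1 + norm (x ^ (2 ^ m + 2 ^ m))"
      using norm_triangle_ineq4[of 1 "x ^ 2 ^ m * x ^ 2 ^ m"] by (simp add: power_add)
    also have "norm (x ^ (2 ^ m + 2 ^ m)) \<le> 1"
      using norm_power_ineq[of x "2 ^ m + 2 ^ m"] x by simp
    finally show ?thesis by (simp add: mult_left_mono)
  qed
  obtain m where "norm y * 2 < 2 ^ m"
    using real_arch_pow[of 2 "norm y * 2"] by auto
  then show False using low[of m 0] up[of m] by (simp add: cpeval_monom monom_0)
qed

lemma selfadjoint_spectrum_norm: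
  fixes x :: "'a::unital_cstar_algebra"
  assumes x: "adj x = x"
  shows "\<exists>\<mu>\<in>spectrum x. cmod \<mu> = norm x"
proof (cases "x = 0")
  case True
  then show ?thesis by (intro bexI[of _ 0]) (auto simp: spectrum_def not_unit_elem_0)
next
  case False
  define r where "r = norm x"
  have r: "r > 0" using False by (simp add: r_def)
  define z where "z = (1 / complex_of_real r) *\<^sub>C x"
  have z: "adj z = z" "norm z = 1"
    using r by (simp_all add: z_def adj_scaleC x norm_scaleC norm_divide r_def)
  have xz: "x = of_real r *\<^sub>C z" using r by (simp add: z_def scaleC_scaleC scaleC_one)
  have "1 - z * z = (1 - z) * (1 + z)" by (simp add: algebra_simps)
  with norm_one_not_unit[OF z] consider "\<not> unit_elem (1 - z)" | "\<not> unit_elem (1 + z)"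
    using unit_elem_mult by metis
  then show ?thesis
  proof cases
    case 1
    have "1 - z = (- 1 / of_real r) *\<^sub>C (x - of_real r *\<^sub>C 1)"
      using r by (simp add: xz complex_vector.scale_right_diff_distrib scaleC_scaleC scaleC_one
          complex_vector.scale_minus_left)
    then have "of_real r \<in> spectrum x"
      using 1 r unit_elem_scaleC[of "- 1 / of_real r" "x - of_real r *\<^sub>C 1"]
      by (auto simp: spectrum_def)
    then show ?thesis using r by (intro bexI[of _ "of_real r"]) (auto simp: r_def)
  next
    case 2
    have "1 + z = (1 / of_real r) *\<^sub>C (x - (- of_real r) *\<^sub>C 1)"
      using r by (simp add: xz complex_vector.scale_right_distrib scaleC_scaleC scaleC_one
          complex_vector.scale_minus_left)
    then have "- of_real r \<in> spectrum x"
      using 2 r unit_elem_scaleC[of "1 / of_real r" "x - (- of_real r) *\<^sub>C 1"]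
      by (auto simp: spectrum_def)
    then show ?thesis using r by (intro bexI[of _ "- of_real r"]) (auto simp: r_def)
  qed
qed

text \<open>
  The polynomial functional calculus: together with \<open>norm_cpeval_ge\<close> below, the norm of \<open>p(x)\<close> is the
  maximum of \<open>\<bar>p\<bar>\<close> over the spectrum of \<open>x\<close>.
\<close>

lemma norm_cpeval_selfadjoint:
  fixes x :: "'a::unital_cstar_algebra"
  assumes x: "adj x = x"
  shows "\<exists>t::real. of_real t \<in> spectrum x \<and> norm (cpeval p x) = cmod (poly p (of_real t))"
proof -
  define q where "q = map_poly cnj p * p"
  have real_spec: "\<exists>t::real. \<mu> = of_real t" if "\<mu> \<in> spectrum x" for \<mu>
    using selfadjoint_spectrum_real[OF x that] by (metis complex_is_Real_iff Reals_cases)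
  have q: "poly q (of_real t) = of_real ((cmod (poly p (of_real t)))\<^sup>2)" for t :: real
  proof -
    have "poly (map_poly cnj p) (cnj (of_real t)) = cnj (poly p (of_real t))"
      by (induction p) (simp_all add: map_poly_pCons)
    then show ?thesis
      unfolding q_def poly_mult by (simp add: complex_norm_square mult.commute del: of_real_power)
  qed
  have "map_poly cnj q = q"
    by (simp add: q_def map_poly_cnj map_poly_map_poly o_def mult.commute)
  then have "adj (cpeval q x) = cpeval q x" by (simp add: adj_cpeval x)
  then obtain \<mu> where \<mu>: "\<mu> \<in> spectrum (cpeval q x)" "cmod \<mu> = norm (cpeval q x)"
    using selfadjoint_spectrum_norm by blast
  have "\<exists>t::real. of_real t \<in> spectrum x \<and> poly q (of_real t) = \<mu>"
  proof (cases "q = [:\<mu>:]")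
    case True
    obtain \<nu> where "\<nu> \<in> spectrum x" using selfadjoint_spectrum_norm[OF x] by blast
    then show ?thesis using real_spec True by fastforce
  next
    case False
    have "cpeval q x - \<mu> *\<^sub>C 1 = cpeval (q - [:\<mu>:]) x" by (simp add: cpeval_diff)
    then have "\<not> unit_elem (cpeval (q - [:\<mu>:]) x)" using \<mu> by (simp add: spectrum_def)
    then obtain \<nu> where "\<nu> \<in> spectrum x" "poly (q - [:\<mu>:]) \<nu> = 0"
      using not_unit_cpeval_root[of "q - [:\<mu>:]" x] False by auto
    then show ?thesis using real_spec by (metis diff_eq_eq add_0 poly_diff poly_pCons poly_0 mult_zero_right add_0_right)
  qed
  then obtain t :: real where t: "of_real t \<in> spectrum x" "poly q (of_real t) = \<mu>" by blast
  have "(norm (cpeval p x))\<^sup>2 = cmod \<mu>"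
    using norm_cpeval_sq[OF x, of p] \<mu> by (simp add: q_def)
  also have "\<dots> = (cmod (poly p (of_real t)))\<^sup>2"
    using t(2) q[of t] by (metis norm_of_real abs_of_nonneg zero_le_power2)
  finally have "norm (cpeval p x) = cmod (poly p (of_real t))" by (metis norm_ge_zero power2_eq_imp_eq)
  with t(1) show ?thesis by blast
qed

lemma norm_cpeval_ge:
  "\<mu> \<in> spectrum x \<Longrightarrow> cmod (poly p \<mu>) \<le> norm (cpeval p x)"
  by (intro spectrum_norm_le spectrum_cpeval)

section \<open>Copies of \<open>c\<^sub>0\<close> from infinite spectra\<close>

text \<open>
  A commuting self-adjoint sequence equivalent to the unit vector basis of \<open>c\<^sub>0\<close>: the norm of a linear
  combination is controlled by the largest coefficient, uniformly in the number of terms, and the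
  members stay away from \<open>0\<close>.
\<close>

definition c0_sequence :: "(nat \<Rightarrow> 'a::unital_cstar_algebra) \<Rightarrow> bool" where
  "c0_sequence h \<longleftrightarrow>
     (\<forall>j. adj (h j) = h j) \<and> (\<forall>i j. h i * h j = h j * h i) \<and>
     (\<exists>C\<ge>0. \<forall>N c s. (\<forall>j<N. \<bar>c j\<bar> \<le> s) \<longrightarrow> 0 \<le> s \<longrightarrow> norm (\<Sum>j<N. c j *\<^sub>R h j) \<le> C * s) \<and>
     (\<exists>e>0. \<forall>j. norm (h j) \<ge> e)"

lemma ideal_cpeval:
  assumes I: "closed_two_sided_ideal I" and x: "x \<in> I" and p: "poly p 0 = 0"
  shows "cpeval p x \<in> I"
proof -
  obtain a q where "p = pCons a q" by (cases p)
  then show ?thesis using p x I by (auto simp: closed_two_sided_ideal_def)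
qed

text \<open>
  Tents of height \<open>1\<close> with disjoint supports, centred at points of \<open>S\<close> that approach a limit point \<open>l\<close>
  so fast that each distance to \<open>l\<close> is at most a quarter of the one before.  All of them vanish at \<open>0\<close>,
  because the condition \<open>p(0) = 0\<close> puts the values \<open>p(x)\<close> into every ideal that contains \<open>x\<close>.
\<close>

lemma tent_functions:
  fixes S :: "real set"
  assumes "infinite S" "bounded S"
  shows "\<exists>g :: nat \<Rightarrow> real \<Rightarrow> real. (\<forall>n. continuous_on UNIV (g n)) \<and> (\<forall>n x. 0 \<le> g n x) \<and>
    (\<forall>n. g n 0 = 0) \<and> (\<forall>n. \<exists>t\<in>S. g n t = 1) \<and> (\<forall>N x. (\<Sum>n<N. g n x) \<le> 1)"
proof -
  obtain l where l: "l islimpt S"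
    using Heine_Borel_imp_Bolzano_Weierstrass[of "closure S" S] assms compact_closure closure_subset
    by blast
  \<comment> \<open>Points this close to \<open>l\<close> have tents that do not reach \<open>0\<close>.\<close>
  define b where "b = (if l = 0 then 1 else \<bar>l\<bar> / 2)"
  have b: "b > 0" by (auto simp: b_def)
  have near: "\<exists>y\<in>S. 0 < \<bar>y - l\<bar> \<and> \<bar>y - l\<bar> < e" if "e > 0" for e
    using l that unfolding islimpt_approachable by (force simp: dist_real_def)
  have "\<exists>f. \<forall>n::nat. (f n \<in> S \<and> 0 < \<bar>f n - l\<bar> \<and> \<bar>f n - l\<bar> < b) \<and> \<bar>f (Suc n) - l\<bar> \<le> \<bar>f n - l\<bar> / 4"
  proof (rule dependent_nat_choice)
    show "\<exists>x. x \<in> S \<and> 0 < \<bar>x - l\<bar> \<and> \<bar>x - l\<bar> < b" using near[OF b] by blast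
  next
    fix x n assume x: "x \<in> S \<and> 0 < \<bar>x - l\<bar> \<and> \<bar>x - l\<bar> < b"
    obtain y where "y \<in> S" "0 < \<bar>y - l\<bar>" "\<bar>y - l\<bar> < \<bar>x - l\<bar> / 4"
      using near[of "\<bar>x - l\<bar> / 4"] x by auto
    moreover have "u < b" if "0 < u" "u < v / 4" "v < b" for u v :: real using that by linarith
    ultimately have "\<bar>y - l\<bar> < b" using x by blast
    with \<open>y \<in> S\<close> \<open>0 < \<bar>y - l\<bar>\<close> \<open>\<bar>y - l\<bar> < \<bar>x - l\<bar> / 4\<close>
    show "\<exists>y. (y \<in> S \<and> 0 < \<bar>y - l\<bar> \<and> \<bar>y - l\<bar> < b) \<and> \<bar>y - l\<bar> \<le> \<bar>x - l\<bar> / 4"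
      using less_imp_le by blast
  qed
  then obtain f where f: "\<And>n. f n \<in> S" "\<And>n. 0 < \<bar>f n - l\<bar>" "\<And>n. \<bar>f n - l\<bar> < b"
      "\<And>n. \<bar>f (Suc n) - l\<bar> \<le> \<bar>f n - l\<bar> / 4" by blast
  define d where "d n = \<bar>f n - l\<bar>" for n
  have d: "0 < d n" "d n < b" "d (Suc n) \<le> d n / 4" for n using f by (simp_all add: d_def)
  have dec: "d (Suc (m + k)) \<le> d m / 4" for m k
  proof (induction k)
    case (Suc k)
    then show ?case using d(3)[of "Suc (m + k)"] d(1)[of "Suc (m + k)"] by simp
  qed (use d in auto)
  define g where "g n x = max 0 (1 - 2 * \<bar>\<bar>x - l\<bar> / d n - 1\<bar>)" for n x
  have supp: "d n / 2 < \<bar>x - l\<bar> \<and> \<bar>x - l\<bar> < 3 * d n / 2" if "g n x \<noteq> 0" for n x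
  proof -
    have "\<bar>\<bar>x - l\<bar> / d n - 1\<bar> < 1 / 2" using that by (auto simp: g_def max_def split: if_splits)
    then have "1 / 2 < \<bar>x - l\<bar> / d n" "\<bar>x - l\<bar> / d n < 3 / 2" by linarith+
    then show ?thesis using d(1)[of n] by (simp add: field_simps)
  qed
  have disj: False if "g m x \<noteq> 0" "g n x \<noteq> 0" "m < n" for m n x
    using supp[OF that(1)] supp[OF that(2)] dec[of m "n - m - 1"] that(3) d(1)[of m] by simp
  have le1: "g n x \<le> 1" for n x by (simp add: g_def)
  have "(\<Sum>n<N. g n x) \<le> 1" for N x
  proof (cases "\<exists>m<N. g m x \<noteq> 0")
    case True
    then obtain m where m: "m < N" "g m x \<noteq> 0" by blast
    have "(\<Sum>n<N. g n x) = (\<Sum>n\<in>{m}. g n x)"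
      by (rule sum.mono_neutral_right) (use m disj nat_neq_iff in \<open>auto, metis\<close>)
    then show ?thesis using le1 by simp
  next
    case False
    then show ?thesis by simp
  qed
  moreover have "g n 0 = 0" for n
  proof (rule ccontr)
    assume "g n 0 \<noteq> 0"
    from supp[OF this] d(1)[of n] d(2)[of n] show False by (auto simp: b_def split: if_splits)
  qed
  moreover have "g n (f n) = 1" for n using d(1)[of n] by (simp add: g_def d_def[symmetric])
  moreover have "continuous_on UNIV (g n)" for n
    unfolding g_def using d(1)[of n] by (intro continuous_intros) auto
  moreover have "0 \<le> g n x" for n x by (simp add: g_def)
  ultimately show ?thesis using f(1) by (intro exI[of _ g]) blast
qed

lemma real_poly_approx:
  fixes g :: "real \<Rightarrow> real"
  assumes g: "continuous_on UNIV g" "g 0 = 0" and e: "e > 0" and R: "R \<ge> 0"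
  shows "\<exists>q. map_poly cnj q = q \<and> poly q 0 = 0 \<and>
    (\<forall>x. \<bar>x\<bar> \<le> R \<longrightarrow> cmod (poly q (of_real x) - of_real (g x)) \<le> e)"
proof -
  obtain p where p: "real_polynomial_function p" "\<And>x. x \<in> {-R..R} \<Longrightarrow> \<bar>g x - p x\<bar> < e / 2"
    using Stone_Weierstrass_real_polynomial_function[of "{-R..R}" g "e / 2"] e g
    by (metis compact_Icc continuous_on_subset half_gt_zero subset_UNIV)
  obtain a n where a: "p = (\<lambda>x. \<Sum>i\<le>n. a i * x ^ i)"
    using p(1) real_polynomial_function_iff_sum by blast
  define P where "P = (\<Sum>i\<le>n. Polynomial.monom (complex_of_real (a i)) i)"
  define q where "q = P - [:of_real (p 0):]"
  have P: "poly P (of_real x) = of_real (p x)" for x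
    by (simp add: P_def poly_sum poly_monom a)
  have "map_poly cnj q = q"
    by (auto simp: q_def P_def poly_eq_iff coeff_map_poly coeff_sum coeff_pCons split: nat.split)
  moreover have "poly q 0 = 0" using P[of 0] by (simp add: q_def)
  moreover have "cmod (poly q (of_real x) - of_real (g x)) \<le> e" if x: "\<bar>x\<bar> \<le> R" for x
  proof -
    have "poly q (of_real x) - of_real (g x) = of_real (p x - p 0 - g x)" by (simp add: q_def P)
    then have "cmod (poly q (of_real x) - of_real (g x)) = \<bar>p x - p 0 - g x\<bar>" by (simp only: norm_of_real)
    also have "\<dots> \<le> e"
    proof -
      have "x \<in> {-R..R}" "0 \<in> {-R..R}" using x R by auto
      from this[THEN p(2)] show ?thesis using g(2) by linarith
    qed
    finally show ?thesis .
  qed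
  ultimately show ?thesis by blast
qed

text \<open>
  Polynomials that approximate disjoint tents with summable errors \<open>2\<^bsup>-n-1\<^esup>\<close> have
  \<open>\<Sum>\<^sub>n \<bar>q\<^sub>n(t)\<bar> \<le> 2\<close> on the spectrum, while \<open>\<bar>q\<^sub>n\<bar> \<ge> 1/2\<close> at the top of the \<open>n\<close>-th tent.  The
  polynomial calculus transfers both bounds to norms.
\<close>

lemma infinite_spectrum_c0_sequence:
  fixes x :: "'a::unital_cstar_algebra"
  assumes I: "closed_two_sided_ideal I" and xI: "x \<in> I" and x: "adj x = x"
    and inf: "infinite (spectrum x)"
  shows "\<exists>h. c0_sequence h \<and> range h \<subseteq> I"
proof -
  define S where "S = {t::real. of_real t \<in> spectrum x}"
  have "spectrum x \<subseteq> of_real ` S"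
  proof
    fix \<mu> assume m: "\<mu> \<in> spectrum x"
    then have "\<mu> = of_real (Re \<mu>)" using selfadjoint_spectrum_real[OF x] by (simp add: complex_eq_iff)
    then show "\<mu> \<in> of_real ` S" using m by (metis S_def image_eqI mem_Collect_eq)
  qed
  then have "infinite S" using inf by (meson finite_imageI finite_subset)
  have Sb: "\<bar>t\<bar> \<le> norm x" if "t \<in> S" for t
    using spectrum_norm_le[of "of_real t" x] that by (simp add: S_def)
  then have "bounded S" by (metis boundedI real_norm_def)
  obtain g :: "nat \<Rightarrow> real \<Rightarrow> real" where g: "\<And>n. continuous_on UNIV (g n)" "\<And>n x. 0 \<le> g n x"
    "\<And>n. g n 0 = 0" "\<And>n. \<exists>t\<in>S. g n t = 1" "\<And>N x. (\<Sum>n<N. g n x) \<le> 1"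
    using tent_functions[OF \<open>infinite S\<close> \<open>bounded S\<close>] by metis
  have "\<forall>n. \<exists>q. map_poly cnj q = q \<and> poly q 0 = 0 \<and>
    (\<forall>t. \<bar>t\<bar> \<le> norm x \<longrightarrow> cmod (poly q (of_real t) - of_real (g n t)) \<le> (1 / 2) ^ Suc n)"
    by (intro allI real_poly_approx g) auto
  then obtain q where q: "\<And>n. map_poly cnj (q n) = q n" "\<And>n. poly (q n) 0 = 0"
    "\<And>n t. \<bar>t\<bar> \<le> norm x \<Longrightarrow> cmod (poly (q n) (of_real t) - of_real (g n t)) \<le> (1 / 2) ^ Suc n"
    by metis
  define h where "h n = cpeval (q n) x" for n
  have geo: "(\<Sum>n<N. (1 / 2) ^ Suc n) \<le> (1::real)" for N
  proof -
    have "(\<Sum>n<N. (1 / 2) ^ Suc n) = 1 - (1 / 2::real) ^ N" by (induction N) auto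
    then show ?thesis by simp
  qed
  have bound: "norm (\<Sum>j<N. c j *\<^sub>R h j) \<le> 2 * s" if c: "\<forall>j<N. \<bar>c j\<bar> \<le> s" and s: "0 \<le> s"
    for N s and c :: "nat \<Rightarrow> real"
  proof -
    define Q where "Q = (\<Sum>j<N. Polynomial.smult (of_real (c j)) (q j))"
    have "(\<Sum>j<N. c j *\<^sub>R h j) = cpeval Q x"
      by (simp add: Q_def cpeval_sum cpeval_smult h_def scaleR_scaleC)
    moreover obtain t where t: "of_real t \<in> spectrum x" "norm (cpeval Q x) = cmod (poly Q (of_real t))"
      using norm_cpeval_selfadjoint[OF x] by blast
    moreover have "cmod (poly Q (of_real t)) \<le> (\<Sum>j<N. s * (g j t + (1 / 2) ^ Suc j))"
      unfolding Q_def poly_sum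
    proof (rule sum_norm_le)
      fix j assume "j \<in> {..<N}"
      have "cmod (poly (q j) (of_real t)) \<le> cmod (of_real (g j t)) + (1 / 2) ^ Suc j"
        using q(3)[of t j] Sb[of t] t(1)
          norm_triangle_ineq[of "of_real (g j t)" "poly (q j) (of_real t) - of_real (g j t)"]
        by (auto simp: S_def)
      then have "cmod (poly (q j) (of_real t)) \<le> g j t + (1 / 2) ^ Suc j" using g(2)[of j t] by simp
      then have "\<bar>c j\<bar> * cmod (poly (q j) (of_real t)) \<le> s * (g j t + (1 / 2) ^ Suc j)"
        using c s \<open>j \<in> _\<close> by (intro mult_mono) auto
      then show "cmod (poly (Polynomial.smult (of_real (c j)) (q j)) (of_real t)) \<le> s * (g j t + (1 / 2) ^ Suc j)"
        by (simp add: norm_mult)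
    qed
    moreover have "(\<Sum>j<N. s * (g j t + (1 / 2) ^ Suc j)) \<le> s * 2"
      unfolding sum_distrib_left[symmetric] sum.distrib
      using g(5)[where x = t and N = N] geo[of N] s by (intro mult_left_mono) linarith+
    ultimately show ?thesis by (simp only: mult.commute[of s 2])
  qed
  have low: "norm (h j) \<ge> 1 / 2" for j
  proof -
    obtain t where t: "t \<in> S" "g j t = 1" using g(4) by blast
    have "cmod (poly (q j) (of_real t) - 1) \<le> (1 / 2) ^ Suc j" using q(3)[of t j] Sb[OF t(1)] t(2) by simp
    also have "\<dots> \<le> 1 / 2" by (simp add: power_le_one)
    finally have "1 / 2 \<le> cmod (poly (q j) (of_real t))"
      using norm_triangle_ineq2[of 1 "poly (q j) (of_real t)"] by (simp add: norm_minus_commute)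
    also have "\<dots> \<le> norm (h j)"
      unfolding h_def using t(1) by (intro norm_cpeval_ge) (simp add: S_def)
    finally show ?thesis .
  qed
  have "c0_sequence h"
    unfolding c0_sequence_def
  proof (intro conjI allI)
    show "adj (h j) = h j" for j by (simp add: h_def adj_cpeval x q)
    show "h i * h j = h j * h i" for i j unfolding h_def by (rule cpeval_commute)
    show "\<exists>C\<ge>0. \<forall>N c s. (\<forall>j<N. \<bar>c j\<bar> \<le> s) \<longrightarrow> 0 \<le> s \<longrightarrow> norm (\<Sum>j<N. c j *\<^sub>R h j) \<le> C * s"
      using bound by (intro exI[of _ 2]) auto
    show "\<exists>e>0. \<forall>j. e \<le> norm (h j)" using low by (intro exI[of _ "1 / 2"]) auto
  qed
  moreover have "range h \<subseteq> I" using ideal_cpeval[OF I xI] q(2) by (auto simp: h_def)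
  ultimately show ?thesis by blast
qed

section \<open>Ideals in which all spectra are finite\<close>

definition projection :: "'a::unital_cstar_algebra \<Rightarrow> bool" where
  "projection e \<longleftrightarrow> adj e = e \<and> e * e = e"

text \<open>
  Minimality is stated as \<open>pIp = \<complex>p\<close>, which is the form in which it is used.
\<close>

definition minimal_projection :: "'a::unital_cstar_algebra set \<Rightarrow> 'a \<Rightarrow> bool" where
  "minimal_projection I p \<longleftrightarrow>
     projection p \<and> p \<in> I \<and> p \<noteq> 0 \<and> (\<forall>y\<in>I. \<exists>c. p * y * p = c *\<^sub>C p)"

definition finite_spectra :: "'a::unital_cstar_algebra set \<Rightarrow> bool" where
  "finite_spectra I \<longleftrightarrow> (\<forall>x\<in>I. adj x = x \<longrightarrow> finite (spectrum x))"

lemma ideal_mult: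
  assumes "closed_two_sided_ideal I" "x \<in> I"
  shows "a * x \<in> I" "x * a \<in> I"
  using assms by (auto simp: closed_two_sided_ideal_def)

lemma ideal_linear:
  assumes "closed_two_sided_ideal I"
  shows "0 \<in> I" "x \<in> I \<Longrightarrow> y \<in> I \<Longrightarrow> x + y \<in> I" "x \<in> I \<Longrightarrow> y \<in> I \<Longrightarrow> x - y \<in> I"
    "x \<in> I \<Longrightarrow> c *\<^sub>C x \<in> I" "(\<And>i. i \<in> F \<Longrightarrow> f i \<in> I) \<Longrightarrow> sum f F \<in> I"
    "x \<in> I \<Longrightarrow> r *\<^sub>R x \<in> I"
  using assms unfolding closed_two_sided_ideal_def
  by (auto intro: complex_vector.subspace_0 complex_vector.subspace_add complex_vector.subspace_diff
      complex_vector.subspace_scale complex_vector.subspace_sum simp: scaleR_scaleC)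

lemma projection_le_sym:
  assumes "projection p" "projection q" "p * q = q"
  shows "q * p = q"
  using assms by (metis adj_mult projection_def)

lemma norm_projection:
  assumes "projection p" "p \<noteq> 0"
  shows "norm p = 1"
  using assms selfadjoint_norm_square[of p] by (simp add: projection_def power2_eq_square)

lemma cpeval_eq_on_spectrum:
  assumes x: "adj x = x" and e: "\<And>\<mu>. \<mu> \<in> spectrum x \<Longrightarrow> poly p \<mu> = poly q \<mu>"
  shows "cpeval p x = cpeval q x"
proof -
  obtain t :: real where "of_real t \<in> spectrum x"
    "norm (cpeval (p - q) x) = cmod (poly (p - q) (of_real t))"
    using norm_cpeval_selfadjoint[OF x] by blast
  then show ?thesis using e by (simp add: cpeval_diff)
qed

text \<open>
  Lagrange interpolation at a finite spectrum: the polynomial that is \<open>1\<close> at one nonzero spectral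
  value and \<open>0\<close> at all others and at \<open>0\<close> has idempotent real values there.  Being divisible by \<open>X\<close> it
  produces a projection of the form \<open>x r(x)\<close>, which inherits membership in ideals and corners from \<open>x\<close>.
\<close>

lemma spectral_projection:
  fixes x :: "'a::unital_cstar_algebra"
  assumes x: "adj x = x" "x \<noteq> 0" and fin: "finite (spectrum x)"
  shows "\<exists>r. projection (x * cpeval r x) \<and> x * cpeval r x \<noteq> 0"
proof -
  obtain \<mu> where \<mu>: "\<mu> \<in> spectrum x" "cmod \<mu> = norm x" using selfadjoint_spectrum_norm[OF x(1)] by blast
  then have "\<mu> \<noteq> 0" using x(2) by auto
  define L where "L = (\<Prod>\<nu>\<in>spectrum x - {\<mu>}. [:-\<nu>, 1:])"
  define r where "r = Polynomial.smult (1 / (\<mu> * poly L \<mu>)) L"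
  define q where "q = pCons 0 r"
  have L: "poly L \<mu> \<noteq> 0" unfolding L_def poly_prod by (simp add: fin)
  have q1: "poly q \<mu> = 1" using \<open>\<mu> \<noteq> 0\<close> L by (simp add: q_def r_def)
  have q0: "poly q \<nu> = 0" if "\<nu> \<in> spectrum x" "\<nu> \<noteq> \<mu>" for \<nu>
    using that fin by (auto simp: q_def r_def L_def poly_prod intro!: prod_zero)
  define e where "e = cpeval q x"
  have "e * e = e"
    unfolding e_def cpeval_mult[symmetric]
    by (rule cpeval_eq_on_spectrum[OF x(1)]) (metis mult.right_neutral mult_zero_right poly_mult q0 q1)
  moreover have "adj e = e"
    unfolding e_def adj_cpeval[OF x(1)]
  proof (rule cpeval_eq_on_spectrum[OF x(1)])
    fix \<nu> assume n: "\<nu> \<in> spectrum x"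
    then have "cnj \<nu> = \<nu>" using selfadjoint_spectrum_real[OF x(1)] by (simp add: complex_eq_iff)
    moreover have "poly (map_poly cnj q) (cnj \<nu>) = cnj (poly q \<nu>)"
      by (induction q) (simp_all add: map_poly_pCons)
    ultimately show "poly (map_poly cnj q) \<nu> = poly q \<nu>"
      using n q0 q1 by (metis complex_cnj_one complex_cnj_zero)
  qed
  moreover have "e \<noteq> 0" using norm_cpeval_ge[OF \<mu>(1), of q] q1 by (auto simp: e_def)
  moreover have "e = x * cpeval r x" by (simp add: e_def q_def)
  ultimately show ?thesis unfolding projection_def by metis
qed

lemma cpeval_commute_self: "x * cpeval r x = cpeval r x * x"
  using cpeval_commute[of "[:0, 1:]" x r] by (simp add: scaleC_one)

text \<open>
  A non-minimal corner \<open>pIp\<close> contains a non-scalar self-adjoint \<open>a\<close>.  For a nonzero spectral value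
  \<open>\<mu>\<close> of \<open>a\<close>, the element \<open>b = a - \<mu>p\<close> is nonzero but not invertible in the corner, so its spectral
  projections are proper.
\<close>

lemma split_projection:
  assumes I: "closed_two_sided_ideal I" and fs: "finite_spectra I"
    and p: "projection p" "p \<in> I" "p \<noteq> 0" and nm: "\<not> minimal_projection I p"
  shows "\<exists>e\<in>I. projection e \<and> e \<noteq> 0 \<and> e \<noteq> p \<and> p * e = e"
proof -
  have pp: "adj p = p" "p * p = p" using p by (auto simp: projection_def)
  obtain y where y: "y \<in> I" "\<And>c. p * y * p \<noteq> c *\<^sub>C p"
    using nm p by (auto simp: minimal_projection_def)
  define z where "z = p * y * p"
  have z: "z \<in> I" "adj z \<in> I" "p * z = z" "z * p = z" "p * adj z = adj z" "adj z * p = adj z"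
    using y(1) p(2) by (auto simp: z_def ideal_mult[OF I] adj_mult pp mult.assoc)
      (simp_all add: pp flip: mult.assoc)
  have "\<exists>a\<in>I. adj a = a \<and> p * a = a \<and> a * p = a \<and> (\<forall>c. a \<noteq> c *\<^sub>C p)"
  proof (rule ccontr)
    assume no: "\<not> ?thesis"
    have "z + adj z \<in> I" "adj (z + adj z) = z + adj z" "p * (z + adj z) = z + adj z" "(z + adj z) * p = z + adj z"
      using z by (simp_all add: ideal_linear[OF I] adj_add adj_adj ring_distribs add.commute)
    then obtain c where c: "z + adj z = c *\<^sub>C p" using no by blast
    have "\<i> *\<^sub>C (z - adj z) \<in> I" "adj (\<i> *\<^sub>C (z - adj z)) = \<i> *\<^sub>C (z - adj z)"
      "p * (\<i> *\<^sub>C (z - adj z)) = \<i> *\<^sub>C (z - adj z)" "(\<i> *\<^sub>C (z - adj z)) * p = \<i> *\<^sub>C (z - adj z)"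
      using z by (simp_all add: ideal_linear[OF I] adj_diff adj_scaleC adj_adj ring_distribs
          mult_scaleC_left mult_scaleC_right complex_vector.scale_right_diff_distrib
          complex_vector.scale_minus_left)
    then obtain d where d: "\<i> *\<^sub>C (z - adj z) = d *\<^sub>C p" using no by blast
    have "z - adj z = (- \<i> * \<i>) *\<^sub>C (z - adj z)" by (simp add: scaleC_one)
    also have "\<dots> = (- \<i> * d) *\<^sub>C p" using d by (metis scaleC_scaleC)
    finally have "(z + adj z) + (z - adj z) = (c + - \<i> * d) *\<^sub>C p" by (simp only: c scaleC_add_left)
    moreover have "(z + adj z) + (z - adj z) = 2 *\<^sub>C z"
      by simp (metis one_add_one scaleC_add_left scaleC_one)
    ultimately have "(1 / 2) *\<^sub>C 2 *\<^sub>C z = ((1 / 2) * (c + - \<i> * d)) *\<^sub>C p" by (metis scaleC_scaleC)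
    then have "z = ((1 / 2) * (c + - \<i> * d)) *\<^sub>C p" by (simp add: scaleC_scaleC scaleC_one)
    then show False using y(2) unfolding z_def by blast
  qed
  then obtain a where a: "a \<in> I" "adj a = a" "p * a = a" "a * p = a" "\<And>c. a \<noteq> c *\<^sub>C p" by blast
  have "a \<noteq> 0" using a(5)[of 0] by auto
  obtain \<mu> where \<mu>: "\<mu> \<in> spectrum a" "cmod \<mu> = norm a" using selfadjoint_spectrum_norm[OF a(2)] by blast
  then have "\<mu> \<noteq> 0" using \<open>a \<noteq> 0\<close> by auto
  have "cnj \<mu> = \<mu>" using selfadjoint_spectrum_real[OF a(2) \<mu>(1)] by (simp add: complex_eq_iff)
  define b where "b = a - \<mu> *\<^sub>C p"
  have b: "b \<in> I" "adj b = b" "p * b = b" "b * p = b" "b \<noteq> 0"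
    using a p(2) \<open>cnj \<mu> = \<mu>\<close> by (simp_all add: b_def ideal_linear[OF I] adj_diff adj_scaleC pp ring_distribs
        mult_scaleC_left mult_scaleC_right)
  obtain r where r: "projection (b * cpeval r b)" "b * cpeval r b \<noteq> 0"
    using spectral_projection[of b] b fs by (auto simp: finite_spectra_def)
  define w where "w = cpeval r b"
  define e where "e = b * w"
  have ewb: "e = w * b" unfolding e_def w_def by (rule cpeval_commute_self)
  have "p * e = e" by (simp add: e_def b flip: mult.assoc)
  moreover have "e \<in> I" unfolding e_def by (rule ideal_mult[OF I b(1)])
  moreover have "e \<noteq> p"
  proof
    assume ep: "e = p"
    \<comment> \<open>then \<open>b\<close> is invertible in the corner, so \<open>a - \<mu>\<close> is invertible\<close>
    \<comment> \<open>Here \<open>b\<close> has the inverse \<open>W\<close> in the corner, and \<open>-\<mu>\<close> is invertible on the complement \<open>Q\<close>.\<close>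
    define Q W where "Q = 1 - p" and "W = p * w * p"
    have am: "a - \<mu> *\<^sub>C 1 = b - \<mu> *\<^sub>C Q"
      by (simp add: b_def Q_def complex_vector.scale_right_diff_distrib)
    have "b * W = b * w * p" by (simp add: W_def b(4) flip: mult.assoc)
    moreover have "W * b = p * (w * b)" by (simp add: W_def b(3) mult.assoc)
    ultimately have "b * W = p" "W * b = p" using ep pp ewb by (simp_all add: e_def)
    moreover have "b * Q = 0" "Q * b = 0" by (simp_all add: Q_def ring_distribs b)
    moreover have "Q * W = 0" by (simp add: Q_def W_def left_diff_distrib pp flip: mult.assoc)
    moreover have "W * Q = 0" by (simp add: Q_def W_def right_diff_distrib pp mult.assoc)
    moreover have "Q * Q = Q" by (simp add: Q_def ring_distribs pp)
    ultimately have "(b - \<mu> *\<^sub>C Q) * (W - (1 / \<mu>) *\<^sub>C Q) = p + Q"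
        "(W - (1 / \<mu>) *\<^sub>C Q) * (b - \<mu> *\<^sub>C Q) = p + Q"
      using \<open>\<mu> \<noteq> 0\<close>
      by (simp_all add: ring_distribs mult_scaleC_left mult_scaleC_right scaleC_scaleC scaleC_one)
    moreover have "p + Q = 1" by (simp add: Q_def)
    ultimately have "(a - \<mu> *\<^sub>C 1) * (W - (1 / \<mu>) *\<^sub>C Q) = 1"
        "(W - (1 / \<mu>) *\<^sub>C Q) * (a - \<mu> *\<^sub>C 1) = 1"
      unfolding am by simp_all
    then show False using \<mu>(1) by (auto simp: spectrum_def unit_elem_def)
  qed
  ultimately show ?thesis using r unfolding e_def w_def by blast
qed

text \<open>
  The differences \<open>e\<^sub>n\<close> of an increasing chain are orthogonal projections, and
  \<open>\<Sum>\<^sub>n 2\<^bsup>-n\<^esup> e\<^sub>n\<close> is a self-adjoint member of the closed ideal with all \<open>2\<^bsup>-n\<^esup>\<close> in its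
  spectrum.
\<close>

lemma no_infinite_projection_chain:
  assumes I: "closed_two_sided_ideal I" and fs: "finite_spectra I"
    and s: "\<And>n. projection (s n)" "\<And>n. s n \<in> I" "\<And>n. s n * s (Suc n) = s n" "\<And>n. s n \<noteq> s (Suc n)"
  shows False
proof -
  have ss: "adj (s n) = s n" "s n * s n = s n" for n using s(1)[of n] by (auto simp: projection_def)
  have le: "s i * s j = s i" if "i \<le> j" for i j
    using that
  proof (induction j rule: dec_induct)
    case (step j)
    then show ?case using s(3)[of j] by (metis mult.assoc)
  qed (simp add: ss)
  have ge: "s j * s i = s i" if "i \<le> j" for i j
    using arg_cong[OF le[OF that], of adj] by (simp add: adj_mult ss)
  define e where "e n = s (Suc n) - s n" for n
  have e: "adj (e n) = e n" "e n * e n = e n" "e n \<noteq> 0" "e n \<in> I" for n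
    using s(4)[of n] le[of n "Suc n"] ge[of n "Suc n"] s(2)
    by (auto simp: e_def adj_diff ss ring_distribs ideal_linear[OF I])
  have orth: "e m * e n = 0" if "m \<noteq> n" for m n
  proof -
    have lt: "e m * e n = 0" if "m < n" for m n
      using that by (simp add: e_def ring_distribs le)
    show ?thesis
    proof (cases "m < n")
      case False
      then have "e n * e m = 0" using that lt by auto
      then show ?thesis by (metis adj_mult adj_zero e(1))
    qed (rule lt)
  qed
  have ne: "norm (e n) = 1" for n using norm_projection[of "e n"] e by (auto simp: projection_def)
  define t where "t n = ((1 / 2::real) ^ n) *\<^sub>R e n" for n
  have st: "summable t"
    by (rule summable_norm_cancel) (simp add: t_def ne summable_geometric)
  define h where "h = suminf t"
  have "h \<in> I"
  proof -
    have "(\<lambda>n. \<Sum>i<n. t i) \<longlonglongrightarrow> h" unfolding h_def using summable_LIMSEQ[OF st] .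
    moreover have "closed I" using I by (simp add: closed_two_sided_ideal_def)
    moreover have "(\<Sum>i<n. t i) \<in> I" for n by (intro ideal_linear[OF I]) (simp add: t_def ideal_linear[OF I] e)
    ultimately show ?thesis by (meson closed_sequentially)
  qed
  moreover have "adj h = h"
  proof -
    have "adj (t n) = t n" for n by (simp add: t_def scaleR_scaleC adj_scaleC e)
    then show ?thesis unfolding h_def using bounded_linear.suminf[OF bounded_linear_adj st] by simp
  qed
  ultimately have fin: "finite (spectrum h)" using fs by (simp add: finite_spectra_def)
  have mem: "of_real ((1 / 2) ^ m) \<in> spectrum h" for m
  proof -
    have "h * e m = (\<Sum>n. t n * e m)"
      unfolding h_def by (rule suminf_mult2[OF st])
    also have "\<dots> = (\<Sum>n\<in>{m}. t n * e m)"
      by (rule suminf_finite) (auto simp: t_def orth)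
    finally have "h * e m = of_real ((1 / 2) ^ m) *\<^sub>C e m" by (simp add: t_def e scaleR_scaleC mult_scaleC_left)
    then have z: "(h - of_real ((1 / 2) ^ m) *\<^sub>C 1) * e m = 0"
      by (simp add: ring_distribs mult_scaleC_left)
    show ?thesis
      unfolding spectrum_def unit_elem_def
    proof (rule CollectI, rule notI)
      assume "\<exists>y. (h - of_real ((1 / 2) ^ m) *\<^sub>C 1) * y = 1 \<and> y * (h - of_real ((1 / 2) ^ m) *\<^sub>C 1) = 1"
      then obtain y where "y * (h - of_real ((1 / 2) ^ m) *\<^sub>C 1) = 1" by blast
      then have "e m = y * ((h - of_real ((1 / 2) ^ m) *\<^sub>C 1) * e m)" by (simp flip: mult.assoc)
      then show False using z e(3)[of m] by simp
    qed
  qed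
  have "inj (\<lambda>m::nat. complex_of_real ((1 / 2) ^ m))"
    by (rule injI) (simp del: of_real_power add: power_inject_exp')
  then have "infinite (range (\<lambda>m::nat. complex_of_real ((1 / 2) ^ m)))" by (simp add: range_inj_infinite)
  then show False using mem fin by (meson finite_subset image_subsetI)
qed

text \<open>
  Otherwise repeated splitting gives a decreasing chain below \<open>p\<close>, and the complements in \<open>p\<close> increase.
\<close>

lemma minimal_projection_below:
  assumes I: "closed_two_sided_ideal I" and fs: "finite_spectra I"
    and p: "projection p" "p \<in> I" "p \<noteq> 0"
  shows "\<exists>q. minimal_projection I q \<and> p * q = q"
proof (rule ccontr)
  assume no: "\<not> ?thesis"
  have "\<exists>x. \<forall>n::nat. (projection (x n) \<and> x n \<in> I \<and> x n \<noteq> 0 \<and> p * x n = x n) \<and>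
      (x (Suc n) \<noteq> x n \<and> x n * x (Suc n) = x (Suc n))"
  proof (rule dependent_nat_choice)
    show "\<exists>x. projection x \<and> x \<in> I \<and> x \<noteq> 0 \<and> p * x = x" using p by (auto simp: projection_def)
  next
    fix x n assume x: "projection x \<and> x \<in> I \<and> x \<noteq> 0 \<and> p * x = x"
    then have "\<not> minimal_projection I x" using no by blast
    then obtain e where e: "e \<in> I" "projection e" "e \<noteq> 0" "e \<noteq> x" "x * e = e"
      using split_projection[OF I fs] x by blast
    moreover have "p * e = e" using x e(5) by (metis mult.assoc)
    ultimately show "\<exists>y. (projection y \<and> y \<in> I \<and> y \<noteq> 0 \<and> p * y = y) \<and> (y \<noteq> x \<and> x * y = y)" by blast
  qed
  then obtain x where x: "\<And>n. projection (x n)" "\<And>n. x n \<in> I" "\<And>n. p * x n = x n"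
     "\<And>n. x (Suc n) \<noteq> x n" "\<And>n. x n * x (Suc n) = x (Suc n)" by blast
  have xp: "x n * p = x n" for n using projection_le_sym[OF p(1) x(1) x(3)] .
  show False
  proof (rule no_infinite_projection_chain[OF I fs, of "\<lambda>n. p - x n"])
    show "projection (p - x n)" for n
      using p(1) x(1)[of n] xp[of n] x(3)[of n] by (simp add: projection_def adj_diff ring_distribs)
    show "p - x n \<in> I" for n using p x by (simp add: ideal_linear[OF I])
    show "(p - x n) * (p - x (Suc n)) = p - x n" for n
      using p(1) by (simp add: ring_distribs x xp projection_def)
    show "p - x n \<noteq> p - x (Suc n)" for n using x(4)[of n] by auto
  qed
qed

definition minimal_family :: "'a::unital_cstar_algebra set \<Rightarrow> 'a set \<Rightarrow> bool" where
  "minimal_family I P \<longleftrightarrow>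
     finite P \<and> (\<forall>p\<in>P. minimal_projection I p) \<and> (\<forall>p\<in>P. \<forall>q\<in>P. p \<noteq> q \<longrightarrow> p * q = 0)"

lemma minimal_family_sum:
  assumes "minimal_family I P" "p \<in> P"
  shows "p * \<Sum>P = p" "\<Sum>P * p = p"
proof -
  have "p * q = (if q = p then p else 0)" "q * p = (if q = p then p else 0)" if "q \<in> P" for q
    using assms that by (auto simp: minimal_family_def minimal_projection_def projection_def)
  then show "p * \<Sum>P = p" "\<Sum>P * p = p"
    using assms by (simp_all add: sum_distrib_left sum_distrib_right minimal_family_def)
qed

lemma minimal_family_sum_projection:
  assumes "minimal_family I P"
  shows "projection (\<Sum>P)"
proof -
  have "\<Sum>P * \<Sum>P = \<Sum>P"
    by (simp add: sum_distrib_left minimal_family_sum(2)[OF assms])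
  then show ?thesis
    using assms by (auto simp: projection_def adj_sum minimal_family_def minimal_projection_def)
qed

text \<open>
  An orthogonal family of minimal projections whose sum is a right unit of the ideal.  As long as
  \<open>z = x - xs\<close> is nonzero for some \<open>x\<close> of the ideal, with \<open>s\<close> the sum so far, a spectral projection of
  \<open>z\<^sup>* z\<close> dominates a minimal projection orthogonal to \<open>s\<close>; the sums \<open>s\<close> cannot increase forever.
\<close>

lemma exists_total_minimal_family:
  assumes I: "closed_two_sided_ideal I" and fs: "finite_spectra I"
  shows "\<exists>P. minimal_family I P \<and> (\<forall>x\<in>I. x * \<Sum>P = x)"
proof (rule ccontr)
  assume no: "\<not> ?thesis"
  have ext: "\<exists>q. minimal_family I (insert q P) \<and> q \<notin> P \<and> q \<noteq> 0 \<and> \<Sum>P * q = 0" if P: "minimal_family I P" for P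
  proof -
    define s where "s = \<Sum>P"
    have s: "adj s = s" "s * s = s"
      using minimal_family_sum_projection[OF P] by (auto simp: s_def projection_def)
    obtain x where x: "x \<in> I" "x * s \<noteq> x" using no P by (auto simp: s_def)
    define z where "z = x - x * s"
    have z: "z \<in> I" "z \<noteq> 0" "z * s = 0"
      using x by (simp_all add: z_def ideal_linear[OF I] ideal_mult[OF I] ring_distribs mult.assoc s)
    define h where "h = adj z * z"
    have h: "h \<in> I" "h \<noteq> 0" "adj h = h" "h * s = 0"
      using z by (simp_all add: h_def ideal_mult[OF I] cstar_zero_iff adj_mult adj_adj mult.assoc)
    obtain r where r: "projection (h * cpeval r h)" "h * cpeval r h \<noteq> 0"
      using spectral_projection[of h] h fs by (auto simp: finite_spectra_def)
    define e where "e = h * cpeval r h"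
    have e: "projection e" "e \<noteq> 0" "e \<in> I" using r h by (auto simp: e_def ideal_mult[OF I])
    have es: "e * s = 0" unfolding e_def cpeval_commute_self by (simp add: mult.assoc h)
    obtain q where q: "minimal_projection I q" "e * q = q"
      using minimal_projection_below[OF I fs e(1,3,2)] by blast
    have qq: "adj q = q" "q \<noteq> 0" "q * q = q" using q(1) by (auto simp: minimal_projection_def projection_def)
    have "q * e = q" using projection_le_sym[OF e(1) _ q(2)] q(1) by (auto simp: minimal_projection_def)
    then have qs: "q * s = 0" using es by (metis mult.assoc mult_zero_right)
    then have sq: "s * q = 0" by (metis adj_mult adj_zero s(1) qq(1))
    have "q * p = 0" "p * q = 0" if "p \<in> P" for p
      using minimal_family_sum[OF P that] qs sq unfolding s_def[symmetric]
      by (metis mult.assoc mult_zero_left, metis mult.assoc mult_zero_right)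
    moreover from this have "q \<notin> P" using qq by fastforce
    ultimately show ?thesis
      using P q(1) sq qq by (intro exI[of _ q]) (auto simp: minimal_family_def s_def)
  qed
  have "\<exists>P. \<forall>n::nat. minimal_family I (P n) \<and>
     (\<exists>q. P (Suc n) = insert q (P n) \<and> q \<notin> P n \<and> q \<noteq> 0 \<and> \<Sum>(P n) * q = 0)"
  proof (rule dependent_nat_choice)
    show "\<exists>P. minimal_family I P" by (intro exI[of _ "{}"]) (simp add: minimal_family_def)
  next
    fix P n assume "minimal_family I P"
    from ext[OF this] show "\<exists>P'. minimal_family I P' \<and>
        (\<exists>q. P' = insert q P \<and> q \<notin> P \<and> q \<noteq> 0 \<and> \<Sum>P * q = 0)" by blast
  qed
  then obtain P where P: "\<And>n. minimal_family I (P n)"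
     "\<And>n. \<exists>q. P (Suc n) = insert q (P n) \<and> q \<notin> P n \<and> q \<noteq> 0 \<and> \<Sum>(P n) * q = 0" by blast
  have step: "\<exists>q. \<Sum>(P (Suc n)) = q + \<Sum>(P n) \<and> q \<noteq> 0 \<and> \<Sum>(P n) * q = 0" for n
    using P(2)[of n] P(1)[of n] by (auto simp: minimal_family_def)
  show False
  proof (rule no_infinite_projection_chain[OF I fs, of "\<lambda>n. \<Sum>(P n)"])
    show "projection (\<Sum>(P n))" for n by (rule minimal_family_sum_projection[OF P(1)])
    then have "\<Sum>(P n) * \<Sum>(P n) = \<Sum>(P n)" for n by (simp add: projection_def)
    then show "\<Sum>(P n) * \<Sum>(P (Suc n)) = \<Sum>(P n)" for n using step[of n] by (auto simp: ring_distribs)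
    show "\<Sum>(P n) \<in> I" for n
      using P(1)[of n] by (intro ideal_linear[OF I]) (auto simp: minimal_family_def minimal_projection_def)
    show "\<Sum>(P n) \<noteq> \<Sum>(P (Suc n))" for n using step[of n] by auto
  qed
qed

text \<open>
  In finite dimension the powers of \<open>x\<close> are linearly dependent, so \<open>x\<close> is a root of a polynomial and the
  spectrum consists of roots of the same polynomial.
\<close>

lemma finite_dimensional_finite_spectra:
  assumes I: "closed_two_sided_ideal I" and fd: "finite_dimensional I"
  shows "finite_spectra I"
  unfolding finite_spectra_def
proof (intro ballI impI)
  fix x assume x: "x \<in> I" "adj x = x"
  obtain B where B: "finite B" "I = complex_vector.span B" using fd by (auto simp: finite_dimensional_def)
  define f where "f n = x ^ Suc n" for n
  have fI: "range f \<subseteq> complex_vector.span B" using x(1) B(2) ideal_mult[OF I] by (auto simp: f_def)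
  have "\<exists>q. q \<noteq> 0 \<and> cpeval q x = 0"
  proof (cases "inj f")
    case True
    then have "infinite (range f)" by (simp add: range_inj_infinite)
    then have "complex_vector.dependent (range f)"
      using complex_vector.independent_span_bound[OF B(1) _ fI] by blast
    then obtain T u v where T: "finite T" "T \<subseteq> range f" "(\<Sum>v\<in>T. u v *\<^sub>C v) = 0" "v \<in> T" "u v \<noteq> 0"
      unfolding complex_vector.dependent_explicit by blast
    obtain K where K: "T = f ` K" using T(2) by (meson subset_image_iff)
    have inj: "inj_on f K" using True by (rule inj_on_subset) simp
    then have fK: "finite K" using T(1) K by (simp add: finite_image_iff)
    define q where "q = (\<Sum>k\<in>K. Polynomial.monom (u (f k)) (Suc k))"
    have "cpeval q x = (\<Sum>k\<in>K. u (f k) *\<^sub>C f k)"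
      by (simp add: q_def cpeval_sum cpeval_monom f_def)
    also have "\<dots> = 0" using T(3) inj by (simp add: K sum.reindex)
    finally have "cpeval q x = 0" .
    moreover obtain k where k: "k \<in> K" "v = f k" using T(4) K by blast
    have "Polynomial.coeff q (Suc k) = (\<Sum>j\<in>K. if j = k then u (f k) else 0)"
      unfolding q_def coeff_sum by (intro sum.cong) auto
    then have "Polynomial.coeff q (Suc k) = u v" using fK k by simp
    then have "q \<noteq> 0" using T(5) by auto
    ultimately show ?thesis by blast
  next
    case False
    then obtain m n where mn: "m \<noteq> n" "f m = f n" by (auto simp: inj_on_def)
    define q where "q = Polynomial.monom 1 (Suc m) - Polynomial.monom (1::complex) (Suc n)"
    have "cpeval q x = 0" using mn(2) by (simp add: q_def cpeval_diff cpeval_monom f_def)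
    moreover have "Polynomial.coeff q (Suc m) \<noteq> 0" using mn(1) by (simp add: q_def)
    then have "q \<noteq> 0" by auto
    ultimately show ?thesis by blast
  qed
  then obtain q where q: "q \<noteq> 0" "cpeval q x = 0" by blast
  have "spectrum x \<subseteq> {\<mu>. poly q \<mu> = 0}" using norm_cpeval_ge[of _ x q] q by auto
  then show "finite (spectrum x)" using poly_roots_finite[OF q(1)] finite_subset by blast
qed

text \<open>
  For a nonzero \<open>v\<close> in \<open>pIq\<close>, minimality gives \<open>v\<^sup>* v \<in> \<complex>q\<close> and \<open>w v\<^sup>* \<in> \<complex>p\<close>
  for every \<open>w\<close> in \<open>pIq\<close>, so \<open>w v\<^sup>* v\<close> is a multiple of both \<open>w\<close> and \<open>v\<close>.
\<close>

lemma minimal_corner_line: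
  assumes I: "closed_two_sided_ideal I" and p: "minimal_projection I p" and q: "minimal_projection I q"
  shows "\<exists>v\<in>I. \<forall>x\<in>I. \<exists>c. p * x * q = c *\<^sub>C v"
proof (cases "\<forall>x\<in>I. p * x * q = 0")
  case True
  then show ?thesis using ideal_linear(1)[OF I] by (intro bexI[of _ 0]) auto
next
  case False
  have pp: "adj p = p" "p * p = p" "adj q = q" "q * q = q" "p \<in> I"
    using p q by (auto simp: minimal_projection_def projection_def)
  obtain y where y: "y \<in> I" "p * y * q \<noteq> 0" using False by blast
  define v where "v = p * y * q"
  have vI: "v \<in> I" by (simp add: v_def ideal_mult[OF I] y)
  have vpq: "p * v = v" "v * q = v" by (simp_all add: v_def mult.assoc pp) (simp add: pp flip: mult.assoc)
  have "q * (adj v * v) * q = adj v * v"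
  proof -
    have "q * adj v = adj v" using arg_cong[OF vpq(2), of adj] by (simp only: adj_mult pp)
    then have "q * (adj v * v) = adj v * v" by (simp flip: mult.assoc)
    then show ?thesis by (simp add: mult.assoc vpq)
  qed
  moreover have "adj v * v \<in> I" by (rule ideal_mult[OF I vI])
  ultimately obtain l where l: "adj v * v = l *\<^sub>C q" using q unfolding minimal_projection_def by metis
  have "l \<noteq> 0" using l y(2) cstar_zero_iff[of v] by (auto simp: v_def)
  have "\<exists>c. p * x * q = c *\<^sub>C v" if x: "x \<in> I" for x
  proof -
    have "p * x * q * adj v = p * (x * adj v) * p"
      using arg_cong[OF vpq(1), of adj] arg_cong[OF vpq(2), of adj] by (simp add: adj_mult pp mult.assoc)
    moreover have "x * adj v \<in> I" by (rule ideal_mult[OF I x])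
    ultimately obtain c where c: "p * x * q * adj v = c *\<^sub>C p" using p unfolding minimal_projection_def by metis
    have "l *\<^sub>C (p * x * q) = p * x * (l *\<^sub>C q)" by (simp add: mult_scaleC_right)
    also have "\<dots> = p * x * q * adj v * v" using l vpq
      by (metis (no_types, lifting) mult.assoc mult_scaleC_right pp(4))
    also have "\<dots> = c *\<^sub>C v" by (simp add: c mult_scaleC_left vpq)
    finally have "p * x * q = (inverse l * c) *\<^sub>C v"
      using \<open>l \<noteq> 0\<close> by (metis left_inverse scaleC_one scaleC_scaleC)
    then show ?thesis by blast
  qed
  then show ?thesis using vI by blast
qed

text \<open>
  The element \<open>z = x - sx\<close> satisfies \<open>z z\<^sup>* = z z\<^sup>* s = z (s z)\<^sup>* = 0\<close>.  The right unit is
  applied to \<open>z z\<^sup>*\<close>, which lies in the ideal even before \<open>z\<^sup>*\<close> is known to.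
\<close>

lemma total_family_left_unit:
  assumes I: "closed_two_sided_ideal I" and s: "projection s" "s \<in> I" "\<forall>x\<in>I. x * s = x" and x: "x \<in> I"
  shows "s * x = x"
proof -
  define z where "z = x - s * x"
  have z: "z \<in> I" using x by (simp add: z_def ideal_linear[OF I] ideal_mult[OF I])
  have "s * z = 0" using s(1) by (simp add: z_def ring_distribs projection_def flip: mult.assoc)
  then have zs: "adj z * s = 0" using s(1) by (metis adj_mult adj_zero projection_def)
  have "z * adj z = z * adj z * s" using s(3) ideal_mult(2)[OF I z] by simp
  also have "\<dots> = 0" by (simp add: mult.assoc zs)
  finally have "adj z = 0" using cstar_zero_iff[of "adj z"] by (simp add: adj_adj)
  then have "z = 0" by (metis adj_adj adj_zero)
  then show ?thesis by (simp add: z_def)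
qed

lemma finite_spectra_finite_dimensional:
  assumes I: "closed_two_sided_ideal I" and fs: "finite_spectra I"
  shows "finite_dimensional I"
proof -
  obtain P where P: "minimal_family I P" "\<forall>x\<in>I. x * \<Sum>P = x"
    using exists_total_minimal_family[OF I fs] by blast
  have fin: "finite P" and mp: "\<And>p. p \<in> P \<Longrightarrow> minimal_projection I p"
    using P(1) by (auto simp: minimal_family_def)
  have "\<forall>p q. \<exists>v. p \<in> P \<longrightarrow> q \<in> P \<longrightarrow> v \<in> I \<and> (\<forall>x\<in>I. \<exists>c. p * x * q = c *\<^sub>C v)"
    using minimal_corner_line[OF I] mp by blast
  then obtain v where v: "\<And>p q. p \<in> P \<Longrightarrow> q \<in> P \<Longrightarrow> v p q \<in> I"
    "\<And>p q x. p \<in> P \<Longrightarrow> q \<in> P \<Longrightarrow> x \<in> I \<Longrightarrow> \<exists>c. p * x * q = c *\<^sub>C v p q"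
    by metis
  define B where "B = (\<lambda>(p, q). v p q) ` (P \<times> P)"
  have "\<Sum>P \<in> I" using mp by (intro ideal_linear[OF I]) (auto simp: minimal_projection_def)
  note lu = total_family_left_unit[OF I minimal_family_sum_projection[OF P(1)] this P(2)]
  have "x \<in> complex_vector.span B" if x: "x \<in> I" for x
  proof -
    have "x = \<Sum>P * x * \<Sum>P" using lu[OF x] P(2) x by simp
    also have "\<dots> = (\<Sum>p\<in>P. \<Sum>q\<in>P. p * x * q)"
      by (simp add: sum_distrib_left sum_distrib_right) (rule sum.swap)
    finally have e: "x = (\<Sum>p\<in>P. \<Sum>q\<in>P. p * x * q)" .
    have "(\<Sum>p\<in>P. \<Sum>q\<in>P. p * x * q) \<in> complex_vector.span B"
    proof (intro complex_vector.span_sum)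
      fix p q assume pq: "p \<in> P" "q \<in> P"
      then obtain c where "p * x * q = c *\<^sub>C v p q" using v(2)[OF pq x] by blast
      moreover have "v p q \<in> B" using pq by (auto simp: B_def)
      ultimately show "p * x * q \<in> complex_vector.span B"
        by (simp add: complex_vector.span_base complex_vector.span_scale)
    qed
    then show ?thesis using e by simp
  qed
  moreover have "complex_vector.span B \<subseteq> I"
    using I v(1) by (intro complex_vector.span_minimal) (auto simp: B_def closed_two_sided_ideal_def)
  moreover have "finite B" using fin by (simp add: B_def)
  ultimately show ?thesis unfolding finite_dimensional_def by blast
qed

section \<open>Averaging over signs in a Hilbert space\<close>

context complex_hilbert_space
begin

definition hsq :: "'h \<Rightarrow> real" where
  "hsq x = Re (cinner H x x)"

lemma scalar_ring [simp]:
  "carrier (ring_of_type_algebra :: complex ring) = UNIV"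
  "add (ring_of_type_algebra :: complex ring) = (+)"
  "monoid.mult (ring_of_type_algebra :: complex ring) = (*)"
  "one (ring_of_type_algebra :: complex ring) = 1"
  "zero (ring_of_type_algebra :: complex ring) = 0"
  by (simp_all add: ring_of_type_algebra_def)

lemma scalar_closed [simp]: "x \<in> carrier H \<Longrightarrow> c \<odot>\<^bsub>H\<^esub> x \<in> carrier H"
  by (rule smult_closed) simp_all

lemma cinner_add_right:
  "\<lbrakk>x \<in> carrier H; y \<in> carrier H; z \<in> carrier H\<rbrakk> \<Longrightarrow> cinner H x (y \<oplus>\<^bsub>H\<^esub> z) = cinner H x y + cinner H x z"
  using cinner_add_left[of y z x] cinner_commute[of "y \<oplus>\<^bsub>H\<^esub> z" x] cinner_commute[of y x] cinner_commute[of z x]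
  by simp

lemma cinner_smult_right:
  "\<lbrakk>x \<in> carrier H; y \<in> carrier H\<rbrakk> \<Longrightarrow> cinner H x (c \<odot>\<^bsub>H\<^esub> y) = cnj c * cinner H x y"
  using cinner_smult_left[of y x c] cinner_commute[of "c \<odot>\<^bsub>H\<^esub> y" x] cinner_commute[of y x]
  by simp

lemma cinner_minus_left:
  assumes "x \<in> carrier H" "y \<in> carrier H"
  shows "cinner H (\<ominus>\<^bsub>H\<^esub> x) y = - cinner H x y"
proof -
  have "cinner H (\<zero>\<^bsub>H\<^esub> \<oplus>\<^bsub>H\<^esub> \<zero>\<^bsub>H\<^esub>) y = cinner H \<zero>\<^bsub>H\<^esub> y + cinner H \<zero>\<^bsub>H\<^esub> y"
    by (rule cinner_add_left) (simp_all add: assms)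
  then have "cinner H \<zero>\<^bsub>H\<^esub> y = 0" by simp
  moreover have "cinner H (x \<oplus>\<^bsub>H\<^esub> \<ominus>\<^bsub>H\<^esub> x) y = cinner H x y + cinner H (\<ominus>\<^bsub>H\<^esub> x) y"
    by (rule cinner_add_left) (simp_all add: assms)
  ultimately show ?thesis using assms by (simp add: M.r_neg eq_neg_iff_add_eq_0 add.commute)
qed

lemma cinner_minus_right:
  assumes "x \<in> carrier H" "y \<in> carrier H"
  shows "cinner H y (\<ominus>\<^bsub>H\<^esub> x) = - cinner H y x"
  using cinner_minus_left[OF assms] cinner_commute[of "\<ominus>\<^bsub>H\<^esub> x" y] cinner_commute[of x y] assms by simp

lemma Re_cinner_commute: "\<lbrakk>x \<in> carrier H; y \<in> carrier H\<rbrakk> \<Longrightarrow> Re (cinner H y x) = Re (cinner H x y)"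
  using cinner_commute[of x y] by simp

lemma hsq_add:
  assumes "x \<in> carrier H" "y \<in> carrier H"
  shows "hsq (x \<oplus>\<^bsub>H\<^esub> y) = hsq x + hsq y + 2 * Re (cinner H x y)"
  using assms by (simp add: hsq_def cinner_add_left cinner_add_right Re_cinner_commute[of x y])

lemma hsq_diff:
  assumes "x \<in> carrier H" "y \<in> carrier H"
  shows "hsq (x \<ominus>\<^bsub>H\<^esub> y) = hsq x + hsq y - 2 * Re (cinner H x y)"
  using assms unfolding M.minus_eq
  by (simp add: hsq_add) (simp add: hsq_def cinner_minus_left cinner_minus_right)

lemma hsq_smult: "x \<in> carrier H \<Longrightarrow> hsq (of_real r \<odot>\<^bsub>H\<^esub> x) = r\<^sup>2 * hsq x"
  by (simp add: hsq_def cinner_smult_left cinner_smult_right power2_eq_square)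

lemma hsq_nonneg: "x \<in> carrier H \<Longrightarrow> 0 \<le> hsq x"
  by (simp add: hsq_def cinner_nonneg)

lemma hsq_eq_0: "x \<in> carrier H \<Longrightarrow> hsq x = 0 \<Longrightarrow> x = \<zero>\<^bsub>H\<^esub>"
  using cinner_commute[of x x] by (intro cinner_definite) (auto simp: hsq_def complex_eq_iff)

lemma Re_cinner_le:
  assumes x: "x \<in> carrier H" and y: "y \<in> carrier H"
  shows "Re (cinner H x y) \<le> sqrt (hsq x) * sqrt (hsq y)"
proof -
  define a b c where "a = hsq x" and "b = hsq y" and "c = Re (cinner H x y)"
  have ab: "a \<ge> 0" "b \<ge> 0" using x y by (simp_all add: a_def b_def hsq_nonneg)
  have q: "0 \<le> a + t\<^sup>2 * b - 2 * t * c" for t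
  proof -
    have "0 \<le> hsq (x \<ominus>\<^bsub>H\<^esub> (of_real t \<odot>\<^bsub>H\<^esub> y))" using x y by (intro hsq_nonneg) simp
    then show ?thesis using x y
      by (simp add: hsq_diff hsq_smult cinner_smult_right a_def b_def c_def)
  qed
  have "c\<^sup>2 \<le> a * b"
  proof (cases "b = 0")
    case True
    have "c = 0"
    proof (rule ccontr)
      assume "c \<noteq> 0"
      then show False using q[of "(a + 1) / (2 * c)"] True by simp
    qed
    then show ?thesis using True by simp
  next
    case False
    have "a + (c / b)\<^sup>2 * b - 2 * (c / b) * c = a - c\<^sup>2 / b"
      using False by (simp add: power2_eq_square)
    then have "c\<^sup>2 / b \<le> a" using q[of "c / b"] by simp
    then show ?thesis using ab False by (simp add: pos_divide_le_eq)
  qed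
  then have "\<bar>c\<bar> \<le> sqrt (a * b)" by (metis real_sqrt_abs real_sqrt_le_iff)
  then show ?thesis by (simp add: a_def b_def c_def real_sqrt_mult)
qed

lemma hdist_eq:
  "\<lbrakk>x \<in> carrier H; y \<in> carrier H\<rbrakk> \<Longrightarrow> hdist H x y = sqrt (hsq (x \<ominus>\<^bsub>H\<^esub> y))"
  by (simp add: hdist_def hsq_def)

lemma hdist_sq:
  "\<lbrakk>x \<in> carrier H; y \<in> carrier H\<rbrakk> \<Longrightarrow> (hdist H x y)\<^sup>2 = hsq x + hsq y - 2 * Re (cinner H x y)"
  by (simp add: hdist_eq hsq_nonneg flip: hsq_diff)

lemma hdist_nonneg: "0 \<le> hdist H x y"
  by (simp add: hdist_def cinner_nonneg)

lemma hilbert_Metric_space: "Metric_space (carrier H) (hdist H)"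
proof
  show "0 \<le> hdist H x y" for x y by (rule hdist_nonneg)
  show "hdist H x y = hdist H y x" for x y
  proof (cases "x \<in> carrier H \<and> y \<in> carrier H")
    case True
    then show ?thesis by (simp add: hdist_eq hsq_diff Re_cinner_commute[of x y])
  qed (auto simp: hdist_def)
  show "hdist H x y = 0 \<longleftrightarrow> x = y" if "x \<in> carrier H" "y \<in> carrier H" for x y
  proof
    assume "hdist H x y = 0"
    then have "x \<ominus>\<^bsub>H\<^esub> y = \<zero>\<^bsub>H\<^esub>" using that by (simp add: hdist_eq hsq_eq_0 hsq_nonneg)
    then have "(x \<oplus>\<^bsub>H\<^esub> \<ominus>\<^bsub>H\<^esub> y) \<oplus>\<^bsub>H\<^esub> y = \<zero>\<^bsub>H\<^esub> \<oplus>\<^bsub>H\<^esub> y" by (simp add: M.minus_eq)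
    then show "x = y" using that by (simp add: M.a_assoc M.l_neg)
  next
    assume "x = y"
    then show "hdist H x y = 0" using that by (simp add: hdist_eq hsq_diff) (simp add: hsq_def)
  qed
  show "hdist H x z \<le> hdist H x y + hdist H y z"
    if c: "x \<in> carrier H" "y \<in> carrier H" "z \<in> carrier H" for x y z
  proof -
    define u v where "u = x \<ominus>\<^bsub>H\<^esub> y" and "v = y \<ominus>\<^bsub>H\<^esub> z"
    have uv: "u \<in> carrier H" "v \<in> carrier H" using c by (simp_all add: u_def v_def)
    have "hsq (x \<ominus>\<^bsub>H\<^esub> z) = hsq (u \<oplus>\<^bsub>H\<^esub> v)"
    proof -
      have "Re (cinner H u v) = Re (cinner H x y) - Re (cinner H x z) - hsq y + Re (cinner H y z)"
        unfolding u_def v_def M.minus_eq using c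
        by (simp add: cinner_add_left cinner_add_right cinner_minus_left cinner_minus_right hsq_def)
      then show ?thesis using uv c by (simp add: hsq_add) (simp add: u_def v_def hsq_diff)
    qed
    also have "\<dots> = hsq u + hsq v + 2 * Re (cinner H u v)" by (rule hsq_add[OF uv])
    also have "\<dots> \<le> hsq u + hsq v + 2 * (sqrt (hsq u) * sqrt (hsq v))" using Re_cinner_le[OF uv] by simp
    also have "\<dots> = (sqrt (hsq u) + sqrt (hsq v))\<^sup>2"
      using uv by (simp add: power2_eq_square algebra_simps hsq_nonneg flip: power2_eq_square)
         (simp add: power2_eq_square algebra_simps hsq_nonneg)
    finally have "sqrt (hsq (x \<ominus>\<^bsub>H\<^esub> z)) \<le> sqrt (hsq u) + sqrt (hsq v)"
      using uv by (intro real_le_lsqrt) (auto intro: add_nonneg_nonneg simp: hsq_nonneg)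
    then show ?thesis using c by (simp add: hdist_eq u_def v_def)
  qed
qed

lemma unitary_operatorsD:
  assumes "U \<in> unitary_operators H"
  shows "x \<in> carrier H \<Longrightarrow> U x \<in> carrier H"
    "\<lbrakk>x \<in> carrier H; y \<in> carrier H\<rbrakk> \<Longrightarrow> U (x \<oplus>\<^bsub>H\<^esub> y) = U x \<oplus>\<^bsub>H\<^esub> U y"
    "x \<in> carrier H \<Longrightarrow> U (c \<odot>\<^bsub>H\<^esub> x) = c \<odot>\<^bsub>H\<^esub> U x"
    "\<lbrakk>x \<in> carrier H; y \<in> carrier H\<rbrakk> \<Longrightarrow> cinner H (U x) (U y) = cinner H x y"
    "x \<in> carrier H \<Longrightarrow> hsq (U x) = hsq x"
    "\<lbrakk>x \<in> carrier H; y \<in> carrier H\<rbrakk> \<Longrightarrow> hdist H (U x) (U y) = hdist H x y"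
proof -
  show 1: "x \<in> carrier H \<Longrightarrow> U x \<in> carrier H" for x
  proof -
    have "bij_betw U (carrier H) (carrier H)" using assms by (simp add: unitary_operators_def Bij_def)
    then show "x \<in> carrier H \<Longrightarrow> U x \<in> carrier H" by (rule bij_betwE[THEN bspec])
  qed
  show "\<lbrakk>x \<in> carrier H; y \<in> carrier H\<rbrakk> \<Longrightarrow> U (x \<oplus>\<^bsub>H\<^esub> y) = U x \<oplus>\<^bsub>H\<^esub> U y"
    "x \<in> carrier H \<Longrightarrow> U (c \<odot>\<^bsub>H\<^esub> x) = c \<odot>\<^bsub>H\<^esub> U x"
    using assms by (auto simp: unitary_operators_def)
  show 2: "\<lbrakk>x \<in> carrier H; y \<in> carrier H\<rbrakk> \<Longrightarrow> cinner H (U x) (U y) = cinner H x y" for x y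
    using assms by (auto simp: unitary_operators_def)
  show 3: "x \<in> carrier H \<Longrightarrow> hsq (U x) = hsq x" for x by (simp add: hsq_def 2)
  show "\<lbrakk>x \<in> carrier H; y \<in> carrier H\<rbrakk> \<Longrightarrow> hdist H (U x) (U y) = hdist H x y"
    by (simp add: hdist_eq 1 hsq_diff 2 3)
qed

text \<open>
  Finitely many commuting generators are handled through their exponents: \<open>R c\<close> below stands for the
  unitary with exponent vector \<open>c\<close>, and \<open>coordinate k t\<close> for \<open>t\<close> times the \<open>k\<close>-th unit vector.
\<close>

definition coordinate :: "nat \<Rightarrow> real \<Rightarrow> nat \<Rightarrow> real" where
  "coordinate k t = (\<lambda>j. if j = k then t else 0)"

lemma coordinate_add: "(\<lambda>j. coordinate k a j + coordinate k b j) = coordinate k (a + b)"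
  by (auto simp: coordinate_def)

text \<open>
  The averaging argument.  Suppose all unitaries with exponents in \<open>[-s, s]\<close> move \<open>\<xi>\<close> by at most \<open>\<eta>\<close>.
  Put \<open>T\<^sub>0 = \<xi>\<close> and let \<open>T\<^sub>k\<^sub>+\<^sub>1\<close> be the mean of the images of \<open>T\<^sub>k\<close> under \<open>V\<^sub>k\<close> and
  its inverse, where \<open>V\<^sub>k = R (coordinate k s)\<close>; so \<open>T\<^sub>k\<close> is the average of the images of \<open>\<xi>\<close> under
  all sign choices in the first \<open>k\<close> coordinates.  It stays in the half-space \<open>Re \<langle>y, \<xi>\<rangle> \<ge> \<kappa>\<close> and in the
  ball of radius \<open>\<parallel>\<xi>\<parallel>\<close>, whose intersection lies within \<open>\<eta>\<close> of \<open>\<xi>\<close>.  By the parallelogram law each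
  averaging step lowers the square of the norm by a quarter of the squared distance between the two
  images.  The total loss is at most \<open>\<eta>\<^sup>2\<close>, so one of \<open>N\<close> steps loses at most \<open>\<eta>\<^sup>2/N\<close>, and for it
  \<open>V\<^sub>k\<^sup>2\<close> moves \<open>T\<^sub>k\<close> by at most \<open>2\<eta>/\<surd>N\<close>.  The bound for the \<open>m\<close>-th power of \<open>V\<^sub>k\<^sup>2\<close> grows with
  \<open>m\<close> only in the summand that \<open>N\<close> makes small.
\<close>

lemma some_coordinate_almost_fixes:
  fixes R :: "(nat \<Rightarrow> real) \<Rightarrow> 'h \<Rightarrow> 'h"
  assumes U: "\<And>c. R c \<in> unitary_operators H"
    and hom: "\<And>c d x. x \<in> carrier H \<Longrightarrow> R (\<lambda>j. c j + d j) x = R c (R d x)"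
    and R0: "\<And>x. x \<in> carrier H \<Longrightarrow> R (\<lambda>_. 0) x = x"
    and \<xi>: "\<xi> \<in> carrier H"
    and close: "\<And>c. (\<forall>j. \<bar>c j\<bar> \<le> s) \<Longrightarrow> hdist H (R c \<xi>) \<xi> \<le> \<eta>"
    and s: "s \<ge> 0" and N: "N > 0"
  shows "\<exists>k<N. hdist H (R (coordinate k (2 * s * real m)) \<xi>) \<xi> \<le> 2 * \<eta> + real m * (2 * \<eta> / sqrt (real N))"
proof -
  interpret MS: Metric_space "carrier H" "hdist H" by (rule hilbert_Metric_space)
  note RD = unitary_operatorsD[OF U]
  have \<eta>: "\<eta> \<ge> 0" by (rule order_trans[OF hdist_nonneg close[of "\<lambda>_. 0"]]) (simp add: s)
  define \<kappa> where "\<kappa> = hsq \<xi> - \<eta>\<^sup>2 / 2"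
  define T where "T = rec_nat \<xi> (\<lambda>k y. of_real (1 / 2) \<odot>\<^bsub>H\<^esub> (R (coordinate k s) y \<oplus>\<^bsub>H\<^esub> R (coordinate k (- s)) y))"
  have T0: "T 0 = \<xi>" and TS: "T (Suc k) = of_real (1 / 2) \<odot>\<^bsub>H\<^esub> (R (coordinate k s) (T k) \<oplus>\<^bsub>H\<^esub> R (coordinate k (- s)) (T k))" for k
    by (simp_all add: T_def)
  have Tc: "T k \<in> carrier H" for k
    by (induction k) (simp_all only: T0 TS \<xi>, simp add: RD)
  have half: "\<kappa> \<le> Re (cinner H (R c (T k)) \<xi>)" if "\<forall>j. \<bar>c j\<bar> \<le> s" "\<forall>j<k. c j = 0" for c k
    using that
  proof (induction k arbitrary: c)
    case 0
    have "(hdist H (R c \<xi>) \<xi>)\<^sup>2 \<le> \<eta>\<^sup>2" using close[of c] 0 hdist_nonneg by (intro power_mono) auto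
    then show ?case using \<xi> by (simp add: T0 hdist_sq RD \<kappa>_def)
  next
    case (Suc k)
    have *: "\<kappa> \<le> Re (cinner H (R (\<lambda>j. c j + coordinate k t j) (T k)) \<xi>)" if "\<bar>t\<bar> \<le> s" for t
      by (rule Suc.IH) (use Suc.prems that in \<open>auto simp: coordinate_def\<close>)
    have "R c (T (Suc k)) = of_real (1 / 2) \<odot>\<^bsub>H\<^esub> (R (\<lambda>j. c j + coordinate k s j) (T k) \<oplus>\<^bsub>H\<^esub> R (\<lambda>j. c j + coordinate k (- s) j) (T k))"
      unfolding TS using Tc[of k] by (simp add: RD hom)
    then have "Re (cinner H (R c (T (Suc k))) \<xi>) = (1 / 2) *
       (Re (cinner H (R (\<lambda>j. c j + coordinate k s j) (T k)) \<xi>) + Re (cinner H (R (\<lambda>j. c j + coordinate k (- s) j) (T k)) \<xi>))"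
      using Tc[of k] \<xi> by (simp add: cinner_smult_left cinner_add_left RD)
    then show ?case using *[of s] *[of "- s"] s by simp
  qed
  have half': "\<kappa> \<le> Re (cinner H (T k) \<xi>)" for k
    using half[of "\<lambda>_. 0" k] s by (simp add: R0 Tc)
  define D where "D k = hsq (R (coordinate k s) (T k) \<ominus>\<^bsub>H\<^esub> R (coordinate k (- s)) (T k))" for k
  have D0: "D k \<ge> 0" for k unfolding D_def by (intro hsq_nonneg) (simp add: RD Tc)
  have drop: "hsq (T k) - hsq (T (Suc k)) = D k / 4" for k
    unfolding TS D_def using Tc[of k]
    by (subst hsq_smult) (simp_all add: RD hsq_add hsq_diff power2_eq_square add_divide_distrib)
  have tele: "hsq (T n) = hsq \<xi> - (\<Sum>k<n. D k / 4)" for n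
  proof (induction n)
    case (Suc n)
    then show ?case using drop[of n] by simp
  qed (simp add: T0)
  have Tle: "hsq (T k) \<le> hsq \<xi>" for k unfolding tele using D0 by (simp add: sum_nonneg)
  have near: "hdist H (T k) \<xi> \<le> \<eta>" for k
  proof -
    have "(hdist H (T k) \<xi>)\<^sup>2 \<le> \<eta>\<^sup>2" using half'[of k] Tle[of k] \<xi> Tc by (simp add: hdist_sq \<kappa>_def)
    then show ?thesis using \<eta> by (rule power2_le_imp_le)
  qed
  have "0 \<le> (hdist H (T N) \<xi>)\<^sup>2" by simp
  then have "2 * \<kappa> - hsq \<xi> \<le> hsq (T N)" using half'[of N] \<xi> Tc[of N]
    by (simp add: hdist_sq)
  then have "(\<Sum>k<N. D k / 4) \<le> \<eta>\<^sup>2" unfolding tele by (simp add: \<kappa>_def)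
  then have "\<exists>k<N. D k / 4 \<le> \<eta>\<^sup>2 / real N"
  proof (rule contrapos_pp)
    assume "\<not> (\<exists>k<N. D k / 4 \<le> \<eta>\<^sup>2 / real N)"
    then have "(\<Sum>k<N. \<eta>\<^sup>2 / real N) < (\<Sum>k<N. D k / 4)" using N by (intro sum_strict_mono) auto
    then show "\<not> (\<Sum>k<N. D k / 4) \<le> \<eta>\<^sup>2" using N by simp
  qed
  then obtain k where k: "k < N" "D k / 4 \<le> \<eta>\<^sup>2 / real N" by blast
  define \<tau> where "\<tau> = 2 * \<eta> / sqrt (real N)"
  have "hdist H (R (coordinate k s) (T k)) (R (coordinate k (- s)) (T k)) = sqrt (D k)"
    by (simp add: hdist_eq RD Tc D_def)
  also have "\<dots> \<le> sqrt (4 * (\<eta>\<^sup>2 / real N))" using k(2) by (intro real_sqrt_le_mono) linarith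
  also have "\<dots> = \<tau>" using \<eta> by (simp add: \<tau>_def real_sqrt_mult real_sqrt_divide)
  finally have *: "hdist H (R (coordinate k s) (T k)) (R (coordinate k (- s)) (T k)) \<le> \<tau>" .
  have c0: "coordinate k 0 = (\<lambda>_. 0)" by (auto simp: coordinate_def)
  have Rc: "R (coordinate k a) (R (coordinate k b) x) = R (coordinate k (a + b)) x" if "x \<in> carrier H" for a b x
    unfolding hom[OF that, symmetric] coordinate_add ..
  have "hdist H (R (coordinate k s) (R (coordinate k s) (T k))) (R (coordinate k s) (R (coordinate k (- s)) (T k))) \<le> \<tau>"
    using * by (simp add: RD Tc)
  then have step: "hdist H (R (coordinate k (2 * s)) (T k)) (T k) \<le> \<tau>"
    by (simp add: Rc Tc c0 R0)
  have iter: "hdist H (R (coordinate k (2 * s * real m)) (T k)) (T k) \<le> real m * \<tau>" for m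
  proof (induction m)
    case 0
    then show ?case by (simp add: c0 R0 Tc)
  next
    case (Suc m)
    have "2 * s * real (Suc m) = 2 * s * real m + 2 * s" by (simp add: algebra_simps)
    then have e: "R (coordinate k (2 * s * real (Suc m))) (T k) = R (coordinate k (2 * s * real m)) (R (coordinate k (2 * s)) (T k))"
      by (simp only: Rc Tc)
    have "hdist H (R (coordinate k (2 * s * real (Suc m))) (T k)) (T k) \<le>
       hdist H (R (coordinate k (2 * s * real (Suc m))) (T k)) (R (coordinate k (2 * s * real m)) (T k)) +
       hdist H (R (coordinate k (2 * s * real m)) (T k)) (T k)"
      by (intro MS.triangle RD Tc)
    also have "hdist H (R (coordinate k (2 * s * real (Suc m))) (T k)) (R (coordinate k (2 * s * real m)) (T k))
        = hdist H (R (coordinate k (2 * s)) (T k)) (T k)"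
      unfolding e by (intro RD Tc)
    finally show ?case using step Suc by (simp add: algebra_simps)
  qed
  let ?V = "R (coordinate k (2 * s * real m))"
  have "hdist H (?V \<xi>) \<xi> \<le> hdist H (?V \<xi>) (?V (T k)) + hdist H (?V (T k)) \<xi>"
    by (intro MS.triangle RD Tc \<xi>)
  also have "hdist H (?V \<xi>) (?V (T k)) = hdist H (T k) \<xi>"
    using RD(6)[OF \<xi> Tc] MS.commute by simp
  also have "hdist H (?V (T k)) \<xi> \<le> hdist H (?V (T k)) (T k) + hdist H (T k) \<xi>"
    by (intro MS.triangle RD Tc \<xi>)
  finally have "hdist H (?V \<xi>) \<xi> \<le> 2 * \<eta> + real m * \<tau>" using near[of k] iter[of m] by simp
  then show ?thesis using k(1) \<tau>_def by blast
qed

end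

section \<open>Infinite-dimensional ideals have no representation\<close>

lemma ideal_unitary_carrier: "u \<in> carrier (ideal_unitary_group I) \<longleftrightarrow> u \<in> unitaries \<and> u - 1 \<in> I"
  by (simp add: ideal_unitary_group_def)

text \<open>
  Bounds \<open>exp x - 1\<close> from both sides by multiples of the norm of \<open>x\<close>, for small \<open>x\<close>.
\<close>

lemma norm_exp_minus_linear:
  fixes x :: "'a::unital_cstar_algebra"
  assumes "norm x \<le> 1"
  shows "norm (exp x - 1 - x) \<le> (norm x)\<^sup>2"
proof -
  have e: "exp y = (\<Sum>n. y ^ (n + 2) /\<^sub>R fact (n + 2)) + 1 + y" for y :: "'b::{real_normed_algebra_1,banach}"
    unfolding exp_def using suminf_split_initial_segment[OF summable_exp_generic[of y], of 2]
    by (simp add: numeral_2_eq_2)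
  have s: "summable (\<lambda>n. norm x ^ (n + 2) /\<^sub>R fact (n + 2))"
    using summable_exp_generic[of "norm x"] by (rule summable_ignore_initial_segment)
  have "norm (exp x - 1 - x) = norm (\<Sum>n. x ^ (n + 2) /\<^sub>R fact (n + 2))" by (subst e) simp
  also have "\<dots> \<le> (\<Sum>n. norm x ^ (n + 2) /\<^sub>R fact (n + 2))"
  proof (rule norm_suminf_le[OF _ s])
    show "norm (x ^ (n + 2) /\<^sub>R fact (n + 2)) \<le> norm x ^ (n + 2) /\<^sub>R fact (n + 2)" for n
      using norm_power_ineq[of x "n + 2"] by (simp add: divide_right_mono)
  qed
  also have "\<dots> = exp (norm x) - 1 - norm x" by (subst e) simp
  also have "\<dots> \<le> (norm x)\<^sup>2" using exp_bound[of "norm x"] assms by simp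
  finally show ?thesis .
qed

lemma exp_minus_one_in_ideal:
  assumes I: "closed_two_sided_ideal I" and x: "x \<in> I"
  shows "exp x - 1 \<in> I"
proof -
  have "(\<lambda>n. x ^ Suc n /\<^sub>R fact (Suc n)) sums (exp x - 1)"
    using sums_split_initial_segment[OF exp_converges[of x], of 1] by simp
  moreover have "(\<Sum>n<k. x ^ Suc n /\<^sub>R fact (Suc n)) \<in> I" for k
    by (intro ideal_linear[OF I]) (simp add: ideal_mult[OF I x])
  moreover have "closed I" using I by (simp add: closed_two_sided_ideal_def)
  ultimately show ?thesis unfolding sums_def by (meson closed_sequentially)
qed

lemma adj_exp: "adj (exp x) = exp (adj x)"
proof -
  have "adj (exp x) = (\<Sum>n. adj (x ^ n /\<^sub>R fact n))"
    unfolding exp_def by (rule bounded_linear.suminf[OF bounded_linear_adj summable_exp_generic])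
  then show ?thesis by (simp add: exp_def scaleR_scaleC adj_scaleC adj_power)
qed

lemma exp_i_in_ideal_unitaries:
  assumes I: "closed_two_sided_ideal I" and x: "x \<in> I" "adj x = x"
  shows "exp (\<i> *\<^sub>C x) \<in> carrier (ideal_unitary_group I)"
proof -
  have "adj (exp (\<i> *\<^sub>C x)) = exp (- (\<i> *\<^sub>C x))"
    by (simp add: adj_exp adj_scaleC x complex_vector.scale_minus_left)
  then have "exp (\<i> *\<^sub>C x) \<in> unitaries"
    using exp_minus_inverse[of "\<i> *\<^sub>C x"] exp_minus_inverse[of "- (\<i> *\<^sub>C x)"]
    by (simp add: unitaries_def)
  then show ?thesis
    by (simp add: ideal_unitary_carrier exp_minus_one_in_ideal[OF I] ideal_linear[OF I] x)
qed

lemma c0_sequence_scale: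
  assumes "c0_sequence h" "t > 0"
  shows "c0_sequence (\<lambda>n. t *\<^sub>R h n)"
proof -
  obtain C e where h: "\<And>j. adj (h j) = h j" "\<And>i j. h i * h j = h j * h i" and C: "C \<ge> 0"
    "\<And>N c s. (\<forall>j<N. \<bar>c j\<bar> \<le> s) \<Longrightarrow> 0 \<le> s \<Longrightarrow> norm (\<Sum>j<N. c j *\<^sub>R h j) \<le> C * s"
    and e: "e > 0" "\<And>j. norm (h j) \<ge> e"
    using assms(1) unfolding c0_sequence_def by metis
  have "norm (\<Sum>j<N. c j *\<^sub>R t *\<^sub>R h j) \<le> (C * t) * s" if "\<forall>j<N. \<bar>c j\<bar> \<le> s" "0 \<le> s" for N c s
    using C(2)[of N "\<lambda>j. c j * t" "t * s"] that assms(2)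
    by (simp add: abs_mult mult.commute mult.left_commute mult_left_mono)
  moreover have "C * t \<ge> 0" using C assms(2) by simp
  ultimately have "\<exists>C\<ge>0. \<forall>N c s. (\<forall>j<N. \<bar>c j\<bar> \<le> s) \<longrightarrow> 0 \<le> s \<longrightarrow> norm (\<Sum>j<N. c j *\<^sub>R t *\<^sub>R h j) \<le> C * s"
    by blast
  moreover have "\<exists>e>0. \<forall>j. norm (t *\<^sub>R h j) \<ge> e"
    using e assms(2) by (intro exI[of _ "t * e"]) auto
  ultimately show ?thesis
    using h by (simp add: c0_sequence_def scaleR_scaleC adj_scaleC mult_scaleC_left mult_scaleC_right)
qed

lemma c0_sequence_subsequence:
  assumes "c0_sequence h" "strict_mono f"
  shows "c0_sequence (h \<circ> f)"
proof -
  obtain C e where h: "\<And>j. adj (h j) = h j" "\<And>i j. h i * h j = h j * h i" and C: "C \<ge> 0"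
    "\<And>N c s. (\<forall>j<N. \<bar>c j\<bar> \<le> s) \<Longrightarrow> 0 \<le> s \<Longrightarrow> norm (\<Sum>j<N. c j *\<^sub>R h j) \<le> C * s"
    and e: "e > 0" "\<And>j. norm (h j) \<ge> e"
    using assms(1) unfolding c0_sequence_def by metis
  have inj: "inj f" using assms(2) by (rule strict_mono_imp_inj_on)
  have "norm (\<Sum>j<N. c j *\<^sub>R h (f j)) \<le> C * s" if c: "\<forall>j<N. \<bar>c j\<bar> \<le> s" "0 \<le> s" for N c s
  proof -
    define d where "d i = (if i \<in> f ` {..<N} then c (inv_into UNIV f i) else 0)" for i
    have "(\<Sum>j<N. c j *\<^sub>R h (f j)) = (\<Sum>i\<in>f ` {..<N}. d i *\<^sub>R h i)"
      using inj by (subst sum.reindex) (auto simp: d_def inj_on_def)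
    also have "\<dots> = (\<Sum>i<f N. d i *\<^sub>R h i)"
      by (rule sum.mono_neutral_left) (use assms(2) in \<open>auto simp: strict_mono_less d_def\<close>)
    finally have e: "(\<Sum>j<N. c j *\<^sub>R h (f j)) = (\<Sum>i<f N. d i *\<^sub>R h i)" .
    have "\<forall>j<f N. \<bar>d j\<bar> \<le> s" using c inj by (auto simp: d_def)
    then show ?thesis unfolding e using C(2) c(2) by blast
  qed
  then have "\<exists>C\<ge>0. \<forall>N c s. (\<forall>j<N. \<bar>c j\<bar> \<le> s) \<longrightarrow> 0 \<le> s \<longrightarrow> norm (\<Sum>j<N. c j *\<^sub>R (h \<circ> f) j) \<le> C * s"
    using C(1) by auto
  then show ?thesis using h e by (auto simp: c0_sequence_def)
qed

context complex_hilbert_space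
begin

text \<open>
  Coefficients of size \<open>s = 1/(2m)\<close> give unitaries so close to \<open>1\<close> that they move \<open>\<xi>\<close> by less than
  \<open>\<eta>\<close>, whatever their number \<open>N\<close>: this is where the \<open>c\<^sub>0\<close>-bound enters.  The generator
  \<open>exp (\<i> h\<^sub>k)\<close> is the \<open>2m\<close>-th power of \<open>exp (\<i> s h\<^sub>k)\<close>, and \<open>N = (2m)\<^sup>2\<close> makes the averaging
  bound equal to \<open>3\<eta> < \<epsilon>\<close>.
\<close>

lemma c0_sequence_some_almost_fixes:
  fixes I :: "'a::unital_cstar_algebra set"
  assumes I: "closed_two_sided_ideal I" and h: "c0_sequence h" "range h \<subseteq> I"
    and U: "\<And>u. u \<in> carrier (ideal_unitary_group I) \<Longrightarrow> \<phi> u \<in> unitary_operators H"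
    and hom: "\<And>u v x. \<lbrakk>u \<in> carrier (ideal_unitary_group I); v \<in> carrier (ideal_unitary_group I); x \<in> carrier H\<rbrakk>
        \<Longrightarrow> \<phi> (u * v) x = \<phi> u (\<phi> v x)"
    and one: "\<And>x. x \<in> carrier H \<Longrightarrow> \<phi> 1 x = x"
    and \<xi>: "\<xi> \<in> carrier H"
    and cont: "\<And>\<eta>. \<eta> > 0 \<Longrightarrow> \<exists>\<delta>>0. \<forall>u\<in>carrier (ideal_unitary_group I).
        norm (u - 1) < \<delta> \<longrightarrow> hdist H (\<phi> u \<xi>) \<xi> < \<eta>"
    and \<epsilon>: "\<epsilon> > 0"
  shows "\<exists>k. hdist H (\<phi> (exp (\<i> *\<^sub>C h k)) \<xi>) \<xi> < \<epsilon>"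
proof -
  obtain C where hh: "\<And>j. adj (h j) = h j" "\<And>i j. h i * h j = h j * h i" and C: "C \<ge> 0"
    "\<And>N c s. (\<forall>j<N. \<bar>c j\<bar> \<le> s) \<Longrightarrow> 0 \<le> s \<Longrightarrow> norm (\<Sum>j<N. c j *\<^sub>R h j) \<le> C * s"
    using h(1) unfolding c0_sequence_def by metis
  define \<eta> where "\<eta> = \<epsilon> / 4"
  have \<eta>: "\<eta> > 0" using \<epsilon> by (simp add: \<eta>_def)
  obtain \<delta> where \<delta>: "\<delta> > 0" "\<And>u. u \<in> carrier (ideal_unitary_group I) \<Longrightarrow> norm (u - 1) < \<delta> \<Longrightarrow> hdist H (\<phi> u \<xi>) \<xi> < \<eta>"
    using cont[OF \<eta>] by blast
  define r where "r = min 1 (\<delta> / 3)"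
  have r: "r > 0" "r \<le> 1" "2 * r < \<delta>" using \<delta>(1) by (auto simp: r_def)
  obtain m :: nat where m: "(C + 1) / r < real m" using reals_Archimedean2 by blast
  have "0 < (C + 1) / r" using C(1) r(1) by simp
  then have m0: "real m > 0" using m by linarith
  define s where "s = 1 / (2 * real m)"
  have s: "s > 0" "2 * s * real m = 1" using m0 by (simp_all add: s_def)
  have Cs: "C * s \<le> r"
  proof -
    have "C + 1 < real m * r" using m r(1) by (simp add: pos_divide_less_eq)
    moreover have "0 < real m * r" using r(1) m0 by simp
    ultimately have "C \<le> r * (2 * real m)" by (simp add: algebra_simps)
    then show ?thesis using m0 by (simp add: s_def pos_divide_le_eq)
  qed
  define N where "N = (2 * m) ^ 2"
  have "real N = (2 * real m)\<^sup>2" by (simp add: N_def)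
  then have N: "N > 0" "sqrt (real N) = 2 * real m"
    using m0 real_sqrt_abs[of "2 * real m"] by (simp_all add: N_def del: real_sqrt_abs)
  define L where "L c = (\<Sum>j<N. c j *\<^sub>R h j)" for c :: "nat \<Rightarrow> real"
  have LI: "L c \<in> I" for c
    unfolding L_def using h(2) by (intro ideal_linear[OF I]) (auto intro: ideal_linear[OF I])
  have La: "adj (L c) = L c" for c
    by (simp add: L_def adj_sum scaleR_scaleC adj_scaleC hh)
  have Ladd: "L (\<lambda>j. c j + d j) = L c + L d" for c d
    by (simp add: L_def scaleR_add_left sum.distrib)
  have Lcomm: "L c * L d = L d * L c" for c d
  proof -
    have "L c * L d = (\<Sum>i<N. \<Sum>j<N. (c i * d j) *\<^sub>R (h i * h j))"
      by (simp add: L_def sum_product mult.commute)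
    also have "\<dots> = (\<Sum>j<N. \<Sum>i<N. (d j * c i) *\<^sub>R (h j * h i))"
      by (subst sum.swap) (simp add: mult.commute hh(2))
    also have "\<dots> = L d * L c" by (simp add: L_def sum_product mult.commute)
    finally show ?thesis .
  qed
  define E where "E c = exp (\<i> *\<^sub>C L c)" for c
  have EU: "E c \<in> carrier (ideal_unitary_group I)" for c
    unfolding E_def by (rule exp_i_in_ideal_unitaries[OF I LI La])
  have Eadd: "E (\<lambda>j. c j + d j) = E c * E d" for c d
    unfolding E_def Ladd scaleC_add_right
    by (rule exp_add_commuting) (simp add: mult_scaleC_left mult_scaleC_right Lcomm)
  have E0: "E (\<lambda>_. 0) = 1" by (simp add: E_def L_def)
  have small: "norm (E c - 1) < \<delta>" if "\<forall>j. \<bar>c j\<bar> \<le> s" for c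
  proof -
    have "norm (L c) \<le> C * s" unfolding L_def using that s(1) by (intro C(2)) auto
    then have n: "norm (\<i> *\<^sub>C L c) \<le> r" using Cs by (simp add: norm_scaleC)
    then have n1: "norm (\<i> *\<^sub>C L c) \<le> 1" using r by simp
    have "norm (E c - 1) \<le> norm (E c - 1 - \<i> *\<^sub>C L c) + norm (\<i> *\<^sub>C L c)"
      using norm_triangle_ineq[of "E c - 1 - \<i> *\<^sub>C L c" "\<i> *\<^sub>C L c"] by simp
    also have "\<dots> \<le> (norm (\<i> *\<^sub>C L c))\<^sup>2 + norm (\<i> *\<^sub>C L c)"
      unfolding E_def using norm_exp_minus_linear[OF n1] by simp
    also have "\<dots> \<le> 2 * norm (\<i> *\<^sub>C L c)"
      using mult_right_mono[OF n1, of "norm (\<i> *\<^sub>C L c)"] by (simp add: power2_eq_square)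
    finally show ?thesis using n r(3) by linarith
  qed
  have "\<exists>k<N. hdist H (\<phi> (E (coordinate k (2 * s * real m))) \<xi>) \<xi> \<le> 2 * \<eta> + real m * (2 * \<eta> / sqrt (real N))"
  proof (rule some_coordinate_almost_fixes[where R = "\<lambda>c. \<phi> (E c)"])
    show "\<phi> (E c) \<in> unitary_operators H" for c by (intro U EU)
    show "\<phi> (E (\<lambda>j. c j + d j)) x = \<phi> (E c) (\<phi> (E d) x)" if "x \<in> carrier H" for c d x
      unfolding Eadd by (rule hom[OF EU EU that])
    show "\<phi> (E (\<lambda>_. 0)) x = x" if "x \<in> carrier H" for x using one[OF that] by (simp add: E0)
    show "hdist H (\<phi> (E c) \<xi>) \<xi> \<le> \<eta>" if "\<forall>j. \<bar>c j\<bar> \<le> s" for c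
      using \<delta>(2)[OF EU small[OF that]] by simp
  qed (use \<xi> s N in auto)
  then obtain k where k: "k < N" "hdist H (\<phi> (E (coordinate k 1)) \<xi>) \<xi> \<le> 2 * \<eta> + real m * (2 * \<eta> / sqrt (real N))"
    using s(2) by auto
  have "L (coordinate k 1) = (\<Sum>j<N. if j = k then h j else 0)"
    unfolding L_def coordinate_def by (intro sum.cong) auto
  then have "L (coordinate k 1) = h k" using k(1) by simp
  moreover have "2 * \<eta> + real m * (2 * \<eta> / sqrt (real N)) < \<epsilon>"
    using m0 \<epsilon> by (simp add: N(2) \<eta>_def)
  ultimately show ?thesis using k(2) by (intro exI[of _ k]) (simp add: E_def)
qed

text \<open>
  Every subsequence of a \<open>c\<^sub>0\<close>-sequence is one, so the exceptional indices cannot form an infinite set.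
  Finiteness allows finitely many vectors to be treated at once.
\<close>

lemma c0_sequence_almost_all_fix:
  fixes I :: "'a::unital_cstar_algebra set"
  assumes I: "closed_two_sided_ideal I" and h: "c0_sequence h" "range h \<subseteq> I"
    and U: "\<And>u. u \<in> carrier (ideal_unitary_group I) \<Longrightarrow> \<phi> u \<in> unitary_operators H"
    and hom: "\<And>u v x. \<lbrakk>u \<in> carrier (ideal_unitary_group I); v \<in> carrier (ideal_unitary_group I); x \<in> carrier H\<rbrakk>
        \<Longrightarrow> \<phi> (u * v) x = \<phi> u (\<phi> v x)"
    and one: "\<And>x. x \<in> carrier H \<Longrightarrow> \<phi> 1 x = x"
    and \<xi>: "\<xi> \<in> carrier H"
    and cont: "\<And>\<eta>. \<eta> > 0 \<Longrightarrow> \<exists>\<delta>>0. \<forall>u\<in>carrier (ideal_unitary_group I).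
        norm (u - 1) < \<delta> \<longrightarrow> hdist H (\<phi> u \<xi>) \<xi> < \<eta>"
    and \<epsilon>: "\<epsilon> > 0"
  shows "finite {k. \<epsilon> \<le> hdist H (\<phi> (exp (\<i> *\<^sub>C h k)) \<xi>) \<xi>}" (is "finite ?S")
proof (rule ccontr)
  assume inf: "infinite ?S"
  define f where "f = enumerate ?S"
  have "strict_mono f" unfolding f_def using strict_mono_enumerate[OF inf] .
  moreover have "range (h \<circ> f) \<subseteq> I" using h(2) by auto
  ultimately obtain k where "hdist H (\<phi> (exp (\<i> *\<^sub>C (h \<circ> f) k)) \<xi>) \<xi> < \<epsilon>"
    using c0_sequence_some_almost_fixes[OF I c0_sequence_subsequence[OF h(1)] _ U hom one \<xi> cont \<epsilon>]
    by blast
  moreover have "f k \<in> ?S" unfolding f_def by (rule enumerate_in_set[OF inf])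
  ultimately show False by simp
qed

lemma unitary_group_mult:
  assumes "f \<in> unitary_operators H" "g \<in> unitary_operators H" "x \<in> carrier H"
  shows "monoid.mult (unitary_group H) f g x = f (g x)"
  using assms by (simp add: unitary_group_def BijGroup_def unitary_operators_def compose_def)

lemma continuous_at_one:
  fixes \<phi> :: "'a::real_normed_algebra_1 \<Rightarrow> 'h \<Rightarrow> 'h"
  assumes c: "continuous_map (top_of_set S) (strong_operator_topology H) \<phi>"
    and one: "1 \<in> S" "\<phi> 1 \<xi> = \<xi>" and \<xi>: "\<xi> \<in> carrier H" and \<eta>: "\<eta> > 0"
  shows "\<exists>\<delta>>0. \<forall>u\<in>S. norm (u - 1) < \<delta> \<longrightarrow> hdist H (\<phi> u \<xi>) \<xi> < \<eta>"
proof -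
  interpret MS: Metric_space "carrier H" "hdist H" by (rule hilbert_Metric_space)
  have "continuous_map (top_of_set S) (product_topology (\<lambda>_. MS.mtopology) (carrier H)) \<phi>"
    using c unfolding strong_operator_topology_def by (simp add: continuous_map_in_subtopology)
  then have ev: "continuous_map (top_of_set S) MS.mtopology (\<lambda>u. \<phi> u \<xi>)"
    using \<xi> by (simp add: continuous_map_componentwise)
  have "openin (top_of_set S) {u \<in> topspace (top_of_set S). \<phi> u \<xi> \<in> MS.mball \<xi> \<eta>}"
    by (rule openin_continuous_map_preimage[OF ev MS.openin_mball])
  moreover have "1 \<in> {u \<in> topspace (top_of_set S). \<phi> u \<xi> \<in> MS.mball \<xi> \<eta>}"
    using one \<xi> \<eta> by simp
  ultimately obtain \<delta> where \<delta>: "\<delta> > 0" "ball 1 \<delta> \<inter> S \<subseteq> {u \<in> topspace (top_of_set S). \<phi> u \<xi> \<in> MS.mball \<xi> \<eta>}"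
    unfolding openin_contains_ball by blast
  have "hdist H (\<phi> u \<xi>) \<xi> < \<eta>" if "u \<in> S" "norm (u - 1) < \<delta>" for u
  proof -
    have "u \<in> ball 1 \<delta> \<inter> S" using that by (simp add: dist_norm norm_minus_commute)
    then have "\<phi> u \<xi> \<in> MS.mball \<xi> \<eta>" using \<delta>(2) by blast
    then show ?thesis by (simp add: MS.commute)
  qed
  then show ?thesis using \<delta>(1) by blast
qed

text \<open>
  The inverse of the representation is continuous at the identity operator, and a basic neighbourhood
  in the topology of pointwise convergence restricts only finitely many coordinates.
\<close>

lemma finitely_many_vectors_control_norm:
  fixes \<phi> :: "'a::real_normed_algebra_1 \<Rightarrow> 'h \<Rightarrow> 'h"
  assumes h: "homeomorphic_map (top_of_set S) (subtopology (strong_operator_topology H) K) \<phi>"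
    and K: "\<phi> ` S \<subseteq> unitary_operators H" "\<phi> ` S \<subseteq> K"
    and one: "1 \<in> S" "\<And>x. x \<in> carrier H \<Longrightarrow> \<phi> 1 x = x" and c: "c > 0"
  shows "\<exists>\<Xi> \<epsilon>. finite \<Xi> \<and> \<Xi> \<subseteq> carrier H \<and> \<epsilon> > 0 \<and>
    (\<forall>u\<in>S. (\<forall>\<xi>\<in>\<Xi>. hdist H (\<phi> u \<xi>) \<xi> < \<epsilon>) \<longrightarrow> norm (u - 1) < c)"
proof -
  interpret MS: Metric_space "carrier H" "hdist H" by (rule hilbert_Metric_space)
  define W where "W = S \<inter> ball 1 c"
  have "openin (top_of_set S) W" unfolding W_def by (simp add: openin_open_Int)
  then have "openin (subtopology (strong_operator_topology H) K) (\<phi> ` W)"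
    using homeomorphic_imp_open_map[OF h] by (simp add: open_map_def)
  then obtain V where V: "openin (product_topology (\<lambda>_. MS.mtopology) (carrier H)) V"
    "\<phi> ` W = V \<inter> unitary_operators H \<inter> K"
    unfolding strong_operator_topology_def by (auto simp: openin_subtopology)
  have inj: "inj_on \<phi> S" using homeomorphic_imp_injective_map[OF h] by simp
  have "1 \<in> W" using one c by (simp add: W_def)
  then have "\<phi> 1 \<in> V" using V(2) by blast
  then obtain B where B: "finite {i \<in> carrier H. B i \<noteq> carrier H}" "\<forall>i\<in>carrier H. openin MS.mtopology (B i)"
     "\<phi> 1 \<in> Pi\<^sub>E (carrier H) B" "Pi\<^sub>E (carrier H) B \<subseteq> V"
    using V(1) unfolding openin_product_topology_alt by auto
  define \<Xi> where "\<Xi> = {i \<in> carrier H. B i \<noteq> carrier H}"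
  have "\<exists>r>0. MS.mball i r \<subseteq> B i" if "i \<in> carrier H" for i
  proof -
    have "i \<in> B i" using B(3) that one(2)[OF that] by (metis PiE_mem)
    then show ?thesis using B(2) that by (simp add: MS.openin_mtopology)
  qed
  then obtain r where r: "\<And>i. i \<in> carrier H \<Longrightarrow> r i > 0" "\<And>i. i \<in> carrier H \<Longrightarrow> MS.mball i (r i) \<subseteq> B i"
    by metis
  define \<epsilon> where "\<epsilon> = Min (insert 1 (r ` \<Xi>))"
  have fin: "finite \<Xi>" using B(1) by (simp add: \<Xi>_def)
  have \<epsilon>: "\<epsilon> > 0" unfolding \<epsilon>_def using fin r by (auto simp: \<Xi>_def)
  have \<epsilon>r: "\<epsilon> \<le> r i" if "i \<in> \<Xi>" for i unfolding \<epsilon>_def using fin that by (intro Min_le) auto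
  have "norm (u - 1) < c" if u: "u \<in> S" "\<forall>\<xi>\<in>\<Xi>. hdist H (\<phi> u \<xi>) \<xi> < \<epsilon>" for u
  proof -
    have uo: "\<phi> u \<in> unitary_operators H" "\<phi> u \<in> K" using K u(1) by auto
    have "\<phi> u i \<in> B i" if i: "i \<in> carrier H" for i
    proof (cases "i \<in> \<Xi>")
      case True
      then have "hdist H i (\<phi> u i) < r i" using u(2) \<epsilon>r[OF True] by (fastforce simp: MS.commute)
      then have "\<phi> u i \<in> MS.mball i (r i)" using i unitary_operatorsD(1)[OF uo(1) i] by simp
      then show ?thesis using r(2)[OF i] by blast
    next
      case False
      then show ?thesis using i unitary_operatorsD(1)[OF uo(1) i] by (simp add: \<Xi>_def)
    qed
    moreover have "\<phi> u \<in> extensional (carrier H)" using uo(1) by (simp add: unitary_operators_def Bij_def)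
    ultimately have "\<phi> u \<in> Pi\<^sub>E (carrier H) B" by (simp add: PiE_iff)
    then have "\<phi> u \<in> \<phi> ` W" using B(4) V(2) uo by blast
    then have "u \<in> W" using inj u(1) by (auto simp: W_def inj_on_def)
    then show ?thesis by (simp add: W_def dist_norm norm_minus_commute)
  qed
  then show ?thesis using fin \<epsilon> by (intro exI[of _ \<Xi>] exI[of _ \<epsilon>]) (auto simp: \<Xi>_def)
qed

text \<open>
  After scaling to norm at most \<open>1/2\<close>, the unitaries \<open>exp (\<i> h\<^sub>k)\<close> stay at a fixed distance from \<open>1\<close>,
  whereas almost all of them lie in any given strong neighbourhood of the identity.
\<close>

lemma c0_sequence_no_representation:
  fixes I :: "'a::unital_cstar_algebra set"
  assumes I: "closed_two_sided_ideal I" and h: "c0_sequence h" "range h \<subseteq> I"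
    and K: "subgroup K (unitary_group H)"
    and iso: "\<phi> \<in> iso (ideal_unitary_group I) ((unitary_group H)\<lparr>carrier := K\<rparr>)"
    and homeo: "homeomorphic_map (top_of_set (carrier (ideal_unitary_group I)))
        (subtopology (strong_operator_topology H) K) \<phi>"
  shows False
proof -
  interpret MS: Metric_space "carrier H" "hdist H" by (rule hilbert_Metric_space)
  let ?G = "carrier (ideal_unitary_group I)"
  have KU: "K \<subseteq> unitary_operators H" using subgroup.subset[OF K] by (simp add: unitary_group_def)
  have \<phi>K: "\<phi> u \<in> K" if "u \<in> ?G" for u using iso that by (auto simp: iso_def hom_def)
  have U: "\<phi> u \<in> unitary_operators H" if "u \<in> ?G" for u using \<phi>K[OF that] KU by blast
  have hom: "\<phi> (u * v) x = \<phi> u (\<phi> v x)" if "u \<in> ?G" "v \<in> ?G" "x \<in> carrier H" for u v x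
  proof -
    have "\<phi> (u \<otimes>\<^bsub>ideal_unitary_group I\<^esub> v) = \<phi> u \<otimes>\<^bsub>unitary_group H\<^esub> \<phi> v"
      using iso that by (simp add: iso_def hom_def)
    then show ?thesis using that U by (simp add: ideal_unitary_group_def unitary_group_mult)
  qed
  have oneG: "1 \<in> ?G" using ideal_linear(1)[OF I] by (simp add: ideal_unitary_carrier unitaries_def)
  have one: "\<phi> 1 x = x" if x: "x \<in> carrier H" for x
  proof -
    note D = unitary_operatorsD[OF U[OF oneG]]
    have "hdist H (\<phi> 1 (\<phi> 1 x)) (\<phi> 1 x) = hdist H (\<phi> 1 x) x" by (intro D x)
    moreover have "\<phi> 1 (\<phi> 1 x) = \<phi> 1 x" using hom[OF oneG oneG x] by simp
    ultimately show ?thesis using D(1)[OF x] x MS.zero by metis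
  qed
  have "continuous_map (top_of_set ?G) (strong_operator_topology H) \<phi>"
    using homeomorphic_imp_continuous_map[OF homeo] by (simp add: continuous_map_in_subtopology)
  note cont = continuous_at_one[OF this oneG one]
  obtain C e where hh: "\<And>j. adj (h j) = h j" and C: "C \<ge> 0"
    "\<And>N c s. (\<forall>j<N. \<bar>c j\<bar> \<le> s) \<Longrightarrow> 0 \<le> s \<Longrightarrow> norm (\<Sum>j<N. c j *\<^sub>R h j) \<le> C * s"
    and e: "e > 0" "\<And>j. norm (h j) \<ge> e"
    using h(1) unfolding c0_sequence_def by metis
  have hC: "norm (h j) \<le> C" for j
  proof -
    have "(\<Sum>i<Suc j. (if i = j then 1 else 0) *\<^sub>R h i) = h j" by simp
    moreover have "norm (\<Sum>i<Suc j. (if i = j then 1 else 0) *\<^sub>R h i) \<le> C * 1" by (intro C(2)) auto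
    ultimately show ?thesis by simp
  qed
  define t where "t = 1 / (2 * (C + 1))"
  have t: "t > 0" "t * C \<le> 1 / 2" using C(1) by (simp_all add: t_def field_simps)
  define g where "g n = t *\<^sub>R h n" for n
  have g: "c0_sequence g" unfolding g_def by (rule c0_sequence_scale[OF h(1) t(1)])
  have gI: "range g \<subseteq> I" using h(2) by (auto simp: g_def intro: ideal_linear[OF I])
  have ga: "adj (g j) = g j" for j by (simp add: g_def scaleR_scaleC adj_scaleC hh)
  have far: "norm (exp (\<i> *\<^sub>C g k) - 1) \<ge> t * e / 2" for k
  proof -
    let ?x = "\<i> *\<^sub>C g k"
    have n: "norm ?x = t * norm (h k)" using t(1) by (simp add: norm_scaleC g_def)
    have "t * norm (h k) \<le> t * C" using hC t(1) by simp
    then have n2: "norm ?x \<le> 1 / 2" using n t(2) by linarith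
    have "norm ?x \<le> norm (exp ?x - 1) + norm (exp ?x - 1 - ?x)"
      using norm_triangle_ineq4[of "exp ?x - 1" "exp ?x - 1 - ?x"] by simp
    also have "norm (exp ?x - 1 - ?x) \<le> (norm ?x)\<^sup>2" using n2 by (intro norm_exp_minus_linear) simp
    also have "(norm ?x)\<^sup>2 \<le> norm ?x / 2"
      using mult_right_mono[OF n2, of "norm ?x"] by (simp add: power2_eq_square)
    finally have "norm ?x / 2 \<le> norm (exp ?x - 1)" by simp
    moreover have "t * e \<le> norm ?x" unfolding n using t(1) e(2) by simp
    ultimately show ?thesis by linarith
  qed
  have "t * e / 2 > 0" using t e by simp
  then obtain \<Xi> \<epsilon> where \<Xi>: "finite \<Xi>" "\<Xi> \<subseteq> carrier H" "\<epsilon> > 0"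
    "\<And>u. u \<in> ?G \<Longrightarrow> (\<forall>\<xi>\<in>\<Xi>. hdist H (\<phi> u \<xi>) \<xi> < \<epsilon>) \<Longrightarrow> norm (u - 1) < t * e / 2"
    using finitely_many_vectors_control_norm[OF homeo _ _ oneG one, of "t * e / 2"] U \<phi>K by (metis image_subsetI)
  have "finite (\<Union>\<xi>\<in>\<Xi>. {k. \<epsilon> \<le> hdist H (\<phi> (exp (\<i> *\<^sub>C g k)) \<xi>) \<xi>})"
  proof (intro finite_UN_I \<Xi>)
    fix \<xi> assume "\<xi> \<in> \<Xi>"
    then have \<xi>: "\<xi> \<in> carrier H" using \<Xi>(2) by blast
    show "finite {k. \<epsilon> \<le> hdist H (\<phi> (exp (\<i> *\<^sub>C g k)) \<xi>) \<xi>}"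
      by (rule c0_sequence_almost_all_fix[OF I g gI U hom one \<xi> cont[OF \<xi> \<xi>] \<Xi>(3)])
  qed
  then obtain k where "k \<notin> (\<Union>\<xi>\<in>\<Xi>. {k. \<epsilon> \<le> hdist H (\<phi> (exp (\<i> *\<^sub>C g k)) \<xi>) \<xi>})"
    using ex_new_if_finite[OF infinite_UNIV_nat] by blast
  then have "\<forall>\<xi>\<in>\<Xi>. hdist H (\<phi> (exp (\<i> *\<^sub>C g k)) \<xi>) \<xi> < \<epsilon>" by auto
  moreover have "exp (\<i> *\<^sub>C g k) \<in> ?G" using gI by (intro exp_i_in_ideal_unitaries[OF I] ga) auto
  ultimately show False using \<Xi>(4) far[of k] by fastforce
qed

end

lemma representable_imp_finite_dimensional:
  fixes I :: "'a::unital_cstar_algebra set"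
  assumes I: "closed_two_sided_ideal I"
    and r: "strongly_unitarily_representable TYPE('h) (ideal_unitary_group I)
           (top_of_set (carrier (ideal_unitary_group I)))"
  shows "finite_dimensional I"
proof (rule ccontr)
  assume "\<not> finite_dimensional I"
  then obtain x where "x \<in> I" "adj x = x" "infinite (spectrum x)"
    using finite_spectra_finite_dimensional[OF I] unfolding finite_spectra_def by blast
  then obtain h where h: "c0_sequence h" "range h \<subseteq> I"
    using infinite_spectrum_c0_sequence[OF I] by blast
  obtain H :: "'h inner_module" and K \<phi> where
    "complex_hilbert_space H" "subgroup K (unitary_group H)"
    "\<phi> \<in> iso (ideal_unitary_group I) ((unitary_group H)\<lparr>carrier := K\<rparr>)"
    "homeomorphic_map (top_of_set (carrier (ideal_unitary_group I)))
       (subtopology (strong_operator_topology H) K) \<phi>"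
    using r unfolding strongly_unitarily_representable_def by blast
  then show False using complex_hilbert_space.c0_sequence_no_representation[OF _ I h] by blast
qed

section \<open>The Hilbert space of a finite-dimensional ideal\<close>

locale total_minimal_family =
  fixes I P :: "'a::unital_cstar_algebra set"
  assumes ideal: "closed_two_sided_ideal I"
    and family: "minimal_family I P"
    and total: "x \<in> I \<Longrightarrow> x * \<Sum>P = x"
begin

definition unit_of_ideal :: 'a where
  "unit_of_ideal = \<Sum>P"

text \<open>
  The state of the ideal attached to a minimal projection \<open>p\<close>.  Minimality determines the scalar for
  \<open>y\<close> in the ideal.
\<close>

definition coef :: "'a \<Rightarrow> 'a \<Rightarrow> complex" where
  "coef p y = (SOME c. p * y * p = c *\<^sub>C p)"

definition form :: "'a \<Rightarrow> 'a \<Rightarrow> complex" where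
  "form x y = (\<Sum>p\<in>P. coef p (adj y * x))"

definition form_norm :: "'a \<Rightarrow> real" where
  "form_norm x = L2_set (\<lambda>p. norm (x * p)) P"

lemmas ideal_mem = ideal_mult[OF ideal] ideal_linear[OF ideal]

lemma finite_P: "finite P"
  using family by (simp add: minimal_family_def)

lemma P_D:
  assumes "p \<in> P"
  shows "minimal_projection I p" "adj p = p" "p * p = p" "p \<in> I" "p \<noteq> 0" "norm p = 1"
  using assms family norm_projection[of p]
  by (auto simp: minimal_family_def minimal_projection_def projection_def)

lemma unit_adj: "adj unit_of_ideal = unit_of_ideal"
  and unit_idem: "unit_of_ideal * unit_of_ideal = unit_of_ideal"
  using minimal_family_sum_projection[OF family] by (auto simp: unit_of_ideal_def projection_def)

lemma unit_mem: "unit_of_ideal \<in> I"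
  unfolding unit_of_ideal_def using P_D by (intro ideal_mem)

lemma unit_right: "x \<in> I \<Longrightarrow> x * unit_of_ideal = x"
  unfolding unit_of_ideal_def by (rule total)

lemma unit_left: "x \<in> I \<Longrightarrow> unit_of_ideal * x = x"
  using total_family_left_unit[OF ideal _ unit_mem] unit_right unit_adj unit_idem
  by (simp add: projection_def)

lemma adj_mem: "x \<in> I \<Longrightarrow> adj x \<in> I"
  using ideal_mem(1)[OF unit_mem, of "adj x"] unit_left[of x] unit_adj by (metis adj_mult)

lemma coef_unique:
  assumes "p \<in> P" "p * y * p = c *\<^sub>C p"
  shows "coef p y = c"
proof -
  have "p * y * p = coef p y *\<^sub>C p" unfolding coef_def by (rule someI[of _ c]) (rule assms)
  then show ?thesis using P_D(5)[OF assms(1)] assms(2) by simp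
qed

lemma coef_eq:
  assumes "p \<in> P" "y \<in> I"
  shows "p * y * p = coef p y *\<^sub>C p"
  using P_D(1)[OF assms(1)] coef_unique[OF assms(1)] assms(2) by (auto simp: minimal_projection_def)

lemma coef_linear:
  assumes "p \<in> P" "y \<in> I" "z \<in> I"
  shows "coef p (y + z) = coef p y + coef p z" "coef p (c *\<^sub>C y) = c * coef p y"
  using assms
  by (auto intro!: coef_unique simp: ring_distribs coef_eq scaleC_add_left mult_scaleC_left
      mult_scaleC_right scaleC_scaleC)

lemma coef_adj:
  assumes "p \<in> P" "y \<in> I"
  shows "coef p (adj y) = cnj (coef p y)"
  using arg_cong[OF coef_eq[OF assms], of adj] assms
  by (intro coef_unique) (simp_all add: adj_mult adj_scaleC P_D mult.assoc)

text \<open>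
  Positivity of these states.  The scalar \<open>l\<close>
  with \<open>y\<^sup>* y = l p\<close>, \<open>y = xp\<close>, is real and equals \<open>\<plusminus>\<parallel>y\<parallel>\<^sup>2\<close>.  If it were negative, the quadratic
  \<open>t \<mapsto> l + 2ta + t\<^sup>2\<close> describing \<open>(y + tp)\<^sup>* (y + tp)\<close> would have a real zero \<open>t\<close>; then \<open>y = -tp\<close>, and
  \<open>l = t\<^sup>2\<close>.
\<close>

lemma coef_square:
  assumes p: "p \<in> P" and x: "x \<in> I"
  shows "coef p (adj x * x) = of_real ((norm (x * p))\<^sup>2)"
proof -
  define y where "y = x * p"
  define l where "l = coef p (adj x * x)"
  have yy: "adj y * y = l *\<^sub>C p"
    using coef_eq[OF p, of "adj x * x"] x by (simp add: y_def l_def adj_mult P_D[OF p] mult.assoc ideal_mem)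
  have "cnj l = l" using coef_adj[OF p, of "adj x * x"] x by (simp add: l_def ideal_mem adj_mult adj_adj)
  then have lr: "l = of_real (Re l)" by (simp add: complex_eq_iff)
  have ln: "\<bar>Re l\<bar> = (norm y)\<^sup>2"
    using cstar_identity[of y] yy P_D(6)[OF p] lr by (metis mult.right_neutral norm_of_real norm_scaleC)
  have "\<not> Re l < 0"
  proof
    assume neg: "Re l < 0"
    define a where "a = Re (coef p x)"
    define t where "t = sqrt (a\<^sup>2 - Re l) - a"
    have t: "Re l + 2 * t * a + t\<^sup>2 = 0"
    proof -
      have "Re l \<le> a\<^sup>2" using neg zero_le_power2[of a] by linarith
      then have "(t + a)\<^sup>2 = a\<^sup>2 - Re l" by (simp add: t_def)
      then show ?thesis by (simp add: power2_eq_square algebra_simps)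
    qed
    define z where "z = y + of_real t *\<^sub>C p"
    have "adj y * p + p * y = (2 * of_real a) *\<^sub>C p"
    proof -
      have "p * y = coef p x *\<^sub>C p" using coef_eq[OF p x] by (simp add: y_def mult.assoc)
      moreover have "adj y * p = cnj (coef p x) *\<^sub>C p"
        using coef_eq[OF p adj_mem[OF x]] coef_adj[OF p x] by (simp add: y_def adj_mult P_D[OF p])
      moreover have "cnj (coef p x) + coef p x = 2 * of_real a" by (simp add: a_def complex_eq_iff)
      ultimately show ?thesis by (simp flip: scaleC_add_left)
    qed
    then have "of_real t *\<^sub>C (adj y * p + p * y) = (of_real t * (2 * of_real a)) *\<^sub>C p"
      by (simp only: scaleC_scaleC)
    moreover have "adj z * z = adj y * y + of_real t *\<^sub>C (adj y * p + p * y) + (of_real t * of_real t) *\<^sub>C p"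
      by (simp add: z_def adj_add adj_scaleC P_D[OF p] ring_distribs mult_scaleC_left mult_scaleC_right
          scaleC_scaleC scaleC_add_right)
    ultimately have "adj z * z = (l + of_real t * (2 * of_real a) + of_real t * of_real t) *\<^sub>C p"
      by (simp add: yy scaleC_add_left)
    also have "l + of_real t * (2 * of_real a) + of_real t * of_real t = 0"
      using t by (subst lr) (simp add: complex_eq_iff power2_eq_square algebra_simps)
    finally have "z = 0" by (simp add: cstar_zero_iff)
    then have "y = (- of_real t) *\<^sub>C p" by (simp add: z_def eq_neg_iff_add_eq_0 complex_vector.scale_minus_left)
    then have "adj y * y = of_real (t\<^sup>2) *\<^sub>C p"
      by (simp add: adj_scaleC P_D[OF p] mult_scaleC_left mult_scaleC_right scaleC_scaleC power2_eq_square
          adj_minus complex_vector.scale_minus_left)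
    then have "l = of_real (t\<^sup>2)" using yy P_D(5)[OF p] by simp
    then have "Re l = t\<^sup>2" by (simp only: Re_complex_of_real)
    then show False using neg by (metis not_less zero_le_power2)
  qed
  then have "Re l = (norm y)\<^sup>2" using ln by simp
  then show ?thesis using lr by (simp add: l_def y_def)
qed

lemma form_add_left:
  "\<lbrakk>x \<in> I; y \<in> I; z \<in> I\<rbrakk> \<Longrightarrow> form (x + y) z = form x z + form y z"
  unfolding form_def sum.distrib[symmetric] distrib_left
  by (intro sum.cong coef_linear(1)) (auto intro: ideal_mem)

lemma form_scaleC_left:
  "\<lbrakk>x \<in> I; y \<in> I\<rbrakk> \<Longrightarrow> form (c *\<^sub>C x) y = c * form x y"
  unfolding form_def sum_distrib_left mult_scaleC_right
  by (intro sum.cong coef_linear(2)) (auto intro: ideal_mem)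

lemma form_commute:
  assumes "x \<in> I" "y \<in> I"
  shows "form y x = cnj (form x y)"
proof -
  have "coef p (adj x * y) = cnj (coef p (adj y * x))" if "p \<in> P" for p
    using coef_adj[OF that, of "adj y * x"] assms by (simp add: ideal_mem adj_mult adj_adj)
  then show ?thesis by (simp add: form_def)
qed

lemma form_self: "x \<in> I \<Longrightarrow> form x x = of_real ((form_norm x)\<^sup>2)"
  by (simp add: form_def coef_square form_norm_def L2_set_def sum_nonneg)

lemma form_norm_nonneg: "0 \<le> form_norm x"
  by (simp add: form_norm_def)

lemma form_norm_le: "form_norm x \<le> real (card P) * norm x"
proof -
  have "form_norm x \<le> (\<Sum>p\<in>P. norm (x * p))" unfolding form_norm_def by (rule L2_set_le_sum) simp
  also have "\<dots> \<le> (\<Sum>p\<in>P. norm x)"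
    by (intro sum_mono) (metis P_D(6) mult.right_neutral norm_mult_ineq)
  finally show ?thesis by simp
qed

lemma norm_le_form_norm:
  assumes "x \<in> I"
  shows "norm x \<le> real (card P) * form_norm x"
proof -
  have "norm x = norm (\<Sum>p\<in>P. x * p)" using total[OF assms] by (simp add: sum_distrib_left)
  also have "\<dots> \<le> (\<Sum>p\<in>P. form_norm x)"
    unfolding form_norm_def by (intro sum_norm_le member_le_L2_set[OF finite_P])
  finally show ?thesis by simp
qed

lemma form_norm_eq_0: "x \<in> I \<Longrightarrow> form_norm x = 0 \<Longrightarrow> x = 0"
  using norm_le_form_norm[of x] by simp

lemma form_norm_minus_commute: "form_norm (x - y) = form_norm (y - x)"
proof -
  have "norm ((x - y) * p) = norm ((y - x) * p)" for p
    by (metis norm_minus_commute left_diff_distrib)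
  then show ?thesis by (simp add: form_norm_def)
qed

lemma form_norm_triangle: "form_norm (x + y) \<le> form_norm x + form_norm y"
proof -
  have "form_norm (x + y) \<le> L2_set (\<lambda>p. norm (x * p) + norm (y * p)) P"
    unfolding form_norm_def by (rule L2_set_mono) (auto simp: ring_distribs norm_triangle_ineq)
  also have "\<dots> \<le> form_norm x + form_norm y" unfolding form_norm_def by (rule L2_set_triangle_ineq)
  finally show ?thesis .
qed

text \<open>
  The form is faithful on the ideal, so an element whose left multiplication is isometric is an
  isometry relative to the unit of the ideal.
\<close>

lemma form_isometry_imp_adj_mult_self:
  assumes v: "v \<in> I" and iso: "\<And>x y. x \<in> I \<Longrightarrow> y \<in> I \<Longrightarrow> form (v * x) (v * y) = form x y"
  shows "adj v * v = unit_of_ideal"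
proof -
  define z where "z = adj v * v - unit_of_ideal"
  have zI: "z \<in> I" using v unit_mem by (simp add: z_def ideal_mem)
  have "form (v * unit_of_ideal) (v * z) = form (adj v * v) z"
    using v by (simp add: form_def adj_mult mult.assoc unit_right)
  then have "form (adj v * v) z = form unit_of_ideal z" using iso[OF unit_mem zI] by simp
  moreover have "form (adj v * v) z = form (z + unit_of_ideal) z" by (simp add: z_def)
  ultimately have "form z z = 0" using form_add_left[OF zI unit_mem zI] by simp
  then have "z = 0" using form_self[OF zI] form_norm_eq_0[OF zI] by simp
  then show ?thesis by (simp add: z_def)
qed

end

text \<open>
  The ideal itself, with the inner product given by the form, is the Hilbert space of the
  representation.  Its points have to live in a prescribed type, so its structure is transported along
  an injection \<open>g\<close>.
\<close>

locale embedded_family = total_minimal_family I P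
  for I P :: "'a::unital_cstar_algebra set" +
  fixes g :: "'a \<Rightarrow> 'h"
  assumes inj_g: "inj_on g I"
begin

abbreviation f :: "'h \<Rightarrow> 'a" where
  "f \<equiv> inv_into I g"

definition ideal_space :: "'h inner_module" where
  "ideal_space = \<lparr>carrier = g ` I, monoid.mult = (\<lambda>x y. x), one = g 0, zero = g 0,
     add = (\<lambda>x y. g (f x + f y)), smult = (\<lambda>c x. g (c *\<^sub>C f x)), cinner = (\<lambda>x y. form (f x) (f y))\<rparr>"

lemma f_g [simp]: "x \<in> I \<Longrightarrow> f (g x) = x"
  by (rule inv_into_f_f[OF inj_g])

lemma g_eq_iff: "x \<in> I \<Longrightarrow> y \<in> I \<Longrightarrow> g x = g y \<longleftrightarrow> x = y"
  using inj_g by (auto simp: inj_on_def)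

lemma ideal_space_simps:
  "carrier ideal_space = g ` I"
  "zero ideal_space = g 0"
  "x \<in> I \<Longrightarrow> y \<in> I \<Longrightarrow> add ideal_space (g x) (g y) = g (x + y)"
  "x \<in> I \<Longrightarrow> smult ideal_space c (g x) = g (c *\<^sub>C x)"
  "x \<in> I \<Longrightarrow> y \<in> I \<Longrightarrow> cinner ideal_space (g x) (g y) = form x y"
  by (simp_all add: ideal_space_def)

lemma ideal_space_abelian_group: "abelian_group ideal_space"
proof (rule abelian_groupI)
  show "\<exists>y\<in>carrier ideal_space. y \<oplus>\<^bsub>ideal_space\<^esub> x = \<zero>\<^bsub>ideal_space\<^esub>" if "x \<in> carrier ideal_space" for x
  proof -
    from that obtain a where a: "a \<in> I" "x = g a" by (auto simp: ideal_space_simps)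
    have "- a \<in> I" using ideal_mem(5)[OF ideal_mem(3) a(1)] by simp
    then show ?thesis using a by (intro bexI[of _ "g (- a)"]) (auto simp: ideal_space_simps)
  qed
qed (auto simp: ideal_space_simps ideal_mem add.assoc add.commute add.left_commute)

lemma ideal_space_diff:
  assumes "x \<in> I" "y \<in> I"
  shows "g x \<ominus>\<^bsub>ideal_space\<^esub> g y = g (x - y)"
proof -
  interpret abelian_group ideal_space by (rule ideal_space_abelian_group)
  have m: "- y \<in> I" using ideal_mem(5)[OF ideal_mem(3) assms(2)] by simp
  have "\<ominus>\<^bsub>ideal_space\<^esub> g y = g (- y)"
    by (rule minus_equality) (use assms m in \<open>auto simp: ideal_space_simps\<close>)
  then show ?thesis using assms m by (simp add: minus_eq ideal_space_simps)
qed

lemma ideal_space_hdist: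
  assumes "x \<in> I" "y \<in> I"
  shows "hdist ideal_space (g x) (g y) = form_norm (x - y)"
  using assms form_self[of "x - y"]
  by (simp add: hdist_def ideal_space_simps ideal_space_diff ideal_mem form_norm_nonneg)

lemma ideal_space_Metric_space: "Metric_space (g ` I) (hdist ideal_space)"
proof -
  have d: "hdist ideal_space x y = (if x \<in> g ` I \<and> y \<in> g ` I then form_norm (f x - f y) else 0)" for x y
    by (cases "x \<in> g ` I \<and> y \<in> g ` I")
      (auto simp: ideal_space_hdist, auto simp: hdist_def ideal_space_simps(1))
  show ?thesis
  proof
    show "0 \<le> hdist ideal_space x y" for x y by (simp add: d form_norm_nonneg)
    show "hdist ideal_space x y = hdist ideal_space y x" for x y
      by (simp add: d form_norm_minus_commute)
    show "hdist ideal_space x y = 0 \<longleftrightarrow> x = y" if "x \<in> g ` I" "y \<in> g ` I" for x y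
    proof -
      from that obtain a b where ab: "a \<in> I" "b \<in> I" "x = g a" "y = g b" by blast
      have "form_norm 0 = 0" by (simp add: form_norm_def L2_set_def)
      then have "form_norm (a - b) = 0 \<longleftrightarrow> a = b" using form_norm_eq_0[of "a - b"] ab ideal_mem by auto
      then show ?thesis by (simp add: ab ideal_space_hdist g_eq_iff)
    qed
    show "hdist ideal_space x z \<le> hdist ideal_space x y + hdist ideal_space y z"
      if "x \<in> g ` I" "y \<in> g ` I" "z \<in> g ` I" for x y z
      using that form_norm_triangle[of "f x - f y" "f y - f z"] by (simp add: d)
  qed
qed

sublocale MS: Metric_space "g ` I" "hdist ideal_space"
  by (rule ideal_space_Metric_space)

lemma ideal_space_complete: "MS.mcomplete"
  unfolding MS.mcomplete_def
proof (intro allI impI)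
  fix \<sigma> assume "MS.MCauchy \<sigma>"
  then have \<sigma>: "\<And>n. \<sigma> n \<in> g ` I"
    "\<And>\<epsilon>. \<epsilon> > 0 \<Longrightarrow> \<exists>N. \<forall>n n'. N \<le> n \<longrightarrow> N \<le> n' \<longrightarrow> hdist ideal_space (\<sigma> n) (\<sigma> n') < \<epsilon>"
    unfolding MS.MCauchy_def by blast+
  define a where "a n = f (\<sigma> n)" for n
  have a: "a n \<in> I" "\<sigma> n = g (a n)" for n
    using \<sigma>(1)[of n] by (auto simp: a_def)
  define c where "c = real (card P) + 1"
  have c: "c > 0" by (simp add: c_def)
  have le: "norm x \<le> c * form_norm x" if "x \<in> I" for x
    using norm_le_form_norm[OF that] form_norm_nonneg[of x] by (simp add: c_def algebra_simps)
  have ge: "form_norm x \<le> c * norm x" for x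
    using form_norm_le[of x] by (simp add: c_def algebra_simps) (smt (verit) norm_ge_zero)
  have "Cauchy a"
  proof (rule metric_CauchyI)
    fix e :: real assume "e > 0"
    then obtain N where N: "\<And>n n'. N \<le> n \<Longrightarrow> N \<le> n' \<Longrightarrow> hdist ideal_space (\<sigma> n) (\<sigma> n') < e / c"
      using \<sigma>(2)[of "e / c"] c by auto
    have "dist (a m) (a n) < e" if "m \<ge> N" "n \<ge> N" for m n
    proof -
      have "dist (a m) (a n) \<le> c * form_norm (a m - a n)"
        unfolding dist_norm by (rule le) (simp add: ideal_mem a)
      also have "\<dots> = c * hdist ideal_space (\<sigma> m) (\<sigma> n)"
        unfolding a(2) by (simp add: ideal_space_hdist a(1))
      also have "\<dots> < c * (e / c)" using N[OF that] c by (intro mult_strict_left_mono)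
      finally show ?thesis using c by simp
    qed
    then show "\<exists>M. \<forall>m\<ge>M. \<forall>n\<ge>M. dist (a m) (a n) < e" by blast
  qed
  then obtain l where l: "a \<longlonglongrightarrow> l" using Cauchy_convergent convergentD by blast
  have "closed I" using ideal by (simp add: closed_two_sided_ideal_def)
  then have lI: "l \<in> I" using l a(1) closed_sequentially by blast
  have "limitin MS.mtopology \<sigma> (g l) sequentially"
    unfolding MS.limitin_metric
  proof (intro conjI allI impI)
    fix e :: real assume "e > 0"
    then have "\<forall>\<^sub>F n in sequentially. dist (a n) l < e / c" using l c by (intro tendstoD) auto
    then show "\<forall>\<^sub>F n in sequentially. \<sigma> n \<in> g ` I \<and> hdist ideal_space (\<sigma> n) (g l) < e"
    proof (rule eventually_mono)
      fix n assume n: "dist (a n) l < e / c"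
      have "hdist ideal_space (\<sigma> n) (g l) = form_norm (a n - l)"
        unfolding a(2) by (rule ideal_space_hdist[OF a(1) lI])
      also have "\<dots> \<le> c * dist (a n) l" unfolding dist_norm by (rule ge)
      also have "\<dots> < c * (e / c)" using n c by (intro mult_strict_left_mono)
      finally show "\<sigma> n \<in> g ` I \<and> hdist ideal_space (\<sigma> n) (g l) < e" using \<sigma>(1) c by simp
    qed
  qed (use lI in blast)
  then show "\<exists>x. limitin MS.mtopology \<sigma> x sequentially" by blast
qed

lemma ideal_space_hilbert: "complex_hilbert_space ideal_space"
proof (intro complex_hilbert_space.intro complex_hilbert_space_axioms.intro)
  show "Module.module (ring_of_type_algebra :: complex ring) ideal_space"
  proof (rule moduleI)
    show "cring (ring_of_type_algebra :: complex ring)" by (rule cring_from_type_algebra)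
    show "abelian_group ideal_space" by (rule ideal_space_abelian_group)
  qed (auto simp: ideal_space_simps ring_of_type_algebra_def ideal_mem scaleC_add_left scaleC_add_right
      scaleC_scaleC scaleC_one)
  show "Metric_space.mcomplete (carrier ideal_space) (hdist ideal_space)"
    unfolding ideal_space_simps(1) by (rule ideal_space_complete)
  show "cinner ideal_space x x = 0 \<Longrightarrow> x = \<zero>\<^bsub>ideal_space\<^esub>" if "x \<in> carrier ideal_space" for x
    using that by (auto simp: ideal_space_simps form_self dest: form_norm_eq_0)
qed (auto simp: ideal_space_simps form_add_left form_scaleC_left ideal_mem form_self intro: form_commute)

end

section \<open>The groups involved\<close>

lemma (in complex_hilbert_space) group_unitary_group: "group (unitary_group H)"
proof -
  interpret B: group "BijGroup (carrier H)" by (rule group_BijGroup)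
  have "subgroup (unitary_operators H) (BijGroup (carrier H))"
  proof (rule B.subgroupI)
    show "unitary_operators H \<subseteq> carrier (BijGroup (carrier H))"
      by (auto simp: unitary_operators_def BijGroup_def)
    have "(\<lambda>x\<in>carrier H. x) \<in> unitary_operators H"
      by (simp add: unitary_operators_def id_Bij)
    then show "unitary_operators H \<noteq> {}" by blast
  next
    fix U assume U: "U \<in> unitary_operators H"
    note D = unitary_operatorsD[OF U]
    have UB: "U \<in> Bij (carrier H)" using U by (simp add: unitary_operators_def)
    then have inj: "inj_on U (carrier H)" and surj: "U ` carrier H = carrier H"
      by (simp_all add: Bij_def bij_betw_def)
    define V where "V = inv_into (carrier H) U"
    have V: "V x \<in> carrier H" "U (V x) = x" if "x \<in> carrier H" for x
      using that surj by (simp_all add: V_def inv_into_into f_inv_into_f)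
    have VU: "V (U x) = x" if "x \<in> carrier H" for x using inj that by (simp add: V_def)
    have "restrict V (carrier H) \<in> unitary_operators H"
      unfolding unitary_operators_def
    proof (intro CollectI conjI ballI allI)
      show "restrict V (carrier H) \<in> Bij (carrier H)" unfolding V_def by (rule restrict_inv_into_Bij[OF UB])
      fix x y c assume x: "x \<in> carrier H" and y: "y \<in> carrier H"
      have "V (x \<oplus>\<^bsub>H\<^esub> y) = V (U (V x \<oplus>\<^bsub>H\<^esub> V y))" using V x y by (simp add: D)
      then show "restrict V (carrier H) (x \<oplus>\<^bsub>H\<^esub> y) = restrict V (carrier H) x \<oplus>\<^bsub>H\<^esub> restrict V (carrier H) y"
        using x y V by (simp add: VU)
      show "cinner H (restrict V (carrier H) x) (restrict V (carrier H) y) = cinner H x y"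
        using D(4)[of "V x" "V y"] x y V by simp
    next
      fix x c assume x: "x \<in> carrier H"
      have "V (c \<odot>\<^bsub>H\<^esub> x) = V (U (c \<odot>\<^bsub>H\<^esub> V x))" using V x by (simp add: D)
      then show "restrict V (carrier H) (c \<odot>\<^bsub>H\<^esub> x) = c \<odot>\<^bsub>H\<^esub> restrict V (carrier H) x"
        using x V by (simp add: VU)
    qed
    then show "inv\<^bsub>BijGroup (carrier H)\<^esub> U \<in> unitary_operators H"
      using inv_BijGroup[OF UB] by (simp add: V_def restrict_def)
  next
    fix U V assume U: "U \<in> unitary_operators H" and V: "V \<in> unitary_operators H"
    have B: "U \<in> Bij (carrier H)" "V \<in> Bij (carrier H)" using U V by (simp_all add: unitary_operators_def)
    have "compose (carrier H) U V \<in> unitary_operators H"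
      unfolding unitary_operators_def
      using unitary_operatorsD[OF U] unitary_operatorsD[OF V] compose_Bij[OF B]
      by (simp add: compose_def)
    then show "U \<otimes>\<^bsub>BijGroup (carrier H)\<^esub> V \<in> unitary_operators H"
      using B by (simp add: BijGroup_def)
  qed
  then show ?thesis
    unfolding unitary_group_def using subgroup.subgroup_is_group group_BijGroup by blast
qed

lemma unitaries_mult: "u \<in> unitaries \<Longrightarrow> v \<in> unitaries \<Longrightarrow> u * v \<in> unitaries"
proof -
  assume u: "u \<in> unitaries" and v: "v \<in> unitaries"
  have "adj (u * v) * (u * v) = adj v * (adj u * u) * v" "(u * v) * adj (u * v) = u * (v * adj v) * adj u"
    by (simp_all only: adj_mult mult.assoc)
  then show "u * v \<in> unitaries" using u v by (simp add: unitaries_def)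
qed

lemma ideal_unitary_closed:
  assumes I: "closed_two_sided_ideal I"
  shows "1 \<in> carrier (ideal_unitary_group I)"
    "u \<in> carrier (ideal_unitary_group I) \<Longrightarrow> v \<in> carrier (ideal_unitary_group I)
       \<Longrightarrow> u * v \<in> carrier (ideal_unitary_group I)"
    "u \<in> carrier (ideal_unitary_group I) \<Longrightarrow> adj u \<in> carrier (ideal_unitary_group I)"
proof -
  show "1 \<in> carrier (ideal_unitary_group I)"
    using ideal_linear(1)[OF I] by (simp add: ideal_unitary_carrier unitaries_def)
next
  assume u: "u \<in> carrier (ideal_unitary_group I)" and v: "v \<in> carrier (ideal_unitary_group I)"
  have "u * v - 1 = u * (v - 1) + (u - 1)" by (simp add: algebra_simps)
  moreover have "u * (v - 1) + (u - 1) \<in> I"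
    using u v by (intro ideal_linear(2)[OF I] ideal_mult(1)[OF I]) (simp_all add: ideal_unitary_carrier)
  ultimately have "u * v - 1 \<in> I" by (simp only:)
  then show "u * v \<in> carrier (ideal_unitary_group I)"
    using u v by (simp add: ideal_unitary_carrier unitaries_mult)
next
  assume u: "u \<in> carrier (ideal_unitary_group I)"
  have "adj u - 1 = 0 - adj u * (u - 1)" using u by (simp add: ideal_unitary_carrier unitaries_def algebra_simps)
  also have "\<dots> \<in> I" using u
    by (intro ideal_linear(3)[OF I ideal_linear(1)[OF I] ideal_mult(1)[OF I]]) (simp add: ideal_unitary_carrier)
  finally show "adj u \<in> carrier (ideal_unitary_group I)"
    using u by (simp add: ideal_unitary_carrier unitaries_def adj_adj)
qed

lemma ideal_unitary_group_simps:
  "u \<otimes>\<^bsub>ideal_unitary_group I\<^esub> v = u * v" "\<one>\<^bsub>ideal_unitary_group I\<^esub> = 1"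
  by (simp_all add: ideal_unitary_group_def)

lemma group_ideal_unitary_group:
  assumes I: "closed_two_sided_ideal I"
  shows "group (ideal_unitary_group I)"
proof (rule groupI)
  show "\<exists>y\<in>carrier (ideal_unitary_group I). y \<otimes>\<^bsub>ideal_unitary_group I\<^esub> x = \<one>\<^bsub>ideal_unitary_group I\<^esub>"
    if "x \<in> carrier (ideal_unitary_group I)" for x
    using ideal_unitary_closed(3)[OF I that] that
    by (intro bexI[of _ "adj x"]) (auto simp: ideal_unitary_group_simps ideal_unitary_carrier unitaries_def)
qed (auto simp: ideal_unitary_group_simps ideal_unitary_closed[OF I] mult.assoc)

lemma ideal_unitary_group_inv:
  assumes I: "closed_two_sided_ideal I" and u: "u \<in> carrier (ideal_unitary_group I)"
  shows "inv\<^bsub>ideal_unitary_group I\<^esub> u = adj u"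
  by (rule group.inv_equality[OF group_ideal_unitary_group[OF I] _ u ideal_unitary_closed(3)[OF I u]])
    (use u in \<open>simp add: ideal_unitary_group_simps ideal_unitary_carrier unitaries_def\<close>)

lemma hausdorff_ideal_unitary_group:
  assumes I: "closed_two_sided_ideal I"
  shows "hausdorff_topological_group (ideal_unitary_group I) (top_of_set (carrier (ideal_unitary_group I)))"
proof -
  let ?G = "carrier (ideal_unitary_group I)"
  have "continuous_map (top_of_set (?G \<times> ?G)) (top_of_set ?G) (\<lambda>(x, y). x * y)"
    using ideal_unitary_closed(2)[OF I]
    by (auto simp: continuous_map_in_subtopology case_prod_unfold intro!: continuous_intros)
  then have "continuous_map (prod_topology (top_of_set ?G) (top_of_set ?G)) (top_of_set ?G)
      (\<lambda>(x, y). x \<otimes>\<^bsub>ideal_unitary_group I\<^esub> y)"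
    by (simp add: ideal_unitary_group_simps flip: subtopology_Times)
  moreover have "continuous_map (top_of_set ?G) (top_of_set ?G) (\<lambda>x. inv\<^bsub>ideal_unitary_group I\<^esub> x)"
  proof (rule continuous_map_eq)
    show "continuous_map (top_of_set ?G) (top_of_set ?G) adj"
      using ideal_unitary_closed(3)[OF I] bounded_linear.continuous_on[OF bounded_linear_adj continuous_on_id]
      by (auto simp: continuous_map_in_subtopology)
  qed (simp add: ideal_unitary_group_inv[OF I])
  ultimately show ?thesis
    unfolding hausdorff_topological_group_def
    by (simp add: group_ideal_unitary_group[OF I] Hausdorff_space_subtopology)
qed

section \<open>The left regular representation\<close>

context embedded_family
begin

abbreviation G :: "'a set" where
  "G \<equiv> carrier (ideal_unitary_group I)"

abbreviation SOT :: "('h \<Rightarrow> 'h) topology" where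
  "SOT \<equiv> strong_operator_topology ideal_space"

definition left_regular :: "'a \<Rightarrow> 'h \<Rightarrow> 'h" where
  "left_regular u = (\<lambda>x\<in>g ` I. g (u * f x))"

text \<open>
  The range of the left regular representation, described by equations that are visibly closed in the
  strong topology: the unitaries commuting with right multiplications.
\<close>

definition right_module_unitaries :: "('h \<Rightarrow> 'h) set" where
  "right_module_unitaries =
     {V \<in> unitary_operators ideal_space. \<forall>x\<in>I. \<forall>y\<in>I. f (V (g (x * y))) = f (V (g x)) * y}"

text \<open>
  The inverse of the left regular representation.  An element of the unitary group acts as the identity
  on the complement of the unit of the ideal, so it is determined by its value at that unit.
\<close>

definition value_at_unit :: "('h \<Rightarrow> 'h) \<Rightarrow> 'a" where
  "value_at_unit V = 1 - unit_of_ideal + f (V (g unit_of_ideal))"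

sublocale IS: complex_hilbert_space ideal_space
  by (rule ideal_space_hilbert)

lemma left_regular_g [simp]: "x \<in> I \<Longrightarrow> left_regular u (g x) = g (u * x)"
  by (simp add: left_regular_def)

lemma G_D: "u \<in> G \<Longrightarrow> adj u * u = 1" "u \<in> G \<Longrightarrow> u * adj u = 1" "u \<in> G \<Longrightarrow> u - 1 \<in> I"
  by (auto simp: ideal_unitary_carrier unitaries_def)

lemma left_regular_unitary:
  assumes u: "u \<in> G"
  shows "left_regular u \<in> unitary_operators ideal_space"
proof -
  have inv: "adj u * (u * x) = x" "u * (adj u * x) = x" for x
    using G_D[OF u] by (simp_all flip: mult.assoc)
  have "bij_betw (left_regular u) (g ` I) (g ` I)"
    by (rule bij_betw_byWitness[where f' = "left_regular (adj u)"]) (auto simp: ideal_mem inv)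
  moreover have "left_regular u \<in> extensional (g ` I)" by (simp add: left_regular_def)
  moreover have "form (u * x) (u * y) = form x y" if "x \<in> I" "y \<in> I" for x y
    by (simp add: form_def adj_mult mult.assoc inv)
  ultimately show ?thesis
    unfolding unitary_operators_def Bij_def
    by (auto simp: ideal_space_simps ideal_mem ring_distribs mult_scaleC_right)
qed

lemma left_regular_right_module:
  assumes u: "u \<in> G"
  shows "left_regular u \<in> right_module_unitaries"
  using left_regular_unitary[OF u] by (simp add: right_module_unitaries_def ideal_mem mult.assoc)

lemma value_left_regular:
  assumes u: "u \<in> G"
  shows "value_at_unit (left_regular u) = u"
proof -
  have "(u - 1) * unit_of_ideal = u - 1" by (rule unit_right[OF G_D(3)[OF u]])
  then have "u * unit_of_ideal - unit_of_ideal = u - 1" by (simp add: ring_distribs)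
  then show ?thesis by (simp add: value_at_unit_def unit_mem ideal_mem) (simp add: algebra_simps)
qed

text \<open>
  A map commuting with right multiplications is left multiplication by \<open>v\<close>, its value at the unit \<open>s\<close>.
  Isometry gives \<open>v\<^sup>* v = s\<close>, and a right inverse obtained from surjectivity must then be \<open>v\<^sup>*\<close>.
\<close>

lemma right_module_unitary_is_left_regular:
  assumes V: "V \<in> right_module_unitaries"
  shows "value_at_unit V \<in> G" "left_regular (value_at_unit V) = V"
proof -
  have VU: "V \<in> unitary_operators ideal_space" using V by (simp add: right_module_unitaries_def)
  note D = IS.unitary_operatorsD[OF VU, unfolded ideal_space_simps(1)]
  have gf: "g (f x) = x" "f x \<in> I" if "x \<in> g ` I" for x
    using that by (auto simp: f_inv_into_f inv_into_into)
  define s where "s = unit_of_ideal"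
  note s = unit_adj unit_idem unit_mem unit_right unit_left
  note s = s[folded s_def]
  define v where "v = f (V (g s))"
  have v: "v \<in> I" unfolding v_def using s(3) by (intro gf D) simp
  have Vg: "V (g x) = g (v * x)" if x: "x \<in> I" for x
  proof -
    have "f (V (g (s * x))) = v * x" using V s(3) x by (simp add: right_module_unitaries_def v_def)
    then have "f (V (g x)) = v * x" using s(5)[OF x] by simp
    then show ?thesis using gf(1)[OF D(1)[of "g x"]] x by simp
  qed
  have vv: "adj v * v = s"
    unfolding s_def
  proof (rule form_isometry_imp_adj_mult_self[OF v])
    fix x y assume xy: "x \<in> I" "y \<in> I"
    have "cinner ideal_space (V (g x)) (V (g y)) = cinner ideal_space (g x) (g y)"
      using xy by (intro D) auto
    then show "form (v * x) (v * y) = form x y" using xy v by (simp add: Vg ideal_space_simps ideal_mem)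
  qed
  have "V ` (g ` I) = g ` I"
    using VU by (simp add: unitary_operators_def Bij_def bij_betw_def ideal_space_simps)
  then have "g s \<in> V ` (g ` I)" using s(3) by simp
  then obtain w where w: "w \<in> I" "V (g w) = g s" by force
  then have vw: "v * w = s" using Vg[OF w(1)] v s(3) by (simp add: g_eq_iff ideal_mem)
  have "adj v = adj v * s" using s(4)[OF adj_mem[OF v]] by simp
  also have "\<dots> = adj v * v * w" by (simp add: vw mult.assoc)
  also have "\<dots> = w" using vv s(5)[OF w(1)] by simp
  finally have vv': "v * adj v = s" using vw by simp
  have e: "value_at_unit V = 1 - s + v" by (simp add: value_at_unit_def s_def v_def)
  have vs: "v * s = v" "s * v = v" "adj v * s = adj v" "s * adj v = adj v"
    using s(4,5) v adj_mem[OF v] by auto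
  have ae: "adj (value_at_unit V) = 1 - s + adj v" by (simp add: e adj_add adj_diff s)
  have "adj (value_at_unit V) * value_at_unit V = 1" "value_at_unit V * adj (value_at_unit V) = 1"
    unfolding ae unfolding e by (simp_all add: ring_distribs vs vv vv' s)
  moreover have "value_at_unit V - 1 \<in> I" using v s(3) by (simp add: e ideal_mem)
  ultimately show "value_at_unit V \<in> G" by (simp add: ideal_unitary_carrier unitaries_def)
  show "left_regular (value_at_unit V) = V"
  proof (rule extensionalityI)
    show "left_regular (value_at_unit V) \<in> extensional (g ` I)" by (simp add: left_regular_def)
    show "V \<in> extensional (g ` I)" using VU by (simp add: unitary_operators_def Bij_def ideal_space_simps)
    fix y assume "y \<in> g ` I"
    then obtain x where x: "x \<in> I" "y = g x" by blast
    have "value_at_unit V * x = v * x" using s(5)[OF x(1)] by (simp add: e ring_distribs)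
    then show "left_regular (value_at_unit V) y = V y" using x by (simp add: Vg)
  qed
qed

lemma left_regular_image: "left_regular ` G = right_module_unitaries"
proof
  show "left_regular ` G \<subseteq> right_module_unitaries" using left_regular_right_module by blast
  show "right_module_unitaries \<subseteq> left_regular ` G"
  proof
    fix V assume "V \<in> right_module_unitaries"
    note V = right_module_unitary_is_left_regular[OF this]
    show "V \<in> left_regular ` G" using imageI[OF V(1), of left_regular] unfolding V(2) .
  qed
qed

lemma continuous_map_g: "continuous_map (top_of_set I) MS.mtopology g"
proof -
  have "continuous_map (subtopology euclidean I) MS.mtopology g"
    unfolding MS.continuous_map_to_metric
  proof (intro ballI allI impI)
    fix x and e :: real assume x: "x \<in> topspace (top_of_set I)" and e: "e > 0"
    define c where "c = real (card P) + 1"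
    have c: "c > 0" by (simp add: c_def)
    show "\<exists>U. openin (top_of_set I) U \<and> x \<in> U \<and> (\<forall>y\<in>U. g y \<in> MS.mball (g x) e)"
    proof (intro exI conjI ballI)
      show "openin (top_of_set I) (I \<inter> ball x (e / c))" by (simp add: openin_open_Int)
      show "x \<in> I \<inter> ball x (e / c)" using x e c by simp
      fix y assume y: "y \<in> I \<inter> ball x (e / c)"
      have "hdist ideal_space (g x) (g y) = form_norm (x - y)" using x y by (simp add: ideal_space_hdist)
      also have "\<dots> \<le> real (card P) * dist x y" unfolding dist_norm by (rule form_norm_le)
      also have "\<dots> \<le> c * dist x y" by (simp add: c_def mult_right_mono)
      also have "\<dots> < c * (e / c)" using y c by (intro mult_strict_left_mono) auto
      finally show "g y \<in> MS.mball (g x) e" using x y c by simp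
    qed
  qed
  then show ?thesis .
qed

lemma continuous_map_f: "continuous_map MS.mtopology euclidean f"
proof -
  have "continuous_map MS.mtopology Met_TC.mtopology f"
    unfolding MS.metric_continuous_map[OF Met_TC.Metric_space_axioms]
  proof (intro conjI ballI allI impI)
    fix a and e :: real assume a: "a \<in> g ` I" and e: "e > 0"
    define c where "c = real (card P) + 1"
    have c: "c > 0" by (simp add: c_def)
    have "dist (f a) (f x) < e" if x: "x \<in> g ` I" "hdist ideal_space a x < e / c" for x
    proof -
      from a x(1) obtain b y where bz: "b \<in> I" "a = g b" "y \<in> I" "x = g y" by blast
      have "dist (f a) (f x) \<le> real (card P) * form_norm (b - y)"
        using norm_le_form_norm[of "b - y"] bz by (simp add: dist_norm ideal_mem)
      also have "\<dots> \<le> c * form_norm (b - y)" by (simp add: c_def mult_right_mono form_norm_nonneg)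
      also have "\<dots> = c * hdist ideal_space a x" using bz by (simp add: ideal_space_hdist)
      also have "\<dots> < c * (e / c)" using x c by (intro mult_strict_left_mono)
      finally show ?thesis using c by simp
    qed
    then show "\<exists>\<delta>>0. \<forall>x. x \<in> g ` I \<and> hdist ideal_space a x < \<delta> \<longrightarrow> dist (f a) (f x) < e"
      using e c by (intro exI[of _ "e / c"]) auto
  qed auto
  then show ?thesis by simp
qed

lemma SOT_eq:
  "SOT = subtopology (product_topology (\<lambda>_. MS.mtopology) (g ` I)) (unitary_operators ideal_space)"
  by (simp add: strong_operator_topology_def ideal_space_simps)

lemma topspace_SOT: "topspace SOT = unitary_operators ideal_space"
  using IS.unitary_operatorsD(1)
  by (fastforce simp: SOT_eq unitary_operators_def Bij_def PiE_iff ideal_space_simps)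

lemma continuous_map_evaluate:
  assumes "x \<in> I"
  shows "continuous_map SOT euclidean (\<lambda>V. f (V (g x)))"
proof -
  have "continuous_map SOT MS.mtopology (\<lambda>V. V (g x))"
    unfolding SOT_eq using assms
    by (intro continuous_map_from_subtopology continuous_map_product_projection) simp
  from continuous_map_compose[OF this continuous_map_f] show ?thesis by (simp add: o_def)
qed

lemma closedin_right_module_unitaries: "closedin SOT right_module_unitaries"
proof -
  have "closedin SOT {V \<in> topspace SOT. f (V (g (x * y))) = f (V (g x)) * y}" if "x \<in> I" "y \<in> I" for x y
  proof (rule closedin_continuous_maps_eq[where Y = euclidean])
    show "continuous_map SOT euclidean (\<lambda>V. f (V (g (x * y))))"
      using that by (intro continuous_map_evaluate ideal_mem)
    have "continuous_map euclidean euclidean (\<lambda>z. z * y)" by (auto intro!: continuous_intros)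
    from continuous_map_compose[OF continuous_map_evaluate[OF that(1)] this]
    show "continuous_map SOT euclidean (\<lambda>V. f (V (g x)) * y)" by (simp add: o_def)
  qed simp
  then have "closedin SOT (\<Inter>z\<in>I \<times> I. {V \<in> topspace SOT. f (V (g (fst z * snd z))) = f (V (g (fst z))) * snd z})"
    using ideal_mem(3) by (intro closedin_INT) auto
  also have "(\<Inter>z\<in>I \<times> I. {V \<in> topspace SOT. f (V (g (fst z * snd z))) = f (V (g (fst z))) * snd z})
      = right_module_unitaries"
    using ideal_mem(3) by (auto simp: right_module_unitaries_def topspace_SOT)
  finally show ?thesis .
qed

text \<open>
  Left multiplication is continuous pointwise, and evaluation at a single vector recovers the unitary.
\<close>

lemma left_regular_homeomorphic_map:
  "homeomorphic_map (top_of_set G) (subtopology SOT right_module_unitaries) left_regular"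
proof -
  have "continuous_map (top_of_set G) (product_topology (\<lambda>_. MS.mtopology) (g ` I)) left_regular"
    unfolding continuous_map_componentwise
  proof (intro conjI ballI)
    show "left_regular ` topspace (top_of_set G) \<subseteq> extensional (g ` I)" by (auto simp: left_regular_def)
    fix y assume "y \<in> g ` I"
    then obtain x where x: "x \<in> I" "y = g x" by blast
    have "continuous_map (top_of_set G) (top_of_set I) (\<lambda>u. u * x)"
      using x by (auto simp: continuous_map_in_subtopology ideal_mem intro!: continuous_intros)
    from continuous_map_compose[OF this continuous_map_g]
    show "continuous_map (top_of_set G) MS.mtopology (\<lambda>u. left_regular u y)"
      using x by (simp add: o_def)
  qed
  then have 1: "continuous_map (top_of_set G) (subtopology SOT right_module_unitaries) left_regular"
    using left_regular_right_module left_regular_unitary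
    by (auto simp: continuous_map_in_subtopology SOT_eq)
  have "continuous_map euclidean euclidean (\<lambda>z. 1 - unit_of_ideal + z)" by (auto intro!: continuous_intros)
  from continuous_map_compose[OF continuous_map_evaluate[OF unit_mem] this]
  have "continuous_map SOT euclidean value_at_unit" by (simp add: o_def value_at_unit_def[abs_def])
  then have 2: "continuous_map (subtopology SOT right_module_unitaries) (top_of_set G) value_at_unit"
    using right_module_unitary_is_left_regular(1)
    by (auto simp: continuous_map_in_subtopology intro: continuous_map_from_subtopology)
  have "homeomorphic_maps (top_of_set G) (subtopology SOT right_module_unitaries) left_regular value_at_unit"
    unfolding homeomorphic_maps_def
    using 1 2 value_left_regular right_module_unitary_is_left_regular(2) by auto
  then show ?thesis unfolding homeomorphic_map_maps by blast
qed

lemma left_regular_hom: "left_regular \<in> hom (ideal_unitary_group I) (unitary_group ideal_space)"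
proof (rule homI)
  fix u v assume u: "u \<in> G" and v: "v \<in> G"
  show "left_regular u \<in> carrier (unitary_group ideal_space)"
    using left_regular_unitary[OF u] by (simp add: unitary_group_def)
  have B: "left_regular u \<in> Bij (g ` I)" "left_regular v \<in> Bij (g ` I)"
    using left_regular_unitary u v by (simp_all add: unitary_operators_def ideal_space_simps)
  have "left_regular (u * v) = compose (g ` I) (left_regular u) (left_regular v)"
  proof (rule extensionalityI[of _ "g ` I"])
    fix y assume "y \<in> g ` I"
    then obtain x where x: "x \<in> I" "y = g x" by blast
    then show "left_regular (u * v) y = compose (g ` I) (left_regular u) (left_regular v) y"
      by (simp add: compose_eq ideal_mem mult.assoc)
  qed (simp_all add: left_regular_def)
  then show "left_regular (u \<otimes>\<^bsub>ideal_unitary_group I\<^esub> v) = left_regular u \<otimes>\<^bsub>unitary_group ideal_space\<^esub> left_regular v"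
    using B by (simp add: ideal_unitary_group_simps unitary_group_def BijGroup_def ideal_space_simps)
qed

lemma representable:
  "strongly_unitarily_representable TYPE('h) (ideal_unitary_group I) (top_of_set G)"
proof -
  interpret group_hom "ideal_unitary_group I" "unitary_group ideal_space" left_regular
    using group_ideal_unitary_group[OF ideal] IS.group_unitary_group left_regular_hom
    by (simp add: group_hom_def group_hom_axioms_def)
  have "subgroup right_module_unitaries (unitary_group ideal_space)"
    using img_is_subgroup by (simp add: left_regular_image)
  moreover have "inj_on left_regular G" using value_left_regular by (metis inj_onI)
  then have "left_regular \<in> iso (ideal_unitary_group I)
      ((unitary_group ideal_space)\<lparr>carrier := right_module_unitaries\<rparr>)"
    using left_regular_hom left_regular_right_module left_regular_image
    by (auto simp: iso_def hom_def bij_betw_def)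
  ultimately show ?thesis
    unfolding strongly_unitarily_representable_def
    using hausdorff_ideal_unitary_group[OF ideal] ideal_space_hilbert closedin_right_module_unitaries
      left_regular_homeomorphic_map by blast
qed

end

section \<open>The characterization\<close>

text \<open>
  A point is determined by the set of pairs \<open>(n, k)\<close> such that it lies within \<open>1/(k+1)\<close> of the \<open>n\<close>-th
  member of a dense sequence, so a separable metric space has at most continuum many points.
\<close>

lemma separable_injects:
  fixes S :: "'a::metric_space set"
  assumes sep: "separable_space (top_of_set S)" and u: "\<exists>f :: complex \<Rightarrow> 'h. inj f"
  shows "\<exists>g :: 'a \<Rightarrow> 'h. inj_on g S"
proof -
  obtain C where C: "countable C" "C \<subseteq> S" "top_of_set S closure_of C = S"
    using sep unfolding separable_space_def topspace_euclidean_subtopology by blast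
  define c where "c = from_nat_into C"
  have dense: "\<exists>n. dist x (c n) < e" if "x \<in> S" "e > 0" for x e
  proof -
    have "x \<in> top_of_set S closure_of C" using C(3) that(1) by simp
    moreover have "openin (top_of_set S) (S \<inter> ball x e)" "x \<in> S \<inter> ball x e"
      using that by (simp_all add: openin_open_Int)
    ultimately obtain y where y: "y \<in> C" "y \<in> S \<inter> ball x e" unfolding in_closure_of by blast
    then obtain n where "c n = y" using from_nat_into_surj[OF C(1)] by (metis c_def)
    then show ?thesis using y by (auto simp: dist_commute)
  qed
  define code where
    "code x = {m. dist x (c (fst (prod_decode m))) < inverse (real (Suc (snd (prod_decode m))))}" for x
  have mem: "prod_encode (n, k) \<in> code x \<longleftrightarrow> dist x (c n) < inverse (real (Suc k))" for n k x
    by (simp add: code_def)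
  have "inj_on code S"
  proof (rule inj_onI, rule ccontr)
    fix x y assume xy: "x \<in> S" "y \<in> S" "code x = code y" "x \<noteq> y"
    obtain k where k: "inverse (real (Suc k)) < dist x y / 2"
      using reals_Archimedean[of "dist x y / 2"] xy(4) by auto
    obtain n where n: "dist x (c n) < inverse (real (Suc k))" 
      using dense[OF xy(1), of "inverse (real (Suc k))"] by auto
    then have "dist y (c n) < inverse (real (Suc k))" using xy(3) mem by blast
    then have "dist x y < dist x y" using n k dist_triangle2[of x y "c n"] by linarith
    then show False by simp
  qed
  moreover obtain r :: "nat set \<Rightarrow> real" where "inj r"
    using nat_sets_eqpoll_reals by (auto simp: eqpoll_def bij_betw_def)
  moreover have "inj complex_of_real" by (rule injI) simp
  moreover obtain j :: "complex \<Rightarrow> 'h" where "inj j" using u by blast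
  ultimately have "inj (j \<circ> (complex_of_real \<circ> r))" by (simp add: inj_compose)
  with \<open>inj_on code S\<close> have "inj_on ((j \<circ> (complex_of_real \<circ> r)) \<circ> code) S"
    by (metis comp_inj_on inj_on_subset subset_UNIV)
  then show ?thesis by blast
qed

lemma finite_dimensional_imp_representable:
  fixes I :: "'a::unital_cstar_algebra set"
  assumes I: "closed_two_sided_ideal I" and fd: "finite_dimensional I" and g: "\<exists>g :: 'a \<Rightarrow> 'h. inj_on g I"
  shows "strongly_unitarily_representable TYPE('h) (ideal_unitary_group I)
           (top_of_set (carrier (ideal_unitary_group I)))"
proof -
  obtain P where P: "minimal_family I P" "\<forall>x\<in>I. x * \<Sum>P = x"
    using exists_total_minimal_family[OF I finite_dimensional_finite_spectra[OF I fd]] by blast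
  obtain g :: "'a \<Rightarrow> 'h" where g: "inj_on g I" using g by blast
  interpret embedded_family I P g
    using I P g by unfold_locales auto
  show ?thesis by (rule representable)
qed

theorem corollary3p10:
  fixes I :: "'a::unital_cstar_algebra set"
  assumes "closed_two_sided_ideal I"
    and "separable_space (top_of_set I)"
    and universe: "\<exists>f :: complex \<Rightarrow> 'h. inj f"
  shows "strongly_unitarily_representable TYPE('h) (ideal_unitary_group I)
           (top_of_set (carrier (ideal_unitary_group I)))
         \<longleftrightarrow> finite_dimensional I"
proof
  assume "strongly_unitarily_representable TYPE('h) (ideal_unitary_group I)
           (top_of_set (carrier (ideal_unitary_group I)))"
  then show "finite_dimensional I" by (rule representable_imp_finite_dimensional[OF assms(1)])
next
  assume "finite_dimensional I"
  then show "strongly_unitarily_representable TYPE('h) (ideal_unitary_group I)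
           (top_of_set (carrier (ideal_unitary_group I)))"
    by (rule finite_dimensional_imp_representable[OF assms(1) _ separable_injects[OF assms(2) universe]])
qed

end
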